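(* Let $\Omega\subset\mathbb{R}^N$ be a nonempty open and bounded Lipschitz set, let $\alpha\in(0,1)$ be fixed, and for $p>N/\alpha$ let $s_p=\alpha-\frac{N}{p}$. For $k\in\mathbb{N}$ define $$\lambda^{s_p}_{k,p}=\inf_{G\in\mathcal{G}^k_{s_p,p}}\ \sup_{v\in G}\ \frac{(1-s_p)[v]_{s_p,p}^p}{\|v\|_p^p},\qquad \Lambda^{\alpha}_{k,\infty}=\inf_{G\in\mathcal{G}^k_{\alpha,\infty}}\ \sup_{v\in G}\ \frac{\|D^\alpha v\|_{\infty}}{\|v\|_\infty}.$$ Then for every $k\in\mathbb{N}$ (with $k\ge1$), $$\lim_{p\to\infty}\big(\lambda^{s_p}_{k,p}\big)^{1/p}=\Lambda^\alpha_{k,\infty}.$$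
   Context: Functions on $\Omega$ are extended by $0$ to $\mathbb{R}^N$. For $0<s<1\le p<\infty$, $$[u]_{s,p}=\Big(\iint_{\mathbb{R}^N\times\mathbb{R}^N}\frac{|u(x)-u(y)|^p}{|x-y|^{N+sp}}\,dx\,dy\Big)^{1/p},$$ $W^{s,p}(\mathbb{R}^N)=\{u\in L^p(\mathbb{R}^N): [u]_{s,p}<\infty\}$ with norm $(\|u\|_p^p+[u]_{s,p}^p)^{1/p}$, and $W^{s,p}_0(\Omega)=\{u\in W^{s,p}(\mathbb{R}^N): u=0\text{ a.e. in }\mathbb{R}^N\setminus\Omega\}$. $C_0(\Omega)$ is the closure of $C_c(\Omega)$ in the sup norm. For $v\in C_0(\Omega)$, $D^\alpha v(x,y)=\frac{v(x)-v(y)}{|x-y|^\alpha}$ for $x\ne y\in\mathbb{R}^N$, $\|D^\alpha v\|_\infty$ is its norm in $L^\infty(\mathbb{R}^N\times\mathbb{R}^N)$, and $C_0^\alpha(\Omega)=\{v\in C_0(\Omega):\|D^\alpha v\|_\infty<\infty\}$ with norm $\|v\|_\infty+\|D^\alpha v\|_\infty$. Krasnoselskii genus: for a nonempty closed symmetric set $A=-A$ in a real Banach space, $\gamma(A)=\inf\{m\in\mathbb{N}: \text{there is a continuous odd map }\varphi\colon A\to\mathbb{R}^m\setminus\{0\}\}$, with $\inf\emptyset=\infty$. For $p<\infty$, $\mathcal{G}^k_{s,p}$ is the family of nonempty sets $G\subset W^{s,p}_0(\Omega)$ with $G=-G$, $G$ closed and bounded in $W^{s,p}_0(\Omega)$,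 $\|u\|_p=1$ for all $u\in G$, and $\gamma(G)\ge k$. $\mathcal{G}^k_{\alpha,\infty}$ is the family of nonempty sets $G\subset C_0^\alpha(\Omega)$ with $G=-G$, $G$ closed and bounded in $C_0^\alpha(\Omega)$, $\|u\|_\infty=1$ for all $u\in G$, and $\gamma(G)\ge k$. *)

theory Defs
  imports "HOL-Analysis.Analysis" "HOL-Probability.Essential_Supremum"
begin

text \<open>
  The space \<open>\<real>\<^sup>N\<close> is a type \<open>'a::euclidean_space\<close> with \<open>N = DIM('a)\<close>. Norms, seminorms and the
  min-max values are extended nonnegative reals, so that \<open>Inf {} = \<infinity>\<close> as usual.
\<close>

text \<open>Real powers on \<open>[0, \<infinity>]\<close>, meant for exponents \<open>r > 0\<close>.\<close>

definition ennreal_powr :: "ennreal \<Rightarrow> real \<Rightarrow> ennreal" (infixr "epowr" 80) where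
  "x epowr r = (if x = \<infinity> then \<infinity> else ennreal (enn2real x powr r))"


text \<open>
  Near every boundary point \<open>\<Omega>\<close> is the strict epigraph, in the direction of a unit vector \<open>e\<close>, of a
  Lipschitz function on the hyperplane orthogonal to \<open>e\<close>; \<open>x - (x \<bullet> e) *\<^sub>R e\<close> is the projection of
  \<open>x\<close> onto that hyperplane.
\<close>

definition lipschitz_set :: "'a::euclidean_space set \<Rightarrow> bool" where
  "lipschitz_set \<Omega> \<longleftrightarrow>
     (\<forall>z\<in>frontier \<Omega>. \<exists>r>0. \<exists>e. \<exists>g :: 'a \<Rightarrow> real. \<exists>L.
        norm e = 1 \<and> L-lipschitz_on {y. y \<bullet> e = 0} g \<and>
        \<Omega> \<inter> ball z r = {x \<in> ball z r. g (x - (x \<bullet> e) *\<^sub>R e) < x \<bullet> e})"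


text \<open>
  The topology of a (semi)norm on a set \<open>V\<close> of vectors. For a seminorm this is the topology of
  the associated quotient normed space pulled back to \<open>V\<close>: closed sets are unions of classes, and
  continuous maps into a Hausdorff space are constant on classes. Hence closed sets, their
  continuous maps and their genus are those of the quotient.
\<close>

definition seminorm_topology :: "'v::minus set \<Rightarrow> ('v \<Rightarrow> ennreal) \<Rightarrow> 'v topology" where
  "seminorm_topology V nrm =
     topology (\<lambda>U. U \<subseteq> V \<and> (\<forall>u\<in>U. \<exists>e>0. \<forall>v\<in>V. nrm (v - u) < ennreal e \<longrightarrow> v \<in> U))"

lemma openin_seminorm_topology:
  "openin (seminorm_topology V nrm) U \<longleftrightarrow>
     U \<subseteq> V \<and> (\<forall>u\<in>U. \<exists>e>0. \<forall>v\<in>V. nrm (v - u) < ennreal e \<longrightarrow> v \<in> U)"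
proof -
  let ?P = "\<lambda>U. U \<subseteq> V \<and> (\<forall>u\<in>U. \<exists>e>0. \<forall>v\<in>V. nrm (v - u) < ennreal e \<longrightarrow> v \<in> U)"
  have "?P (S \<inter> T)" if S: "?P S" and T: "?P T" for S T
  proof (intro conjI ballI)
    show "S \<inter> T \<subseteq> V" using S by blast
  next
    fix u assume u: "u \<in> S \<inter> T"
    obtain d where d: "d > 0" "\<forall>v\<in>V. nrm (v - u) < ennreal d \<longrightarrow> v \<in> S"
      using S u by blast
    obtain e where e: "e > 0" "\<forall>v\<in>V. nrm (v - u) < ennreal e \<longrightarrow> v \<in> T"
      using T u by blast
    have "nrm (v - u) < ennreal d \<and> nrm (v - u) < ennreal e"
      if "nrm (v - u) < ennreal (min d e)" for v
      using that by (meson ennreal_leI less_le_trans min.cobounded1 min.cobounded2)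
    then show "\<exists>e>0. \<forall>v\<in>V. nrm (v - u) < ennreal e \<longrightarrow> v \<in> S \<inter> T"
      using d e by (intro exI[of _ "min d e"]) auto
  qed
  moreover have "?P (\<Union>\<K>)" if K: "\<forall>S\<in>\<K>. ?P S" for \<K>
  proof (intro conjI ballI)
    show "\<Union>\<K> \<subseteq> V" using K by blast
  next
    fix u assume "u \<in> \<Union>\<K>"
    then obtain S where S: "S \<in> \<K>" "u \<in> S" by blast
    then obtain e where "e > 0" "\<forall>v\<in>V. nrm (v - u) < ennreal e \<longrightarrow> v \<in> S"
      using K by blast
    then show "\<exists>e>0. \<forall>v\<in>V. nrm (v - u) < ennreal e \<longrightarrow> v \<in> \<Union>\<K>"
      using S by blast
  qed
  ultimately have "istopology ?P"
    unfolding istopology_def by blast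
  then show ?thesis
    by (simp add: seminorm_topology_def)
qed

lemma topspace_seminorm_topology: "topspace (seminorm_topology V nrm) = V"
proof
  show "topspace (seminorm_topology V nrm) \<subseteq> V"
    unfolding topspace_def by (auto simp: openin_seminorm_topology)
  have "openin (seminorm_topology V nrm) V"
    by (auto simp: openin_seminorm_topology intro: exI[of _ 1])
  then show "V \<subseteq> topspace (seminorm_topology V nrm)"
    by (rule openin_subset)
qed


text \<open>
  Krasnoselskii genus. \<open>Euclidean_space m\<close> consists of the sequences \<open>nat \<Rightarrow> real\<close> vanishing from
  index \<open>m\<close> on.
\<close>

definition genus :: "'v::uminus topology \<Rightarrow> 'v set \<Rightarrow> enat" where
  "genus T A = Inf {enat m | m. \<exists>\<phi>.
     continuous_map (subtopology T A) (subtopology (Euclidean_space m) (- {\<lambda>_. 0})) \<phi> \<and>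
     (\<forall>u\<in>A. \<phi> (- u) = (\<lambda>i. - \<phi> u i))}"

text \<open>
  The admissible sets in the space \<open>V\<close> with norm \<open>nrm\<close>; \<open>sph\<close> is the weaker norm (\<open>\<parallel>\<cdot>\<parallel>\<^sub>p\<close> or
  \<open>\<parallel>\<cdot>\<parallel>\<^sub>\<infinity>\<close>) whose unit sphere contains the sets.
\<close>

definition genus_family ::
    "nat \<Rightarrow> 'v::{minus,uminus} set \<Rightarrow> ('v \<Rightarrow> ennreal) \<Rightarrow> ('v \<Rightarrow> ennreal) \<Rightarrow> 'v set set" where
  "genus_family k V nrm sph =
     {G. G \<noteq> {} \<and> G \<subseteq> V \<and> uminus ` G = G \<and>
         closedin (seminorm_topology V nrm) G \<and>
         (\<exists>C<\<infinity>. \<forall>u\<in>G. nrm u \<le> C) \<and>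
         (\<forall>u\<in>G. sph u = 1) \<and>
         enat k \<le> genus (seminorm_topology V nrm) G}"


text \<open>
  Fractional Sobolev spaces. Elements of \<open>L\<^sup>p\<close> are represented by their Borel measurable
  representatives (every Lebesgue measurable function has one), all of which are included; the norm
  below is thus a seminorm whose null space is the set of functions that vanish almost everywhere.
\<close>

definition Lp_norm :: "real \<Rightarrow> ('a::euclidean_space \<Rightarrow> real) \<Rightarrow> ennreal" where
  "Lp_norm p u = (\<integral>\<^sup>+x. ennreal (\<bar>u x\<bar> powr p) \<partial>lborel) epowr (1 / p)"

definition gagliardo :: "real \<Rightarrow> real \<Rightarrow> ('a::euclidean_space \<Rightarrow> real) \<Rightarrow> ennreal" where
  "gagliardo s p u =
     (\<integral>\<^sup>+(x, y). ennreal (\<bar>u x - u y\<bar> powr p / norm (x - y) powr (real DIM('a) + s * p))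
        \<partial>(lborel \<Otimes>\<^sub>M lborel)) epowr (1 / p)"

definition Wsp :: "real \<Rightarrow> real \<Rightarrow> ('a::euclidean_space \<Rightarrow> real) set" where
  "Wsp s p = {u \<in> borel_measurable borel. Lp_norm p u < \<infinity> \<and> gagliardo s p u < \<infinity>}"

definition Wsp_norm :: "real \<Rightarrow> real \<Rightarrow> ('a::euclidean_space \<Rightarrow> real) \<Rightarrow> ennreal" where
  "Wsp_norm s p u = (Lp_norm p u epowr p + gagliardo s p u epowr p) epowr (1 / p)"

definition Wsp0 :: "real \<Rightarrow> real \<Rightarrow> 'a::euclidean_space set \<Rightarrow> ('a \<Rightarrow> real) set" where
  "Wsp0 s p \<Omega> = {u \<in> Wsp s p. AE x in lborel. x \<notin> \<Omega> \<longrightarrow> u x = 0}"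


text \<open>
  Functions on \<open>\<Omega>\<close>, extended by zero, as bounded continuous functions on the whole space, whose
  norm is the sup norm.
\<close>

definition C_c :: "'a::euclidean_space set \<Rightarrow> ('a \<Rightarrow>\<^sub>C real) set" where
  "C_c \<Omega> = {v. compact (closure {x. apply_bcontfun v x \<noteq> 0}) \<and>
               closure {x. apply_bcontfun v x \<noteq> 0} \<subseteq> \<Omega>}"

definition C_0 :: "'a::euclidean_space set \<Rightarrow> ('a \<Rightarrow>\<^sub>C real) set" where
  "C_0 \<Omega> = closure (C_c \<Omega>)"

definition holder_seminorm :: "real \<Rightarrow> ('a::euclidean_space \<Rightarrow>\<^sub>C real) \<Rightarrow> ennreal" where
  "holder_seminorm \<alpha> v =
     esssup (lborel \<Otimes>\<^sub>M lborel)
       (\<lambda>(x, y). ennreal \<bar>(apply_bcontfun v x - apply_bcontfun v y) / norm (x - y) powr \<alpha>\<bar>)"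

definition C_0_holder :: "real \<Rightarrow> 'a::euclidean_space set \<Rightarrow> ('a \<Rightarrow>\<^sub>C real) set" where
  "C_0_holder \<alpha> \<Omega> = {v \<in> C_0 \<Omega>. holder_seminorm \<alpha> v < \<infinity>}"

definition holder_norm :: "real \<Rightarrow> ('a::euclidean_space \<Rightarrow>\<^sub>C real) \<Rightarrow> ennreal" where
  "holder_norm \<alpha> v = ennreal (norm v) + holder_seminorm \<alpha> v"


definition \<G>_p :: "nat \<Rightarrow> real \<Rightarrow> real \<Rightarrow> 'a::euclidean_space set \<Rightarrow> ('a \<Rightarrow> real) set set" where
  "\<G>_p k s p \<Omega> = genus_family k (Wsp0 s p \<Omega>) (Wsp_norm s p) (Lp_norm p)"

definition \<G>_infty :: "nat \<Rightarrow> real \<Rightarrow> 'a::euclidean_space set \<Rightarrow> ('a \<Rightarrow>\<^sub>C real) set set" where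
  "\<G>_infty k \<alpha> \<Omega> = genus_family k (C_0_holder \<alpha> \<Omega>) (holder_norm \<alpha>) (\<lambda>v. ennreal (norm v))"

definition lambda_p :: "nat \<Rightarrow> real \<Rightarrow> real \<Rightarrow> 'a::euclidean_space set \<Rightarrow> ennreal" where
  "lambda_p k s p \<Omega> =
     (INF G\<in>\<G>_p k s p \<Omega>. SUP v\<in>G.
        ennreal (1 - s) * gagliardo s p v epowr p / Lp_norm p v epowr p)"

definition Lambda_infty :: "nat \<Rightarrow> real \<Rightarrow> 'a::euclidean_space set \<Rightarrow> ennreal" where
  "Lambda_infty k \<alpha> \<Omega> =
     (INF G\<in>\<G>_infty k \<alpha> \<Omega>. SUP v\<in>G. holder_seminorm \<alpha> v / ennreal (norm v))"

end

theory Submission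
  imports Defs
begin

text \<open>
  Since \<open>N + s\<^sub>p p = \<alpha> p\<close>, the Gagliardo seminorm is the \<open>L\<^sup>p\<close> norm of \<open>D\<^sup>\<alpha> u\<close>. A sublevel set of a
  Rayleigh quotient is admissible as soon as it contains the image of an admissible set under a
  continuous odd map, because the genus does not decrease under such maps; no compactness is needed.
  For the upper bound the map is \<open>v \<mapsto> v / \<parallel>v\<parallel>\<^sub>p\<close>: \<open>\<bar>D\<^sup>\<alpha> v\<bar>\<close> is bounded and decays like \<open>\<bar>x - y\<bar>\<^sup>-\<^sup>\<alpha>\<close>, so
  its \<open>L\<^sup>p\<close> norm exceeds the bound only by a factor \<open>C\<^sup>1\<^sup>/\<^sup>p\<close>. For the lower bound \<open>u\<close> is
  averaged on two scales, cut off by a soft threshold and normalised in the sup norm. For large \<open>p\<close>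
  this does not increase the quotient by more than a factor close to 1, since \<open>\<parallel>D\<^sup>\<alpha> u\<parallel>\<^sub>p < b < \<mu>\<close> makes the
  integral of \<open>(\<bar>D\<^sup>\<alpha> u\<bar> / \<mu>)\<^sup>p\<close> tend to 0, while \<open>\<bar>D\<^sup>\<alpha> u\<bar> \<le> \<mu> (1 + (\<bar>D\<^sup>\<alpha> u\<bar> / \<mu>)\<^sup>p)\<close>. The
  Lipschitz condition is used only to ensure that balls around points outside \<open>\<Omega>\<close> meet the complement
  of \<open>\<Omega>\<close> in positive measure, which makes the averages small there.
\<close>


section \<open>Genus and seminorm topologies\<close>

text \<open>The constants must be exact in the limit: an embedding estimate of Morrey type whose
  constant does not tend to 1 would be useless for the lower bound. Averages avoid it. For two sets
  whose measures are fixed before p, the means of u differ by at most \<mu> times the \<alpha>-th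
  power of the largest distance between the sets, up to a factor 1 + \<kappa> / (product of the
  measures), where \<kappa> bounds the integral that tends to 0. Hence the threshold and all
  averaging scales are chosen before p, and only \<kappa> has to be small compared with them.

  The weight 1 - s_p lies between 1 - \<alpha> and 1 for large p, so it is harmless under a p-th
  root.

  The image of an admissible set need not be closed, which is why whole sublevel sets take its
  place. For the averaged functions, continuity in the Hoelder norm comes from interpolation between
  uniform closeness and a common Lipschitz bound; that bound may depend on p, since it does not
  enter the values of the quotients.\<close>

lemma epowr_ennreal: "0 \<le> x \<Longrightarrow> ennreal x epowr r = ennreal (x powr r)"
  by (simp add: ennreal_powr_def)

lemma epowr_epowr_inverse:
  assumes "0 < p"
  shows "(x epowr (1 / p)) epowr p = x"
  using assms by (cases x) (auto simp: ennreal_powr_def powr_powr)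

lemma epowr_inverse_epowr:
  assumes "0 < p"
  shows "(x epowr p) epowr (1 / p) = x"
  using assms by (cases x) (auto simp: ennreal_powr_def powr_powr)

lemma epowr_mono:
  assumes "0 < r" "x \<le> y"
  shows "x epowr r \<le> y epowr r"
proof (cases y)
  case (real b)
  moreover obtain a where "x = ennreal a" "0 \<le> a"
    using assms real by (cases x) (auto simp: top_unique)
  ultimately show ?thesis
    using assms by (auto simp: ennreal_powr_def intro!: ennreal_leI powr_mono2)
qed (simp add: ennreal_powr_def)

lemma epowr_le_iff:
  assumes "0 < p"
  shows "x epowr (1 / p) \<le> y \<longleftrightarrow> x \<le> y epowr p"
  using epowr_mono[of p "x epowr (1 / p)" y] epowr_mono[of "1 / p" x "y epowr p"] assms
  by (auto simp: epowr_epowr_inverse epowr_inverse_epowr)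

lemma epowr_eq_one_iff:
  assumes "0 < p"
  shows "x epowr (1 / p) = 1 \<longleftrightarrow> x = 1"
  using assms epowr_epowr_inverse[OF assms, of x] by (auto simp: ennreal_powr_def)

lemma epowr_cmult:
  assumes "0 < r" "0 \<le> a"
  shows "(ennreal a * x) epowr r = ennreal (a powr r) * (x epowr r)"
proof (cases x)
  case (real b)
  then show ?thesis
    using assms by (simp add: epowr_ennreal powr_mult flip: ennreal_mult)
next
  case top
  show ?thesis
    using assms top by (cases "a = 0") (auto simp: ennreal_powr_def ennreal_mult_top)
qed

text \<open>Convexity of the p-th power at \<open>x / (1 - \<theta>)\<close> and
  \<open>y / \<theta>\<close>, which average to \<open>x + y\<close> with the weights
  \<open>1 - \<theta>\<close> and \<open>\<theta>\<close>. Convexity is applied to positive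
  arguments; if a summand is 0, it is enough that both coefficients are at least 1.\<close>

lemma powr_add_le:
  fixes x y p \<theta> :: real
  assumes "1 \<le> p" "0 < \<theta>" "\<theta> < 1" "0 \<le> x" "0 \<le> y"
  shows "(x + y) powr p \<le> (1 - \<theta>) powr (1 - p) * x powr p + \<theta> powr (1 - p) * y powr p"
proof -
  have ge: "z powr p \<le> t powr (1 - p) * z powr p" if "0 < t" "t < 1" for t z :: real
  proof -
    have "1 powr (1 - p) \<le> t powr (1 - p)"
      using that assms by (intro powr_mono2') auto
    then show ?thesis
      using mult_right_mono[of 1 "t powr (1 - p)" "z powr p"] by simp
  qed
  have scale: "t * (z / t) powr p = t powr (1 - p) * z powr p" if "0 < t" "0 \<le> z" for t z :: real
    using that by (simp add: powr_divide powr_diff)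
  show ?thesis
  proof (cases "x = 0 \<or> y = 0")
    case True
    then show ?thesis
      using ge[of "1 - \<theta>" x] ge[of \<theta> y] assms by auto
  next
    case False
    have "((1 - \<theta>) *\<^sub>R (x / (1 - \<theta>)) + \<theta> *\<^sub>R (y / \<theta>)) powr p
        \<le> (1 - \<theta>) * (x / (1 - \<theta>)) powr p + \<theta> * (y / \<theta>) powr p"
      using assms False by (intro convex_onD[OF powr_convex]) auto
    then show ?thesis
      using assms by (simp add: scale)
  qed
qed

text \<open>
  Minkowski's inequality: the inequalities with parameter \<open>\<theta>\<close> come from convexity of \<open>t\<^sup>p\<close>
  under an integral sign, and \<open>\<theta> = B / (A + B)\<close> is optimal.
\<close>

lemma Minkowski_epowr:
  fixes a b c :: ennreal
  assumes p: "1 \<le> p"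
    and le: "\<And>\<theta>. 0 < \<theta> \<Longrightarrow> \<theta> < 1 \<Longrightarrow>
      c \<le> ennreal ((1 - \<theta>) powr (1 - p)) * a + ennreal (\<theta> powr (1 - p)) * b"
  shows "c epowr (1 / p) \<le> a epowr (1 / p) + b epowr (1 / p)"
proof (cases "a = \<infinity> \<or> b = \<infinity>")
  case True
  then show ?thesis by (auto simp: ennreal_powr_def)
next
  case False
  then obtain x y where x: "a = ennreal x" "0 \<le> x" and y: "b = ennreal y" "0 \<le> y"
    by (cases a; cases b) auto
  \<comment> \<open>A single value of \<theta> already shows that c is finite.\<close>
  have "c \<le> ennreal ((1 - 1/2) powr (1 - p)) * a + ennreal ((1/2) powr (1 - p)) * b"
    by (rule le) auto
  then obtain z where z: "c = ennreal z" "0 \<le> z"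
    using x y by (cases c) (auto simp: top_unique simp flip: ennreal_mult ennreal_plus)
  have "z powr (1 / p) \<le> (x powr (1 / p) + y powr (1 / p)) + e" if e: "e > 0" for e
  proof -
    \<comment> \<open>The summands \<open>e / 2\<close> keep A and B positive even if x or y
      vanishes, so that \<theta> lies strictly between 0 and 1.\<close>
    define A where "A = x powr (1 / p) + e / 2"
    define B where "B = y powr (1 / p) + e / 2"
    have AB: "0 < A" "0 < B"
      using e by (auto simp: A_def B_def add_nonneg_pos)
    have root: "t \<le> (t powr (1 / p) + e / 2) powr p" if "0 \<le> t" for t
    proof -
      have "t = (t powr (1 / p)) powr p"
        using p that by (simp add: powr_powr)
      also have "\<dots> \<le> (t powr (1 / p) + e / 2) powr p"
        using p e by (intro powr_mono2) auto
      finally show ?thesis .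
    qed
    define \<theta> where "\<theta> = B / (A + B)"
    have \<theta>: "0 < \<theta>" "\<theta> < 1" "1 - \<theta> = A / (A + B)"
      using AB by (auto simp: \<theta>_def field_simps)
    \<comment> \<open>For this \<theta> both terms carry the factor
      \<open>(A + B) powr (p - 1)\<close>, and they add up to \<open>(A + B) powr p\<close>.\<close>
    have weight: "(t / (A + B)) powr (1 - p) * t powr p = t * (A + B) powr (p - 1)" if "0 < t" for t
    proof -
      have "(A + B) powr (p - 1) = 1 / (A + B) powr (1 - p)"
        by (simp flip: powr_minus_divide)
      moreover have "t powr (1 - p) * t powr p = t"
        using that by (simp flip: powr_add)
      ultimately show ?thesis
        by (simp add: powr_divide)
    qed
    have "z \<le> (1 - \<theta>) powr (1 - p) * x + \<theta> powr (1 - p) * y"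
      using le[OF \<theta>(1,2)] x y z by (simp flip: ennreal_mult ennreal_plus)
    also have "\<dots> \<le> (1 - \<theta>) powr (1 - p) * A powr p + \<theta> powr (1 - p) * B powr p"
      using root x y by (intro add_mono mult_left_mono) (auto simp: A_def B_def)
    also have "(1 - \<theta>) powr (1 - p) * A powr p = A * (A + B) powr (p - 1)"
      using AB by (simp add: \<theta> weight)
    also have "\<theta> powr (1 - p) * B powr p = B * (A + B) powr (p - 1)"
      using AB by (simp add: \<theta>_def weight)
    also have "A * (A + B) powr (p - 1) + B * (A + B) powr (p - 1) = (A + B) powr p"
      using AB powr_add[of "A + B" 1 "p - 1"] by (simp add: distrib_right)
    finally have "z powr (1 / p) \<le> ((A + B) powr p) powr (1 / p)"
      using p z by (intro powr_mono2) auto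
    also have "\<dots> = A + B"
      using AB p by (simp add: powr_powr)
    finally show ?thesis by (simp add: A_def B_def)
  qed
  then have "z powr (1 / p) \<le> x powr (1 / p) + y powr (1 / p)"
    by (rule field_le_epsilon)
  then show ?thesis
    by (simp add: x y z epowr_ennreal flip: ennreal_plus)
qed

lemma nn_integral_powr_add_le:
  assumes [measurable]: "f \<in> borel_measurable M" "g \<in> borel_measurable M"
    and p: "1 \<le> p" "0 < \<theta>" "\<theta> < 1"
  shows "(\<integral>\<^sup>+x. ennreal (\<bar>f x + g x :: real\<bar> powr p) \<partial>M)
    \<le> ennreal ((1 - \<theta>) powr (1 - p)) * (\<integral>\<^sup>+x. ennreal (\<bar>f x\<bar> powr p) \<partial>M)
      + ennreal (\<theta> powr (1 - p)) * (\<integral>\<^sup>+x. ennreal (\<bar>g x\<bar> powr p) \<partial>M)"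
proof -
  have "\<bar>f x + g x\<bar> powr p
      \<le> (1 - \<theta>) powr (1 - p) * \<bar>f x\<bar> powr p + \<theta> powr (1 - p) * \<bar>g x\<bar> powr p" for x
    by (rule order_trans[OF powr_mono2 powr_add_le]) (use p in auto)
  then have "(\<integral>\<^sup>+x. ennreal (\<bar>f x + g x\<bar> powr p) \<partial>M)
    \<le> (\<integral>\<^sup>+x. ennreal ((1 - \<theta>) powr (1 - p)) * ennreal (\<bar>f x\<bar> powr p)
      + ennreal (\<theta> powr (1 - p)) * ennreal (\<bar>g x\<bar> powr p) \<partial>M)"
    by (intro nn_integral_mono) (simp flip: ennreal_mult ennreal_plus)
  also have "\<dots> = ennreal ((1 - \<theta>) powr (1 - p)) * (\<integral>\<^sup>+x. ennreal (\<bar>f x\<bar> powr p) \<partial>M)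
      + ennreal (\<theta> powr (1 - p)) * (\<integral>\<^sup>+x. ennreal (\<bar>g x\<bar> powr p) \<partial>M)"
    by (simp add: nn_integral_add nn_integral_cmult)
  finally show ?thesis .
qed

lemma nn_integral_powr_cmult:
  assumes [measurable]: "f \<in> borel_measurable M"
  shows "(\<integral>\<^sup>+x. ennreal (\<bar>a * f x :: real\<bar> powr p) \<partial>M)
    = ennreal (\<bar>a\<bar> powr p) * (\<integral>\<^sup>+x. ennreal (\<bar>f x\<bar> powr p) \<partial>M)"
  by (simp add: abs_mult powr_mult ennreal_mult nn_integral_cmult)

text \<open>Integrated, this replaces the Hoelder and Jensen inequalities, at the cost of a factor.\<close>

lemma le_add_powr:
  fixes t s p :: real
  assumes "0 \<le> t" "0 < s" "1 \<le> p"
  shows "t \<le> s + s * (t / s) powr p"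
proof (cases "t \<le> s")
  case True
  then show ?thesis using assms by (simp add: add_increasing2)
next
  case False
  then have "t / s \<le> (t / s) powr p"
    using assms powr_mono[of 1 p "t / s"] by simp
  then have "t \<le> s * (t / s) powr p"
    using assms by (simp add: field_simps)
  then show ?thesis using assms by linarith
qed

section \<open>Topologies of seminorms and the transport of the genus\<close>

lemma openin_seminorm_ball:
  assumes tri: "\<And>u v w. u \<in> V \<Longrightarrow> v \<in> V \<Longrightarrow> w \<in> V \<Longrightarrow> nrm (u - w) \<le> nrm (u - v) + nrm (v - w)"
    and u: "u \<in> V"
  shows "openin (seminorm_topology V nrm) {w \<in> V. nrm (w - u) < ennreal d}"
  unfolding openin_seminorm_topology
proof (intro conjI ballI)
  fix w assume "w \<in> {w \<in> V. nrm (w - u) < ennreal d}"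
  then have w: "w \<in> V" "nrm (w - u) < ennreal d" by auto
  then obtain r where r: "nrm (w - u) = ennreal r" "0 \<le> r" "r < d"
    by (cases "nrm (w - u)") (auto simp: ennreal_less_iff)
  define e where "e = d - r"
  have "nrm (v - u) < ennreal d" if v: "v \<in> V" "nrm (v - w) < ennreal e" for v
  proof -
    obtain t where t: "nrm (v - w) = ennreal t" "0 \<le> t" "t < e"
      using v by (cases "nrm (v - w)") (auto simp: ennreal_less_iff)
    have "nrm (v - u) \<le> ennreal t + ennreal r"
      using tri[OF v(1) w(1) u] t r by simp
    also have "\<dots> < ennreal d"
      using t r by (simp add: e_def ennreal_less_iff flip: ennreal_plus)
    finally show ?thesis .
  qed
  then show "\<exists>e>0. \<forall>v\<in>V. nrm (v - w) < ennreal e \<longrightarrow> v \<in> {w \<in> V. nrm (w - u) < ennreal d}"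
    using r by (intro exI[of _ e]) (auto simp: e_def)
qed auto

text \<open>The estimate is available only between points of \<open>G\<close>, so the preimage of an
  open set \<open>U\<close> is exhibited as the trace on \<open>G\<close> of a union
  \<open>W\<close> of balls that are open in \<open>V\<close>. The pairs in \<open>D\<close> are the
  centres and radii for which \<open>R\<close> maps the part of the ball in \<open>G\<close> into
  \<open>U\<close>.\<close>

lemma continuous_map_seminorm_topology:
  assumes tri: "\<And>u v w. u \<in> V \<Longrightarrow> v \<in> V \<Longrightarrow> w \<in> V \<Longrightarrow> nrm (u - w) \<le> nrm (u - v) + nrm (v - w)"
    and refl: "\<And>u. u \<in> V \<Longrightarrow> nrm (u - u) = 0"
    and G: "G \<subseteq> V" "R ` G \<subseteq> G'" "G' \<subseteq> V'"
    and cont: "\<And>u e. u \<in> G \<Longrightarrow> 0 < e \<Longrightarrow>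
      \<exists>d>0. \<forall>v\<in>G. nrm (v - u) < ennreal d \<longrightarrow> nrm' (R v - R u) < ennreal e"
  shows "continuous_map (subtopology (seminorm_topology V nrm) G)
    (subtopology (seminorm_topology V' nrm') G') R"
proof (rule continuous_map_into_subtopology)
  show "continuous_map (subtopology (seminorm_topology V nrm) G) (seminorm_topology V' nrm') R"
    unfolding continuous_map_def topspace_subtopology topspace_seminorm_topology
  proof (intro conjI allI impI)
    show "R \<in> V \<inter> G \<rightarrow> V'"
      using G by auto
  next
    fix U assume U: "openin (seminorm_topology V' nrm') U"
    define D where "D = {(u, d). u \<in> G \<and> 0 < d \<and> (\<forall>w\<in>G. nrm (w - u) < ennreal d \<longrightarrow> R w \<in> U)}"
    define W where "W = (\<Union>(u, d)\<in>D. {w \<in> V. nrm (w - u) < ennreal d})"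
    have "openin (seminorm_topology V nrm) W"
      unfolding W_def using G(1)
      by (intro openin_Union) (auto simp: D_def intro!: openin_seminorm_ball intro: tri)
    moreover have "{x \<in> V \<inter> G. R x \<in> U} = W \<inter> G"
    proof (intro equalityI subsetI)
      fix x assume x: "x \<in> {x \<in> V \<inter> G. R x \<in> U}"
      then obtain e where e: "e > 0" "\<forall>v\<in>V'. nrm' (v - R x) < ennreal e \<longrightarrow> v \<in> U"
        using U unfolding openin_seminorm_topology by blast
      obtain d where d: "d > 0" "\<forall>v\<in>G. nrm (v - x) < ennreal d \<longrightarrow> nrm' (R v - R x) < ennreal e"
        using cont[of x e] x e by blast
      have "R w \<in> U" if "w \<in> G" "nrm (w - x) < ennreal d" for w
        using that d e G by blast
      then have "(x, d) \<in> D"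
        using x d by (auto simp: D_def)
      moreover have "nrm (x - x) < ennreal d"
        using refl[of x] x d by simp
      ultimately show "x \<in> W \<inter> G"
        using x unfolding W_def by blast
    next
      fix x assume "x \<in> W \<inter> G"
      then show "x \<in> {x \<in> V \<inter> G. R x \<in> U}"
        by (auto simp: W_def D_def)
    qed
    ultimately show "openin (subtopology (seminorm_topology V nrm) G) {x \<in> V \<inter> G. R x \<in> U}"
      by (auto simp: openin_subtopology)
  qed
  show "R \<in> topspace (subtopology (seminorm_topology V nrm) G) \<rightarrow> G'"
    using G by (auto simp: topspace_subtopology)
qed

lemma genus_le_of_odd_map:
  assumes cont: "continuous_map (subtopology T G) (subtopology T' G') R"
    and img: "R ` G \<subseteq> G'"
    and odd: "\<And>u. u \<in> G \<Longrightarrow> R (- u) = - R u"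
  shows "genus T G \<le> genus T' G'"
  unfolding genus_def
proof (rule Inf_superset_mono, safe)
  fix m \<phi>
  assume \<phi>: "continuous_map (subtopology T' G') (subtopology (Euclidean_space m) (- {\<lambda>_. 0})) \<phi>"
    "\<forall>u\<in>G'. \<phi> (- u) = (\<lambda>i. - \<phi> u i)"
  have "continuous_map (subtopology T G) (subtopology (Euclidean_space m) (- {\<lambda>_. 0})) (\<phi> \<circ> R)"
    by (rule continuous_map_compose[OF cont \<phi>(1)])
  moreover have "\<forall>u\<in>G. (\<phi> \<circ> R) (- u) = (\<lambda>i. - (\<phi> \<circ> R) u i)"
    using \<phi>(2) img odd by auto
  ultimately show "\<exists>m'. enat m = enat m' \<and> (\<exists>\<phi>.
     continuous_map (subtopology T G) (subtopology (Euclidean_space m') (- {\<lambda>_. 0})) \<phi> \<and>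
     (\<forall>u\<in>G. \<phi> (- u) = (\<lambda>i. - \<phi> u i)))"
    by blast
qed

text \<open>A point outside the set satisfies one of three strict inequalities
  \<open>B u < A u\<close>, where A and B are constant or 1-Lipschitz with respect to
  \<open>nrm\<close>. Such an inequality survives on the ball whose radius is half the gap; this is
  the local fact \<open>gap\<close>.\<close>

lemma closedin_seminorm_sublevel:
  assumes sph: "\<And>u v. u \<in> V \<Longrightarrow> v \<in> V \<Longrightarrow> sph u \<le> sph v + nrm (v - u)"
      "\<And>u v. u \<in> V \<Longrightarrow> v \<in> V \<Longrightarrow> sph v \<le> sph u + nrm (v - u)"
    and F: "\<And>u v. u \<in> V \<Longrightarrow> v \<in> V \<Longrightarrow> F u \<le> F v + nrm (v - u)"
    and fin: "\<And>u. u \<in> V \<Longrightarrow> sph u < \<infinity>" "\<And>u. u \<in> V \<Longrightarrow> F u < \<infinity>"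
    and c: "c < \<infinity>"
  shows "closedin (seminorm_topology V nrm) {u \<in> V. sph u = 1 \<and> F u \<le> c}"
proof -
  have gap: "\<exists>e>0. \<forall>v\<in>V. nrm (v - u) < ennreal e \<longrightarrow> \<not> A v \<le> B v"
    if lip: "\<And>v. v \<in> V \<Longrightarrow> A u \<le> A v + nrm (v - u)" "\<And>v. v \<in> V \<Longrightarrow> B v \<le> B u + nrm (v - u)"
      and u: "A u < \<infinity>" "B u < A u" for A B :: "'a \<Rightarrow> ennreal" and u
  proof -
    obtain a b where ab: "A u = ennreal a" "0 \<le> a" "B u = ennreal b" "0 \<le> b" "b < a"
      using u by (cases "A u"; cases "B u") (auto simp: ennreal_less_iff)
    have "\<not> A v \<le> B v" if v: "v \<in> V" "nrm (v - u) < ennreal ((a - b) / 2)" for v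
    proof
      assume le: "A v \<le> B v"
      obtain t where t: "nrm (v - u) = ennreal t" "0 \<le> t" "t < (a - b) / 2"
        using v by (cases "nrm (v - u)") (auto simp: ennreal_less_iff)
      have "ennreal a \<le> A v + ennreal t" using lip(1)[OF v(1)] ab t by simp
      also have "\<dots> \<le> (ennreal b + ennreal t) + ennreal t"
        using lip(2)[OF v(1)] le ab t by (intro add_right_mono) auto
      also have "\<dots> = ennreal (b + t + t)"
        using ab t by (simp flip: ennreal_plus)
      finally have "a \<le> b + t + t"
        using ab t by (simp add: ennreal_le_iff del: ennreal_plus)
      then show False
        using t by simp
    qed
    then show ?thesis using ab by (intro exI[of _ "(a - b) / 2"]) auto
  qed
  show ?thesis
    unfolding closedin_def topspace_seminorm_topology openin_seminorm_topology
  proof (intro conjI ballI)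
    fix u assume "u \<in> V - {u \<in> V. sph u = 1 \<and> F u \<le> c}"
    then have u: "u \<in> V" and "sph u < 1 \<or> 1 < sph u \<or> c < F u"
      by auto
    then consider "sph u < 1" | "1 < sph u" | "c < F u" by blast
    then have "\<exists>e>0. \<forall>v\<in>V. nrm (v - u) < ennreal e \<longrightarrow> sph v \<noteq> 1 \<or> \<not> F v \<le> c"
    proof cases
      case 1
      then have "\<exists>e>0. \<forall>v\<in>V. nrm (v - u) < ennreal e \<longrightarrow> \<not> 1 \<le> sph v"
        using sph(2) u by (intro gap[of "\<lambda>_. 1" u sph]) auto
      then show ?thesis by fastforce
    next
      case 2
      then have "\<exists>e>0. \<forall>v\<in>V. nrm (v - u) < ennreal e \<longrightarrow> \<not> sph v \<le> 1"
        using sph(1) u fin by (intro gap[of sph u "\<lambda>_. 1"]) auto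
      then show ?thesis by fastforce
    next
      case 3
      then have "\<exists>e>0. \<forall>v\<in>V. nrm (v - u) < ennreal e \<longrightarrow> \<not> F v \<le> c"
        using F u fin by (intro gap[of F u "\<lambda>_. c"]) auto
      then show ?thesis by blast
    qed
    then show "\<exists>e>0. \<forall>v\<in>V. nrm (v - u) < ennreal e \<longrightarrow> v \<in> V - {u \<in> V. sph u = 1 \<and> F u \<le> c}"
      by auto
  qed auto
qed

text \<open>The image of \<open>G\<close> under \<open>R\<close> may fail to be closed, whereas the
  sublevel set is closed and bounded by construction; containing the image, it has genus at least k.
  Both inequalities of the theorem use this, with the roles of the two spaces exchanged. The sort
  \<open>{minus, uminus}\<close> carries no laws, so the vector space facts, even
  \<open>- (- u) = u\<close>, appear as assumptions.\<close>

lemma sublevel_in_genus_family: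
  fixes R :: "'v::{minus,uminus} \<Rightarrow> 'w::{minus,uminus}"
  assumes G: "G \<in> genus_family k V nrm sph0"
    and tri: "\<And>u v w. u \<in> V \<Longrightarrow> v \<in> V \<Longrightarrow> w \<in> V \<Longrightarrow> nrm (u - w) \<le> nrm (u - v) + nrm (v - w)"
    and refl: "\<And>u. u \<in> V \<Longrightarrow> nrm (u - u) = 0"
    and img: "\<And>u. u \<in> G \<Longrightarrow> R u \<in> V' \<and> sph (R u) = 1 \<and> F (R u) \<le> c"
    and odd: "\<And>u. u \<in> G \<Longrightarrow> R (- u) = - R u"
    and cont: "\<And>u e. u \<in> G \<Longrightarrow> 0 < e \<Longrightarrow>
      \<exists>d>0. \<forall>v\<in>G. nrm (v - u) < ennreal d \<longrightarrow> nrm' (R v - R u) < ennreal e"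
    and lip: "\<And>u v. u \<in> V' \<Longrightarrow> v \<in> V' \<Longrightarrow> sph u \<le> sph v + nrm' (v - u)"
      "\<And>u v. u \<in> V' \<Longrightarrow> v \<in> V' \<Longrightarrow> sph v \<le> sph u + nrm' (v - u)"
      "\<And>u v. u \<in> V' \<Longrightarrow> v \<in> V' \<Longrightarrow> F u \<le> F v + nrm' (v - u)"
    and fin: "\<And>u. u \<in> V' \<Longrightarrow> sph u < \<infinity>" "\<And>u. u \<in> V' \<Longrightarrow> F u < \<infinity>" "c < \<infinity>"
    and bound: "\<And>u. u \<in> V' \<Longrightarrow> nrm' u \<le> sph u + F u"
    and sym: "\<And>u. u \<in> V' \<Longrightarrow> - u \<in> V' \<and> sph (- u) = sph u \<and> F (- u) = F u \<and> - (- u) = u"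
  shows "{u \<in> V'. sph u = 1 \<and> F u \<le> c} \<in> genus_family k V' nrm' sph"
proof -
  let ?G = "{u \<in> V'. sph u = 1 \<and> F u \<le> c}"
  have G': "G \<noteq> {}" "G \<subseteq> V" "enat k \<le> genus (seminorm_topology V nrm) G"
    using G by (auto simp: genus_family_def)
  have RG: "R ` G \<subseteq> ?G" using img by auto
  have cm: "continuous_map (subtopology (seminorm_topology V nrm) G)
      (subtopology (seminorm_topology V' nrm') ?G) R"
    by (rule continuous_map_seminorm_topology[OF _ refl G'(2) RG _ cont]) (auto intro: tri)
  have "enat k \<le> genus (seminorm_topology V' nrm') ?G"
    using genus_le_of_odd_map[OF cm RG odd] G'(3) by auto
  moreover have "?G \<noteq> {}" using RG G'(1) by blast
  moreover have "uminus ` ?G = ?G"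
  proof -
    have "u \<in> uminus ` ?G" if "u \<in> ?G" for u
      using that sym[of u] by (intro image_eqI[of _ _ "- u"]) auto
    moreover have "u \<in> ?G" if "u \<in> uminus ` ?G" for u
      using that sym by auto
    ultimately show ?thesis by blast
  qed
  moreover have "\<exists>C<\<infinity>. \<forall>u\<in>?G. nrm' u \<le> C"
  proof (intro exI[of _ "1 + c"] conjI ballI)
    fix u assume "u \<in> ?G"
    then have "nrm' u \<le> 1 + F u" "F u \<le> c"
      using bound[of u] by auto
    then show "nrm' u \<le> 1 + c"
      by (metis add_left_mono order_trans)
  qed (use fin in auto)
  moreover have "closedin (seminorm_topology V' nrm') ?G"
    by (intro closedin_seminorm_sublevel lip fin)
  ultimately show ?thesis
    by (auto simp: genus_family_def)
qed


section \<open>The norms\<close>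

text \<open>The function \<open>D\<^sup>\<alpha> u\<close> on pairs of points; on the diagonal it
  has the default value 0.\<close>

definition hquot :: "real \<Rightarrow> ('a::euclidean_space \<Rightarrow> real) \<Rightarrow> 'a \<times> 'a \<Rightarrow> real" where
  "hquot \<alpha> u = (\<lambda>(x, y). (u x - u y) / norm (x - y) powr \<alpha>)"

lemma measurable_hquot [measurable]:
  assumes [measurable]: "u \<in> borel_measurable borel"
  shows "hquot \<alpha> u \<in> borel_measurable (lborel \<Otimes>\<^sub>M lborel)"
  unfolding hquot_def by measurable

lemma hquot_add: "hquot \<alpha> (\<lambda>x. u x + v x) z = hquot \<alpha> u z + hquot \<alpha> v z"
  by (simp add: hquot_def case_prod_beta add_divide_distrib diff_divide_distrib)

lemma hquot_cmult: "hquot \<alpha> (\<lambda>x. a * u x) z = a * hquot \<alpha> u z"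
  by (simp add: hquot_def case_prod_beta flip: right_diff_distrib)

lemma gagliardo_eq:
  fixes u :: "'a::euclidean_space \<Rightarrow> real"
  assumes "0 < p"
  shows "gagliardo s p u =
    (\<integral>\<^sup>+z. ennreal (\<bar>hquot (s + real DIM('a) / p) u z\<bar> powr p) \<partial>(lborel \<Otimes>\<^sub>M lborel)) epowr (1 / p)"
proof -
  have "real DIM('a) + s * p = (s + real DIM('a) / p) * p"
    using assms by (simp add: field_simps)
  then have "\<bar>u x - u y\<bar> powr p / norm (x - y) powr (real DIM('a) + s * p)
      = \<bar>hquot (s + real DIM('a) / p) u (x, y)\<bar> powr p" for x y
    by (simp add: hquot_def powr_divide powr_powr)
  then show ?thesis
    by (simp add: gagliardo_def case_prod_beta')
qed

lemma Wsp_norm_eq: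
  fixes u :: "'a::euclidean_space \<Rightarrow> real"
  assumes "0 < p"
  shows "Wsp_norm s p u =
    ((\<integral>\<^sup>+x. ennreal (\<bar>u x\<bar> powr p) \<partial>lborel) +
     (\<integral>\<^sup>+z. ennreal (\<bar>hquot (s + real DIM('a) / p) u z\<bar> powr p) \<partial>(lborel \<Otimes>\<^sub>M lborel))) epowr (1 / p)"
  using assms by (simp add: Wsp_norm_def Lp_norm_def gagliardo_eq epowr_epowr_inverse)

text \<open>For \<open>Wsp_norm\<close> the inequalities with parameter \<theta> for the two
  integrals are added before \<theta> is optimised, so that one use of
  \<open>Minkowski_epowr\<close> covers the outer p-th root of the sum.\<close>

lemma
  fixes u v :: "'a::euclidean_space \<Rightarrow> real"
  assumes [measurable]: "u \<in> borel_measurable borel" "v \<in> borel_measurable borel" and p: "1 \<le> p"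
  shows Lp_norm_add: "Lp_norm p (\<lambda>x. u x + v x) \<le> Lp_norm p u + Lp_norm p v"
    and gagliardo_add: "gagliardo s p (\<lambda>x. u x + v x) \<le> gagliardo s p u + gagliardo s p v"
    and Wsp_norm_add: "Wsp_norm s p (\<lambda>x. u x + v x) \<le> Wsp_norm s p u + Wsp_norm s p v"
proof -
  let ?I = "\<lambda>u. \<integral>\<^sup>+x. ennreal (\<bar>u x :: real\<bar> powr p) \<partial>(lborel :: 'a measure)"
  let ?J = "\<lambda>u :: 'a \<Rightarrow> real. \<integral>\<^sup>+z. ennreal (\<bar>hquot (s + real DIM('a) / p) u z\<bar> powr p) \<partial>(lborel \<Otimes>\<^sub>M lborel)"
  let ?S = "\<lambda>\<theta> a b. ennreal ((1 - \<theta>) powr (1 - p)) * a + ennreal (\<theta> powr (1 - p)) * (b :: ennreal)"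
  have I: "?I (\<lambda>x. u x + v x) \<le> ?S \<theta> (?I u) (?I v)" if "0 < \<theta>" "\<theta> < 1" for \<theta>
    using p that by (intro nn_integral_powr_add_le) auto
  have J: "?J (\<lambda>x. u x + v x) \<le> ?S \<theta> (?J u) (?J v)" if "0 < \<theta>" "\<theta> < 1" for \<theta>
    unfolding hquot_add using p that by (intro nn_integral_powr_add_le) auto
  have "?I (\<lambda>x. u x + v x) + ?J (\<lambda>x. u x + v x) \<le> ?S \<theta> (?I u + ?J u) (?I v + ?J v)"
    if "0 < \<theta>" "\<theta> < 1" for \<theta>
    using add_mono[OF I[OF that] J[OF that]] by (simp add: algebra_simps)
  note Minkowski_epowr[OF p this]
  then show "Wsp_norm s p (\<lambda>x. u x + v x) \<le> Wsp_norm s p u + Wsp_norm s p v"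
    using p by (simp add: Wsp_norm_eq)
  show "Lp_norm p (\<lambda>x. u x + v x) \<le> Lp_norm p u + Lp_norm p v"
    unfolding Lp_norm_def using p I by (rule Minkowski_epowr)
  show "gagliardo s p (\<lambda>x. u x + v x) \<le> gagliardo s p u + gagliardo s p v"
    using p Minkowski_epowr[OF p J] by (simp add: gagliardo_eq)
qed

lemma
  fixes u :: "'a::euclidean_space \<Rightarrow> real"
  assumes [measurable]: "u \<in> borel_measurable borel" and p: "0 < p"
  shows Lp_norm_cmult: "Lp_norm p (\<lambda>x. a * u x) = ennreal \<bar>a\<bar> * Lp_norm p u"
    and gagliardo_cmult: "gagliardo s p (\<lambda>x. a * u x) = ennreal \<bar>a\<bar> * gagliardo s p u"
    and Wsp_norm_cmult: "Wsp_norm s p (\<lambda>x. a * u x) = ennreal \<bar>a\<bar> * Wsp_norm s p u"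
proof -
  have *: "(ennreal (\<bar>a\<bar> powr p) * b) epowr (1 / p) = ennreal \<bar>a\<bar> * b epowr (1 / p)" for b
    using p by (simp add: epowr_cmult powr_powr)
  show "Lp_norm p (\<lambda>x. a * u x) = ennreal \<bar>a\<bar> * Lp_norm p u"
    by (simp add: Lp_norm_def nn_integral_powr_cmult *)
  show "gagliardo s p (\<lambda>x. a * u x) = ennreal \<bar>a\<bar> * gagliardo s p u"
    using p by (simp add: gagliardo_eq hquot_cmult nn_integral_powr_cmult *)
  show "Wsp_norm s p (\<lambda>x. a * u x) = ennreal \<bar>a\<bar> * Wsp_norm s p u"
    using p by (simp add: Wsp_norm_eq hquot_cmult nn_integral_powr_cmult * flip: distrib_left)
qed

lemma
  fixes u :: "'a::euclidean_space \<Rightarrow> real"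
  assumes p: "0 < p"
  shows Lp_norm_le_Wsp_norm: "Lp_norm p u \<le> Wsp_norm s p u"
    and gagliardo_le_Wsp_norm: "gagliardo s p u \<le> Wsp_norm s p u"
proof -
  have "Lp_norm p u = (Lp_norm p u epowr p) epowr (1 / p)"
    "gagliardo s p u = (gagliardo s p u epowr p) epowr (1 / p)"
    using p by (simp_all add: epowr_inverse_epowr)
  then show "Lp_norm p u \<le> Wsp_norm s p u" "gagliardo s p u \<le> Wsp_norm s p u"
    using p by (auto simp: Wsp_norm_def intro: order_trans[OF eq_refl epowr_mono])
qed

text \<open>Subadditivity of the p-th root is the case of \<open>Minkowski_epowr\<close> in which
  the bound holds because both coefficients are at least 1.\<close>

lemma Wsp_norm_le:
  assumes p: "1 \<le> p"
  shows "Wsp_norm s p u \<le> Lp_norm p u + gagliardo s p u"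
proof -
  let ?a = "Lp_norm p u epowr p" and ?b = "gagliardo s p u epowr p"
  have ge: "x \<le> ennreal (t powr (1 - p)) * x" if "0 < t" "t < 1" for t :: real and x :: ennreal
  proof -
    have "1 powr (1 - p) \<le> t powr (1 - p)"
      using that p by (intro powr_mono2') auto
    then show ?thesis
      using mult_right_mono[of 1 "ennreal (t powr (1 - p))" x] by simp
  qed
  have "?a + ?b \<le> ennreal ((1 - \<theta>) powr (1 - p)) * ?a + ennreal (\<theta> powr (1 - p)) * ?b"
    if "0 < \<theta>" "\<theta> < 1" for \<theta>
    using that by (intro add_mono ge) auto
  from Minkowski_epowr[OF p this] show ?thesis
    using p by (simp add: Wsp_norm_def epowr_inverse_epowr)
qed

lemma Wsp_norm_diff_self: "0 < p \<Longrightarrow> Wsp_norm s p (u - u) = 0"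
  by (simp add: Wsp_norm_eq hquot_def split_beta ennreal_powr_def)

lemma borel_measurable_fun_diff:
  fixes u v :: "'a \<Rightarrow> real"
  assumes [measurable]: "u \<in> borel_measurable M" "v \<in> borel_measurable M"
  shows "u - v \<in> borel_measurable M"
  unfolding fun_diff_def by measurable

lemma Wsp_norm_triangle:
  fixes u v w :: "'a::euclidean_space \<Rightarrow> real"
  assumes "u \<in> borel_measurable borel" "v \<in> borel_measurable borel" "w \<in> borel_measurable borel"
    and p: "1 \<le> p"
  shows "Wsp_norm s p (u - w) \<le> Wsp_norm s p (u - v) + Wsp_norm s p (v - w)"
proof -
  have "Wsp_norm s p (\<lambda>x. (u - v) x + (v - w) x) \<le> Wsp_norm s p (u - v) + Wsp_norm s p (v - w)"
    using assms by (intro Wsp_norm_add borel_measurable_fun_diff)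
  then show ?thesis by (simp add: fun_diff_def)
qed

lemma
  fixes u v :: "'a::euclidean_space \<Rightarrow> real"
  assumes [measurable]: "u \<in> borel_measurable borel" "v \<in> borel_measurable borel" and p: "1 \<le> p"
  shows Lp_norm_le_add: "Lp_norm p u \<le> Lp_norm p v + Wsp_norm s p (v - u)"
    and Lp_norm_le_add': "Lp_norm p v \<le> Lp_norm p u + Wsp_norm s p (v - u)"
    and gagliardo_le_add: "gagliardo s p u \<le> gagliardo s p v + Wsp_norm s p (v - u)"
proof -
  note minus = borel_measurable_fun_diff
  have sym: "u - v = (\<lambda>x. (-1) * (v - u) x)" for u v :: "'a \<Rightarrow> real" by auto
  have "Lp_norm p (\<lambda>x. u x + (v - u) x) \<le> Lp_norm p u + Lp_norm p (v - u)"
    using p by (intro Lp_norm_add minus) auto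
  also have "\<dots> \<le> Lp_norm p u + Wsp_norm s p (v - u)"
    using p by (intro add_mono Lp_norm_le_Wsp_norm) auto
  finally show "Lp_norm p v \<le> Lp_norm p u + Wsp_norm s p (v - u)" by simp
  have eq: "Wsp_norm s p (v - u) = Wsp_norm s p (u - v)"
    using p by (subst sym, subst Wsp_norm_cmult) (auto intro: minus)
  have "Lp_norm p (\<lambda>x. v x + (u - v) x) \<le> Lp_norm p v + Lp_norm p (u - v)"
    using p by (intro Lp_norm_add minus) auto
  also have "\<dots> \<le> Lp_norm p v + Wsp_norm s p (v - u)"
    unfolding eq using p by (intro add_mono Lp_norm_le_Wsp_norm) auto
  finally show "Lp_norm p u \<le> Lp_norm p v + Wsp_norm s p (v - u)" by simp
  have "gagliardo s p (\<lambda>x. v x + (u - v) x) \<le> gagliardo s p v + gagliardo s p (u - v)"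
    using p by (intro gagliardo_add minus) auto
  also have "\<dots> \<le> gagliardo s p v + Wsp_norm s p (v - u)"
    unfolding eq using p by (intro add_mono gagliardo_le_Wsp_norm) auto
  finally show "gagliardo s p u \<le> gagliardo s p v + Wsp_norm s p (v - u)" by simp
qed

lemma Wsp0_scale:
  assumes "u \<in> Wsp0 s p \<Omega>" "0 < p"
  shows "(\<lambda>x. a * u x) \<in> Wsp0 s p \<Omega>"
  using assms
  by (auto simp: Wsp0_def Wsp_def Lp_norm_cmult gagliardo_cmult ennreal_mult_less_top)

lemma
  assumes "u \<in> Wsp0 s p \<Omega>" "0 < p"
  shows uminus_Wsp0: "- u \<in> Wsp0 s p \<Omega>"
    and Lp_norm_uminus: "Lp_norm p (- u) = Lp_norm p u"
    and gagliardo_uminus: "gagliardo s p (- u) = gagliardo s p u"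
proof -
  have [measurable]: "u \<in> borel_measurable borel"
    using assms by (auto simp: Wsp0_def Wsp_def)
  have eq: "- u = (\<lambda>x. (-1) * u x)" by auto
  show "- u \<in> Wsp0 s p \<Omega>" "Lp_norm p (- u) = Lp_norm p u" "gagliardo s p (- u) = gagliardo s p u"
    unfolding eq using Wsp0_scale[OF assms, of "-1"]
      Lp_norm_cmult[of u p "-1"] gagliardo_cmult[of u p s "-1"] assms(2) by simp_all
qed

section \<open>Hoelder functions vanishing outside \<Omega>\<close>

lemma C_0_eq_0:
  assumes "v \<in> C_0 \<Omega>" "x \<notin> \<Omega>"
  shows "apply_bcontfun v x = 0"
proof (rule ccontr)
  assume "apply_bcontfun v x \<noteq> 0"
  then have "0 < \<bar>apply_bcontfun v x\<bar>" by simp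
  then obtain w where w: "w \<in> C_c \<Omega>" "dist w v < \<bar>apply_bcontfun v x\<bar>"
    using assms(1) unfolding C_0_def closure_approachable by blast
  have "apply_bcontfun w x = 0"
    using w(1) assms(2) closure_subset[of "{x. apply_bcontfun w x \<noteq> 0}"]
    by (auto simp: C_c_def)
  then show False
    using w(2) dist_bounded[of w x v] by (simp add: dist_real_def)
qed

lemma measurable_bcontfun [measurable]:
  fixes v :: "'a::euclidean_space \<Rightarrow>\<^sub>C real"
  shows "apply_bcontfun v \<in> borel_measurable borel"
  by (intro borel_measurable_continuous_onI) auto

lemma holder_seminorm_alt:
  "holder_seminorm \<alpha> v = esssup (lborel \<Otimes>\<^sub>M lborel) (\<lambda>z. ennreal \<bar>hquot \<alpha> (apply_bcontfun v) z\<bar>)"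
  unfolding holder_seminorm_def hquot_def by (intro arg_cong2[where f = esssup] refl ext) auto

lemma abs_hquot_le_iff:
  assumes "0 \<le> L"
  shows "\<bar>hquot \<alpha> u (x, y)\<bar> \<le> L \<longleftrightarrow> \<bar>u x - u y\<bar> \<le> L * norm (x - y) powr \<alpha>"
  using assms by (cases "x = y") (auto simp: hquot_def field_simps)

lemma open_eq_empty_of_AE:
  fixes S :: "'a::euclidean_space set"
  assumes "open S" "AE z in lborel. z \<notin> S"
  shows "S = {}"
proof (rule ccontr)
  assume "S \<noteq> {}"
  then obtain x e where e: "0 < e" "ball x e \<subseteq> S"
    using assms(1) by (metis all_not_in_conv openE)
  have "ball x e \<in> null_sets lborel"
    using assms(2) e by (subst AE_iff_null_sets) (auto elim!: eventually_mono)
  then have "measure lborel (ball x e) = 0"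
    by (auto simp: null_sets_def measure_def)
  then show False using e by simp
qed

text \<open>The set of pairs violating the pointwise bound is open because v is continuous, and null
  by definition of the essential supremum; hence it is empty. From here on the seminorm is used only
  as a Hoelder bound valid at all points.\<close>

lemma holder_seminorm_le_iff:
  fixes v :: "'a::euclidean_space \<Rightarrow>\<^sub>C real"
  assumes L: "0 \<le> L" and \<alpha>: "0 < \<alpha>"
  shows "holder_seminorm \<alpha> v \<le> ennreal L \<longleftrightarrow>
    (\<forall>x y. \<bar>apply_bcontfun v x - apply_bcontfun v y\<bar> \<le> L * norm (x - y) powr \<alpha>)"
proof
  assume le: "holder_seminorm \<alpha> v \<le> ennreal L"
  let ?bad = "{z :: 'a \<times> 'a. L * norm (fst z - snd z) powr \<alpha> < \<bar>apply_bcontfun v (fst z) - apply_bcontfun v (snd z)\<bar>}"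
  have "AE z in lborel \<Otimes>\<^sub>M lborel. ennreal \<bar>hquot \<alpha> (apply_bcontfun v) z\<bar> \<le> ennreal L"
    using esssup_AE[where M = "lborel \<Otimes>\<^sub>M lborel" and
        f = "\<lambda>z. ennreal \<bar>hquot \<alpha> (apply_bcontfun v) z\<bar>"] le
    unfolding holder_seminorm_alt by (auto elim: order_trans)
  then have "AE z in lborel. z \<notin> ?bad"
    unfolding lborel_prod
  proof eventually_elim
    case (elim z)
    then show ?case
      using abs_hquot_le_iff[OF L, of \<alpha> "apply_bcontfun v" "fst z" "snd z"] L by simp
  qed
  moreover have "open ?bad"
  proof (rule open_Collect_less)
    show "continuous_on UNIV (\<lambda>z :: 'a \<times> 'a. L * norm (fst z - snd z) powr \<alpha>)"
      using \<alpha> by (intro continuous_on_mult continuous_on_powr' continuous_intros) auto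
    have "continuous_on UNIV (\<lambda>z :: 'a \<times> 'a. apply_bcontfun v (fst z))"
      "continuous_on UNIV (\<lambda>z :: 'a \<times> 'a. apply_bcontfun v (snd z))"
      by (rule continuous_on_compose2[of UNIV "apply_bcontfun v"]; auto intro: continuous_intros)+
    then show "continuous_on UNIV (\<lambda>z :: 'a \<times> 'a. \<bar>apply_bcontfun v (fst z) - apply_bcontfun v (snd z)\<bar>)"
      by (intro continuous_intros)
  qed
  ultimately have "?bad = {}"
    by (intro open_eq_empty_of_AE)
  then show "\<forall>x y. \<bar>apply_bcontfun v x - apply_bcontfun v y\<bar> \<le> L * norm (x - y) powr \<alpha>"
    by (auto simp: not_less)
next
  assume "\<forall>x y. \<bar>apply_bcontfun v x - apply_bcontfun v y\<bar> \<le> L * norm (x - y) powr \<alpha>"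
  then have "\<bar>hquot \<alpha> (apply_bcontfun v) z\<bar> \<le> L" for z
    by (cases z) (simp add: abs_hquot_le_iff[OF L])
  then show "holder_seminorm \<alpha> v \<le> ennreal L"
    unfolding holder_seminorm_alt by (intro esssup_I AE_I2 ennreal_leI) auto
qed

lemma holder_seminorm_uminus: "holder_seminorm \<alpha> (- v) = holder_seminorm \<alpha> v"
proof -
  have "\<bar>hquot \<alpha> (apply_bcontfun (- v)) z\<bar> = \<bar>hquot \<alpha> (apply_bcontfun v) z\<bar>" for z
    by (cases z) (simp add: hquot_def abs_minus_commute)
  then show ?thesis by (simp add: holder_seminorm_alt)
qed

lemma holder_seminorm_add:
  assumes \<alpha>: "0 < \<alpha>"
  shows "holder_seminorm \<alpha> (u + v) \<le> holder_seminorm \<alpha> u + holder_seminorm \<alpha> v"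
proof (cases "holder_seminorm \<alpha> u = \<infinity> \<or> holder_seminorm \<alpha> v = \<infinity>")
  case False
  then obtain a b where ab: "holder_seminorm \<alpha> u = ennreal a" "0 \<le> a"
      "holder_seminorm \<alpha> v = ennreal b" "0 \<le> b"
    by (cases "holder_seminorm \<alpha> u"; cases "holder_seminorm \<alpha> v") auto
  have *: "\<bar>apply_bcontfun u x - apply_bcontfun u y\<bar> \<le> a * norm (x - y) powr \<alpha>"
      "\<bar>apply_bcontfun v x - apply_bcontfun v y\<bar> \<le> b * norm (x - y) powr \<alpha>" for x y
    using holder_seminorm_le_iff[of a \<alpha> u] holder_seminorm_le_iff[of b \<alpha> v] ab \<alpha> by auto
  have "\<bar>apply_bcontfun (u + v) x - apply_bcontfun (u + v) y\<bar> \<le> (a + b) * norm (x - y) powr \<alpha>" for x y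
    using *[of x y] by (simp add: distrib_right)
  then have "holder_seminorm \<alpha> (u + v) \<le> ennreal (a + b)"
    using ab \<alpha> by (subst holder_seminorm_le_iff) auto
  then show ?thesis using ab by simp
qed auto

lemma holder_norm_triangle:
  assumes \<alpha>: "0 < \<alpha>"
  shows "holder_norm \<alpha> (u - w) \<le> holder_norm \<alpha> (u - v) + holder_norm \<alpha> (v - w)"
proof -
  have "ennreal (norm (u - w)) \<le> ennreal (norm (u - v)) + ennreal (norm (v - w))"
    using norm_triangle_ineq[of "u - v" "v - w"] by (simp flip: ennreal_plus)
  moreover have "holder_seminorm \<alpha> (u - w) \<le> holder_seminorm \<alpha> (u - v) + holder_seminorm \<alpha> (v - w)"
    using holder_seminorm_add[OF \<alpha>, of "u - v" "v - w"] by simp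
  ultimately show ?thesis
    unfolding holder_norm_def by (metis (no_types, lifting) add.assoc add.left_commute add_mono)
qed

lemma holder_norm_0:
  assumes "0 < \<alpha>"
  shows "holder_norm \<alpha> 0 = 0"
  using holder_seminorm_le_iff[of 0 \<alpha> 0] assms by (simp add: holder_norm_def)

lemma
  assumes \<alpha>: "0 < \<alpha>"
  shows norm_le_add_holder_norm: "ennreal (norm u) \<le> ennreal (norm v) + holder_norm \<alpha> (v - u)"
    and norm_le_add_holder_norm': "ennreal (norm v) \<le> ennreal (norm u) + holder_norm \<alpha> (v - u)"
    and holder_seminorm_le_add: "holder_seminorm \<alpha> u \<le> holder_seminorm \<alpha> v + holder_norm \<alpha> (v - u)"
proof -
  have "ennreal (norm u) \<le> ennreal (norm v) + ennreal (norm (v - u))"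
    "ennreal (norm v) \<le> ennreal (norm u) + ennreal (norm (v - u))"
    using norm_triangle_ineq2[of u v] norm_triangle_ineq2[of v u]
    by (simp_all add: norm_minus_commute flip: ennreal_plus)
  then show "ennreal (norm u) \<le> ennreal (norm v) + holder_norm \<alpha> (v - u)"
    "ennreal (norm v) \<le> ennreal (norm u) + holder_norm \<alpha> (v - u)"
    unfolding holder_norm_def by (auto elim!: order_trans intro!: add_left_mono)
  have "holder_seminorm \<alpha> (v + - (v - u)) \<le> holder_seminorm \<alpha> v + holder_seminorm \<alpha> (- (v - u))"
    by (rule holder_seminorm_add[OF \<alpha>])
  also have "\<dots> \<le> holder_seminorm \<alpha> v + holder_norm \<alpha> (v - u)"
    unfolding holder_seminorm_uminus holder_norm_def by (intro add_left_mono) auto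
  finally show "holder_seminorm \<alpha> u \<le> holder_seminorm \<alpha> v + holder_norm \<alpha> (v - u)" by simp
qed

lemma uminus_C_0: "v \<in> C_0 \<Omega> \<Longrightarrow> - v \<in> C_0 \<Omega>"
  unfolding C_0_def closure_approachable
proof safe
  fix e :: real assume v: "\<forall>e>0. \<exists>w\<in>C_c \<Omega>. dist w v < e" and "0 < e"
  then obtain w where w: "w \<in> C_c \<Omega>" "dist w v < e" by blast
  have "- w \<in> C_c \<Omega>" using w(1) by (simp add: C_c_def)
  moreover have "dist (- w) (- v) < e"
    using w(2) by (simp add: dist_norm norm_minus_commute)
  ultimately show "\<exists>w\<in>C_c \<Omega>. dist w (- v) < e" by blast
qed

lemma uminus_C_0_holder: "v \<in> C_0_holder \<alpha> \<Omega> \<Longrightarrow> - v \<in> C_0_holder \<alpha> \<Omega>"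
  by (simp add: C_0_holder_def uminus_C_0 holder_seminorm_uminus)


section \<open>Hoelder functions in fractional Sobolev spaces\<close>

lemma measure_ball_pos:
  fixes x :: "'a::euclidean_space"
  shows "0 < r \<Longrightarrow> 0 < measure lborel (ball x r)"
  by simp

lemma measure_ball_eq:
  fixes x y :: "'a::euclidean_space"
  shows "measure lborel (ball x r) = measure lborel (ball y r)"
  by (cases "0 \<le> r") (simp_all add: content_ball ball_empty)

lemma emeasure_ball_eq_measure:
  fixes x :: "'a::euclidean_space"
  shows "emeasure lborel (ball x r) = ennreal (measure lborel (ball x r))"
  using emeasure_lborel_ball_finite[of x r] by (intro emeasure_eq_ennreal_measure) simp

text \<open>The balls of integer radii around \<open>x\<close> make the convergence of the integral that of \<open>\<Sum>n\<^sup>-\<^sup>2\<close>.\<close>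

lemma nn_integral_kernel_bounded:
  fixes \<alpha> q :: real
  assumes \<alpha>: "0 < \<alpha>" and c: "0 \<le> c" and q: "q = real (DIM('a) + 2) / \<alpha>"
  shows "\<exists>C. \<forall>x :: 'a::euclidean_space.
    (\<integral>\<^sup>+y. ennreal (min 1 (c * norm (x - y) powr - \<alpha>) powr q) \<partial>lborel) \<le> ennreal C"
proof -
  define N where "N = DIM('a)"
  \<comment> \<open>The summand 1 serves n = 0. For n \<ge> 1 the lower bound n for t is replaced by
    (n + 1) / 2, which costs the factor 2^(N + 2).\<close>
  define c' where "c' = 1 + c powr q * 2 ^ (N + 2)"
  define b where "b n = c' / real (n + 1) ^ (N + 2)" for n
  define V where "V = unit_ball_vol (real N)"
  have c': "1 \<le> c'" by (simp add: c'_def)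
  have q': "0 < q" "\<alpha> * q = real (N + 2)"
    using \<alpha> by (auto simp: q N_def)
  have le_b: "min 1 (c * t powr - \<alpha>) powr q \<le> b n"
    if t: "real n \<le> t" for t n
  proof (cases "n = 0")
    case True
    have "min 1 (c * t powr - \<alpha>) powr q \<le> 1 powr q"
      using c q' by (intro powr_mono2) auto
    then show ?thesis using True c' by (simp add: b_def)
  next
    case False
    then have n: "0 < real (n + 1) / 2" "real (n + 1) / 2 \<le> t"
      using t by auto
    have "min 1 (c * t powr - \<alpha>) powr q \<le> (c * (real (n + 1) / 2) powr - \<alpha>) powr q"
      using c q' n \<alpha> by (intro powr_mono2 min.coboundedI2 mult_left_mono powr_mono2') auto
    also have "\<dots> = c powr q * (real (n + 1) / 2) powr - real (N + 2)"
      using c q' by (simp add: powr_mult powr_powr)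
    also have "\<dots> = c powr q * 2 ^ (N + 2) / real (n + 1) ^ (N + 2)"
      using n(1) by (simp only: powr_minus powr_realpow power_divide inverse_eq_divide) simp
    also have "\<dots> \<le> b n"
      unfolding b_def c'_def by (intro divide_right_mono) auto
    finally show ?thesis .
  qed
  have "(\<integral>\<^sup>+y. ennreal (min 1 (c * norm (x - y) powr - \<alpha>) powr q) \<partial>lborel)
      \<le> ennreal (\<Sum>n. c' * V * inverse (real (Suc n) ^ 2))" for x :: 'a
  proof -
    have summ: "summable (\<lambda>n. c' * V * inverse (real (Suc n) ^ 2))"
      using summable_Suc_iff[THEN iffD2, OF inverse_power_summable[of 2, where 'a = real]]
      by (intro summable_mult) simp
    have "(\<integral>\<^sup>+y. ennreal (min 1 (c * norm (x - y) powr - \<alpha>) powr q) \<partial>lborel)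
        \<le> (\<integral>\<^sup>+y. (\<Sum>n. ennreal (b n) * indicator (ball x (real (n + 1))) y) \<partial>lborel)"
    proof (intro nn_integral_mono)
      fix y :: 'a
      define n where "n = nat \<lfloor>norm (x - y)\<rfloor>"
      have n: "real n \<le> norm (x - y)" "norm (x - y) < real (n + 1)"
        unfolding n_def using norm_ge_zero[of "x - y"] by linarith+
      have "ennreal (min 1 (c * norm (x - y) powr - \<alpha>) powr q)
          \<le> ennreal (b n) * indicator (ball x (real (n + 1))) y"
        using le_b[OF n(1)] n(2) by (auto simp: dist_norm indicator_def intro: ennreal_leI)
      also have "\<dots> \<le> (\<Sum>n. ennreal (b n) * indicator (ball x (real (n + 1))) y)"
      proof -
        have "f n \<le> suminf f" for f :: "nat \<Rightarrow> ennreal"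
          using sum_le_suminf[of f "{n}"] by simp
        then show ?thesis .
      qed
      finally show "ennreal (min 1 (c * norm (x - y) powr - \<alpha>) powr q) \<le> \<dots>" .
    qed
    also have "\<dots> = (\<Sum>n. ennreal (b n) * emeasure lborel (ball x (real (n + 1))))"
    proof -
      have "(\<lambda>y. ennreal (b n) * indicator (ball x (real (n + 1))) y) \<in> borel_measurable lborel" for n
        by (intro borel_measurable_times_ennreal borel_measurable_indicator) auto
      then show ?thesis
        by (subst nn_integral_suminf) (simp_all add: nn_integral_cmult_indicator del: of_nat_add of_nat_Suc)
    qed
    also have "\<dots> = (\<Sum>n. ennreal (c' * V * inverse (real (Suc n) ^ 2)))"
    proof (intro suminf_cong)
      fix n
      have "b n * (V * real (n + 1) ^ N) = c' * V * inverse (real (Suc n) ^ 2)"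
        by (simp add: b_def power_add inverse_eq_divide power2_eq_square del: of_nat_add of_nat_Suc)
      then show "ennreal (b n) * emeasure lborel (ball x (real (n + 1)))
          = ennreal (c' * V * inverse (real (Suc n) ^ 2))"
        using c' by (simp add: emeasure_ball N_def V_def b_def flip: ennreal_mult)
    qed
    also have "\<dots> = ennreal (\<Sum>n. c' * V * inverse (real (Suc n) ^ 2))"
      using summ c' by (intro suminf_ennreal2) (auto simp: V_def)
    finally show ?thesis .
  qed
  then show ?thesis by blast
qed

text \<open>The constant is uniform in p because everything is compared with the fixed exponent q =
  (N + 2) / \<alpha>: the quotient divided by H is at most 1, so raising it to the power p \<ge> q
  only makes it smaller. Its q-th power lies below the kernel, whose integral in one variable is
  bounded uniformly in the other. Only pairs with a point in \<Omega> contribute, which gives the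
  factor 2 times the measure of \<Omega>.\<close>

lemma nn_integral_hquot_le:
  fixes \<Omega> :: "'a::euclidean_space set"
  assumes \<Omega>: "open \<Omega>" "bounded \<Omega>" and \<alpha>: "0 < \<alpha>" and c: "0 \<le> c"
  obtains C where "0 \<le> C"
    and "\<And>u H p. \<lbrakk>u \<in> borel_measurable borel; \<And>x. x \<notin> \<Omega> \<Longrightarrow> u x = 0; 0 < H;
        \<And>x y. \<bar>u x - u y\<bar> \<le> H * norm (x - y) powr \<alpha>; \<And>x y. \<bar>u x - u y\<bar> \<le> c * H;
        real (DIM('a) + 2) / \<alpha> \<le> p\<rbrakk> \<Longrightarrow>
      (\<integral>\<^sup>+z. ennreal (\<bar>hquot \<alpha> u z\<bar> powr p) \<partial>(lborel \<Otimes>\<^sub>M lborel)) \<le> ennreal (H powr p * C)"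
proof -
  define q where "q = real (DIM('a) + 2) / \<alpha>"
  define h where "h x y = ennreal (min 1 (c * norm (x - y) powr - \<alpha>) powr q)" for x y :: 'a
  obtain C where C: "\<And>x :: 'a. (\<integral>\<^sup>+y. h x y \<partial>lborel) \<le> ennreal C"
    using nn_integral_kernel_bounded[OF \<alpha> c q_def] unfolding h_def by blast
  define m where "m = measure lborel \<Omega>"
  have meas_h [measurable]: "case_prod h \<in> borel_measurable (lborel \<Otimes>\<^sub>M lborel)"
    unfolding h_def by measurable
  have [measurable]: "\<Omega> \<in> sets borel" using \<Omega> by simp
  have fin: "emeasure lborel \<Omega> = ennreal m"
    unfolding m_def using emeasure_bounded_finite[OF \<Omega>(2)] by (intro emeasure_eq_ennreal_measure) auto
  have q: "0 < q" using \<alpha> by (simp add: q_def)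
  show ?thesis
  proof (rule that[of "2 * m * max 0 C"])
    show "0 \<le> 2 * m * max 0 C" by (simp add: m_def)
  next
    fix u :: "'a \<Rightarrow> real" and H p :: real
    assume [measurable]: "u \<in> borel_measurable borel"
      and u0: "\<And>x. x \<notin> \<Omega> \<Longrightarrow> u x = 0" and H: "0 < H"
      and hol: "\<And>x y. \<bar>u x - u y\<bar> \<le> H * norm (x - y) powr \<alpha>"
      and bd: "\<And>x y. \<bar>u x - u y\<bar> \<le> c * H"
      and p: "real (DIM('a) + 2) / \<alpha> \<le> p"
    have pt: "ennreal (\<bar>hquot \<alpha> u (x, y)\<bar> powr p)
        \<le> ennreal (H powr p) * (h x y * indicator \<Omega> x + h x y * indicator \<Omega> y)" for x y
    proof (cases "(x \<in> \<Omega> \<or> y \<in> \<Omega>) \<and> x \<noteq> y")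
      case False
      then have "hquot \<alpha> u (x, y) = 0" using u0 by (auto simp: hquot_def)
      then show ?thesis by simp
    next
      case True
      have le1: "\<bar>hquot \<alpha> u (x, y)\<bar> / H \<le> 1"
        using hol[of x y] True H by (simp add: hquot_def field_simps)
      have "\<bar>hquot \<alpha> u (x, y)\<bar> / H \<le> c * norm (x - y) powr - \<alpha>"
        using bd[of x y] True H by (simp add: hquot_def powr_minus field_simps)
      then have "(\<bar>hquot \<alpha> u (x, y)\<bar> / H) powr q \<le> min 1 (c * norm (x - y) powr - \<alpha>) powr q"
        using le1 q H by (intro powr_mono2) auto
      moreover have "(\<bar>hquot \<alpha> u (x, y)\<bar> / H) powr p \<le> (\<bar>hquot \<alpha> u (x, y)\<bar> / H) powr q"
        using le1 p H by (intro powr_mono') (auto simp: q_def)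
      ultimately have "(\<bar>hquot \<alpha> u (x, y)\<bar> / H) powr p \<le> min 1 (c * norm (x - y) powr - \<alpha>) powr q"
        by linarith
      then have "\<bar>hquot \<alpha> u (x, y)\<bar> powr p
          \<le> H powr p * min 1 (c * norm (x - y) powr - \<alpha>) powr q"
        using H by (simp add: powr_divide pos_divide_le_eq mult.commute)
      then have "ennreal (\<bar>hquot \<alpha> u (x, y)\<bar> powr p) \<le> ennreal (H powr p) * h x y"
        by (simp add: h_def flip: ennreal_mult)
      also have "\<dots> \<le> ennreal (H powr p) * (h x y * indicator \<Omega> x + h x y * indicator \<Omega> y)"
        using True by (intro mult_left_mono) (auto simp: indicator_def)
      finally show ?thesis .
    qed
    have h_sym: "h x y = h y x" for x y
      by (simp add: h_def norm_minus_commute)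
    have A: "(\<integral>\<^sup>+z. h (fst z) (snd z) * indicator \<Omega> (fst z) \<partial>(lborel \<Otimes>\<^sub>M lborel)) \<le> ennreal (max 0 C) * ennreal m"
    proof -
      have "(\<integral>\<^sup>+z. h (fst z) (snd z) * indicator \<Omega> (fst z) \<partial>(lborel \<Otimes>\<^sub>M lborel))
          = (\<integral>\<^sup>+x. \<integral>\<^sup>+y. h x y * indicator \<Omega> x \<partial>lborel \<partial>lborel)"
        by (subst lborel.nn_integral_fst[symmetric]) (auto simp: split_beta)
      also have "\<dots> = (\<integral>\<^sup>+x. (\<integral>\<^sup>+y. h x y \<partial>lborel) * indicator \<Omega> x \<partial>lborel)"
        by (intro nn_integral_cong nn_integral_multc) measurable
      also have "\<dots> \<le> (\<integral>\<^sup>+x. ennreal (max 0 C) * indicator \<Omega> x \<partial>lborel)"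
        by (intro nn_integral_mono mult_right_mono order_trans[OF C] ennreal_leI) auto
      also have "\<dots> = ennreal (max 0 C) * ennreal m"
        by (simp add: nn_integral_cmult_indicator fin)
      finally show ?thesis .
    qed
    have B: "(\<integral>\<^sup>+z. h (fst z) (snd z) * indicator \<Omega> (snd z) \<partial>(lborel \<Otimes>\<^sub>M lborel)) \<le> ennreal (max 0 C) * ennreal m"
    proof -
      have "(\<integral>\<^sup>+z. h (fst z) (snd z) * indicator \<Omega> (snd z) \<partial>(lborel \<Otimes>\<^sub>M lborel))
          = (\<integral>\<^sup>+y. \<integral>\<^sup>+x. h y x * indicator \<Omega> y \<partial>lborel \<partial>lborel)"
        by (subst lborel_pair.nn_integral_snd[symmetric]) (auto simp: split_beta h_sym)
      also have "\<dots> = (\<integral>\<^sup>+z. h (fst z) (snd z) * indicator \<Omega> (fst z) \<partial>(lborel \<Otimes>\<^sub>M lborel))"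
        by (subst lborel.nn_integral_fst[symmetric]) (auto simp: split_beta)
      finally show ?thesis using A by simp
    qed
    have "(\<integral>\<^sup>+z. ennreal (\<bar>hquot \<alpha> u z\<bar> powr p) \<partial>(lborel \<Otimes>\<^sub>M lborel))
        \<le> (\<integral>\<^sup>+z. ennreal (H powr p) * (h (fst z) (snd z) * indicator \<Omega> (fst z)
            + h (fst z) (snd z) * indicator \<Omega> (snd z)) \<partial>(lborel \<Otimes>\<^sub>M lborel))"
      by (intro nn_integral_mono) (metis pt prod.collapse)
    also have "\<dots> = ennreal (H powr p) *
        ((\<integral>\<^sup>+z. h (fst z) (snd z) * indicator \<Omega> (fst z) \<partial>(lborel \<Otimes>\<^sub>M lborel)) +
         (\<integral>\<^sup>+z. h (fst z) (snd z) * indicator \<Omega> (snd z) \<partial>(lborel \<Otimes>\<^sub>M lborel)))"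
      by (simp add: nn_integral_cmult nn_integral_add)
    also have "\<dots> \<le> ennreal (H powr p) * (ennreal (max 0 C) * ennreal m + ennreal (max 0 C) * ennreal m)"
      by (intro mult_left_mono add_mono A B) auto
    also have "\<dots> = ennreal (H powr p * (2 * m * max 0 C))"
      by (simp add: m_def algebra_simps flip: ennreal_mult ennreal_plus)
    finally show "(\<integral>\<^sup>+z. ennreal (\<bar>hquot \<alpha> u z\<bar> powr p) \<partial>(lborel \<Otimes>\<^sub>M lborel))
        \<le> ennreal (H powr p * (2 * m * max 0 C))" .
  qed
qed

text \<open>\<open>C\<close> depends on c but not on p, v or H. The ratio c is left free because the
  two uses differ: it is 2 when H bounds the full norm, and \<open>2 / L\<close> for functions of
  sup norm 1 with seminorm at most H = L.\<close>

lemma gagliardo_le_of_holder: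
  fixes \<Omega> :: "'a::euclidean_space set"
  assumes \<Omega>: "open \<Omega>" "bounded \<Omega>" and \<alpha>: "0 < \<alpha>" and c: "0 \<le> c"
  obtains C where "0 \<le> C"
    and "\<And>v H p. \<lbrakk>v \<in> C_0 \<Omega>; 0 < H; holder_seminorm \<alpha> v \<le> ennreal H; 2 * norm v \<le> c * H;
        real (DIM('a) + 2) / \<alpha> \<le> p\<rbrakk> \<Longrightarrow>
      gagliardo (\<alpha> - real DIM('a) / p) p (apply_bcontfun v) \<le> ennreal (H * C powr (1 / p))"
proof -
  obtain C where C: "0 \<le> C"
    "\<And>u H p. \<lbrakk>u \<in> borel_measurable borel; \<And>x. x \<notin> \<Omega> \<Longrightarrow> u x = 0; 0 < H;
        \<And>x y. \<bar>u x - u y\<bar> \<le> H * norm (x - y) powr \<alpha>; \<And>x y. \<bar>u x - u y\<bar> \<le> c * H;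
        real (DIM('a) + 2) / \<alpha> \<le> p\<rbrakk> \<Longrightarrow>
      (\<integral>\<^sup>+z. ennreal (\<bar>hquot \<alpha> u z\<bar> powr p) \<partial>(lborel \<Otimes>\<^sub>M lborel)) \<le> ennreal (H powr p * C)"
    using nn_integral_hquot_le[OF \<Omega> \<alpha> c] by blast
  show ?thesis
  proof (rule that[OF C(1)])
    fix v :: "'a \<Rightarrow>\<^sub>C real" and H p :: real
    assume v: "v \<in> C_0 \<Omega>" and H: "0 < H" and hol: "holder_seminorm \<alpha> v \<le> ennreal H"
      and bd: "2 * norm v \<le> c * H" and p: "real (DIM('a) + 2) / \<alpha> \<le> p"
    have "0 < real (DIM('a) + 2) / \<alpha>" using \<alpha> by simp
    with p have p0: "0 < p" by linarith
    have "\<bar>apply_bcontfun v x - apply_bcontfun v y\<bar> \<le> c * H" for x y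
      using norm_bounded[of v x] norm_bounded[of v y] bd by (auto simp: abs_le_iff)
    moreover have "\<bar>apply_bcontfun v x - apply_bcontfun v y\<bar> \<le> H * norm (x - y) powr \<alpha>" for x y
      using holder_seminorm_le_iff[of H \<alpha> v] hol H \<alpha> by auto
    ultimately have "(\<integral>\<^sup>+z. ennreal (\<bar>hquot \<alpha> (apply_bcontfun v) z\<bar> powr p) \<partial>(lborel \<Otimes>\<^sub>M lborel))
        \<le> ennreal (H powr p * C)"
      using C_0_eq_0[OF v] H p by (intro C(2)) auto
    then have "gagliardo (\<alpha> - real DIM('a) / p) p (apply_bcontfun v) \<le> ennreal (H powr p * C) epowr (1 / p)"
      using p0 by (subst gagliardo_eq) (auto intro!: epowr_mono)
    also have "\<dots> = ennreal (H * C powr (1 / p))"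
      using C(1) H p0 by (simp add: epowr_ennreal powr_mult powr_powr)
    finally show "gagliardo (\<alpha> - real DIM('a) / p) p (apply_bcontfun v) \<le> ennreal (H * C powr (1 / p))" .
  qed
qed

lemma Lp_norm_le_norm:
  fixes v :: "'a::euclidean_space \<Rightarrow>\<^sub>C real"
  assumes \<Omega>: "open \<Omega>" "bounded \<Omega>" and v: "v \<in> C_0 \<Omega>" and p: "0 < p"
  shows "Lp_norm p (apply_bcontfun v) \<le> ennreal (norm v * measure lborel \<Omega> powr (1 / p))"
proof -
  have fin: "emeasure lborel \<Omega> = ennreal (measure lborel \<Omega>)"
    using emeasure_bounded_finite[OF \<Omega>(2)] by (intro emeasure_eq_ennreal_measure) auto
  have "(\<integral>\<^sup>+x. ennreal (\<bar>apply_bcontfun v x\<bar> powr p) \<partial>lborel)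
      \<le> (\<integral>\<^sup>+x. ennreal (norm v powr p) * indicator \<Omega> x \<partial>lborel)"
  proof (intro nn_integral_mono)
    fix x
    show "ennreal (\<bar>apply_bcontfun v x\<bar> powr p) \<le> ennreal (norm v powr p) * indicator \<Omega> x"
      using C_0_eq_0[OF v, of x] norm_bounded[of v x] p
      by (cases "x \<in> \<Omega>") (auto intro!: ennreal_leI powr_mono2)
  qed
  also have "\<dots> = ennreal (norm v powr p * measure lborel \<Omega>)"
    using \<Omega> by (simp add: nn_integral_cmult_indicator fin ennreal_mult)
  finally have "Lp_norm p (apply_bcontfun v) \<le> ennreal (norm v powr p * measure lborel \<Omega>) epowr (1 / p)"
    unfolding Lp_norm_def using p by (intro epowr_mono) auto
  also have "\<dots> = ennreal (norm v * measure lborel \<Omega> powr (1 / p))"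
    using p by (simp add: epowr_ennreal powr_mult powr_powr)
  finally show ?thesis .
qed

text \<open>The continuous embedding at a fixed p. \<open>K\<close> may depend on p, as it serves
  only for membership, finiteness and continuity.\<close>

lemma Wsp_norm_le_holder_norm:
  fixes \<Omega> :: "'a::euclidean_space set"
  assumes \<Omega>: "open \<Omega>" "bounded \<Omega>" and \<alpha>: "0 < \<alpha>"
    and p: "1 \<le> p" "real (DIM('a) + 2) / \<alpha> \<le> p"
  obtains K where "0 \<le> K"
    and "\<And>v d. \<lbrakk>v \<in> C_0 \<Omega>; 0 < d; holder_norm \<alpha> v \<le> ennreal d\<rbrakk> \<Longrightarrow>
      Wsp_norm (\<alpha> - real DIM('a) / p) p (apply_bcontfun v) \<le> ennreal (K * d)"
proof -
  obtain C where C: "0 \<le> C"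
    "\<And>v H p. \<lbrakk>v \<in> C_0 \<Omega>; 0 < H; holder_seminorm \<alpha> v \<le> ennreal H; 2 * norm v \<le> 2 * H;
        real (DIM('a) + 2) / \<alpha> \<le> p\<rbrakk> \<Longrightarrow>
      gagliardo (\<alpha> - real DIM('a) / p) p (apply_bcontfun v) \<le> ennreal (H * C powr (1 / p))"
    using gagliardo_le_of_holder[OF \<Omega> \<alpha>, of 2] by auto
  define K where "K = measure lborel \<Omega> powr (1 / p) + C powr (1 / p)"
  show ?thesis
  proof (rule that[of K])
    show "0 \<le> K" by (simp add: K_def)
  next
    fix v :: "'a \<Rightarrow>\<^sub>C real" and d :: real
    assume v: "v \<in> C_0 \<Omega>" and d: "0 < d" and le: "holder_norm \<alpha> v \<le> ennreal d"
    have "ennreal (norm v) \<le> ennreal d" and hol: "holder_seminorm \<alpha> v \<le> ennreal d"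
      using le unfolding holder_norm_def by (auto elim: order_trans[rotated])
    then have nv: "norm v \<le> d" using d by simp
    have "Wsp_norm (\<alpha> - real DIM('a) / p) p (apply_bcontfun v)
        \<le> Lp_norm p (apply_bcontfun v) + gagliardo (\<alpha> - real DIM('a) / p) p (apply_bcontfun v)"
      by (rule Wsp_norm_le[OF p(1)])
    also have "\<dots> \<le> ennreal (norm v * measure lborel \<Omega> powr (1 / p)) + ennreal (d * C powr (1 / p))"
      using p d nv hol v by (intro add_mono Lp_norm_le_norm[OF \<Omega>] C(2)) auto
    also have "\<dots> \<le> ennreal (K * d)"
      using mult_right_mono[OF nv, of "measure lborel \<Omega> powr (1 / p)"] d
      by (simp add: K_def algebra_simps flip: ennreal_plus)
    finally show "Wsp_norm (\<alpha> - real DIM('a) / p) p (apply_bcontfun v) \<le> ennreal (K * d)" .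
  qed
qed

text \<open>One half of \<tau> pays for choosing a point where the modulus is close to the supremum,
  the other half for the oscillation on the ball of radius r around it. Since r is chosen
  independently of p, the p-th root of the measure of the ball tends to 1.\<close>

lemma Lp_norm_ge_of_holder:
  fixes v :: "'a::euclidean_space \<Rightarrow>\<^sub>C real"
  assumes nv: "norm v = 1" and hol: "holder_seminorm \<alpha> v \<le> ennreal L" and \<alpha>: "0 < \<alpha>"
    and L: "0 \<le> L" and \<tau>: "0 < \<tau>" "\<tau> < 1" and r: "0 < r" "L * r powr \<alpha> \<le> \<tau> / 2" and p: "0 < p"
  shows "ennreal ((1 - \<tau>) * measure lborel (ball (0 :: 'a) r) powr (1 / p)) \<le> Lp_norm p (apply_bcontfun v)"
proof -
  have "\<exists>x. 1 - \<tau> / 2 < \<bar>apply_bcontfun v x\<bar>"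
  proof (rule ccontr)
    assume "\<not> ?thesis"
    then have "norm v \<le> 1 - \<tau> / 2"
      by (intro norm_bound) (auto simp: not_less)
    then show False using nv \<tau> by simp
  qed
  then obtain x where x: "1 - \<tau> / 2 < \<bar>apply_bcontfun v x\<bar>" by blast
  let ?m = "measure lborel (ball (0 :: 'a) r)"
  have ge: "1 - \<tau> \<le> \<bar>apply_bcontfun v y\<bar>" if "y \<in> ball x r" for y
  proof -
    have "\<bar>apply_bcontfun v x - apply_bcontfun v y\<bar> \<le> L * norm (x - y) powr \<alpha>"
      using holder_seminorm_le_iff[of L \<alpha> v] hol L \<alpha> by auto
    also have "\<dots> \<le> L * r powr \<alpha>"
      using that L \<alpha> by (intro mult_left_mono powr_mono2) (auto simp: dist_norm)
    finally show ?thesis using x r(2) by linarith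
  qed
  have "ennreal ((1 - \<tau>) powr p * ?m) = ennreal ((1 - \<tau>) powr p) * emeasure lborel (ball x r)"
    by (simp add: emeasure_ball_eq_measure measure_ball_eq[of x r 0] ennreal_mult)
  also have "\<dots> = (\<integral>\<^sup>+y. ennreal ((1 - \<tau>) powr p) * indicator (ball x r) y \<partial>lborel)"
    by (simp add: nn_integral_cmult_indicator)
  also have "\<dots> \<le> (\<integral>\<^sup>+y. ennreal (\<bar>apply_bcontfun v y\<bar> powr p) \<partial>lborel)"
    using ge \<tau> p by (intro nn_integral_mono) (auto simp: indicator_def intro!: ennreal_leI powr_mono2)
  finally have "ennreal ((1 - \<tau>) powr p * ?m) epowr (1 / p) \<le> Lp_norm p (apply_bcontfun v)"
    unfolding Lp_norm_def using p by (intro epowr_mono) auto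
  then show ?thesis
    using p \<tau> by (simp add: epowr_ennreal powr_mult powr_powr)
qed

lemma diff_C_0:
  assumes "u \<in> C_0 \<Omega>" "v \<in> C_0 \<Omega>"
  shows "u - v \<in> C_0 \<Omega>"
  unfolding C_0_def closure_approachable
proof safe
  fix e :: real assume "0 < e"
  then have "0 < e / 2" by simp
  then obtain f g where f: "f \<in> C_c \<Omega>" "dist f u < e / 2" and g: "g \<in> C_c \<Omega>" "dist g v < e / 2"
    using assms unfolding C_0_def closure_approachable by blast
  let ?F = "closure {x. apply_bcontfun f x \<noteq> 0}" and ?G = "closure {x. apply_bcontfun g x \<noteq> 0}"
  have "closure {x. apply_bcontfun (f - g) x \<noteq> 0} \<subseteq> ?F \<union> ?G"
    unfolding closure_Un[symmetric] by (intro closure_mono) auto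
  moreover have FG: "compact (?F \<union> ?G)" "?F \<union> ?G \<subseteq> \<Omega>"
    using f(1) g(1) unfolding C_c_def by (simp_all add: compact_Un)
  ultimately have "f - g \<in> C_c \<Omega>"
    using compact_Int_closed[OF FG(1) closed_closure, of "{x. apply_bcontfun (f - g) x \<noteq> 0}"]
    unfolding C_c_def mem_Collect_eq by (simp only: Int_absorb1 simp_thms)
  moreover have "dist (f - g) (u - v) < e"
    using f(2) g(2) norm_triangle_ineq4[of "f - u" "g - v"]
    by (simp add: dist_norm algebra_simps)
  ultimately show "\<exists>w\<in>C_c \<Omega>. dist w (u - v) < e" by blast
qed

lemma Wsp0I:
  fixes \<Omega> :: "'a::euclidean_space set"
  assumes "v \<in> C_0 \<Omega>" "0 < p" "Wsp_norm s p (apply_bcontfun v) < \<infinity>"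
  shows "apply_bcontfun v \<in> Wsp0 s p \<Omega>"
  using assms C_0_eq_0[OF assms(1)] Lp_norm_le_Wsp_norm[OF assms(2), of "apply_bcontfun v" s]
    gagliardo_le_Wsp_norm[OF assms(2), of s "apply_bcontfun v"]
  by (auto simp: Wsp0_def Wsp_def)

section \<open>The upper bound for the limit\<close>

lemma lambda_p_epowr_le:
  assumes G: "{u \<in> Wsp0 s p \<Omega>. Lp_norm p u = 1 \<and> gagliardo s p u \<le> ennreal c} \<in> \<G>_p k s p \<Omega>"
    and s: "0 \<le> s" and p: "0 < p" and c: "0 \<le> c"
  shows "lambda_p k s p \<Omega> epowr (1 / p) \<le> ennreal c"
proof -
  have "ennreal (1 - s) * gagliardo s p v epowr p / Lp_norm p v epowr p \<le> ennreal c epowr p"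
    if "Lp_norm p v = 1" "gagliardo s p v \<le> ennreal c" for v :: "'a \<Rightarrow> real"
  proof -
    \<comment> \<open>As s is nonnegative, the weight is at most 1 and may be dropped in an upper
      bound.\<close>
    have "ennreal (1 - s) * gagliardo s p v epowr p \<le> 1 * ennreal c epowr p"
      using s p that by (intro mult_mono epowr_mono) (auto simp flip: ennreal_1 intro!: ennreal_leI)
    then show ?thesis
      using that epowr_ennreal[of 1 p] by (simp add: divide_ennreal_def)
  qed
  then have "lambda_p k s p \<Omega> \<le> ennreal c epowr p"
    unfolding lambda_p_def by (intro INF_lower2[OF G] SUP_least) auto
  then show ?thesis
    using p by (simp add: epowr_le_iff)
qed

text \<open>
  The set contains the normalised functions \<open>v / \<parallel>v\<parallel>\<^sub>p\<close> with \<open>v \<in> G\<close>, which depend continuously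
  on \<open>v\<close> since \<open>C\<^sub>0\<^sup>\<alpha>(\<Omega>)\<close> embeds continuously into \<open>W\<^sub>0\<^sup>s\<^sup>,\<^sup>p(\<Omega>)\<close>.
\<close>

lemma normalized_sublevel_in_\<G>_p:
  fixes \<Omega> :: "'a::euclidean_space set"
  assumes \<Omega>: "open \<Omega>" "bounded \<Omega>" and \<alpha>: "0 < \<alpha>"
    and p: "1 \<le> p" "real (DIM('a) + 2) / \<alpha> \<le> p" and s: "s = \<alpha> - real DIM('a) / p"
    and G: "G \<in> \<G>_infty k \<alpha> \<Omega>"
    and L: "0 < L" "\<And>v. v \<in> G \<Longrightarrow> holder_seminorm \<alpha> v \<le> ennreal L"
    and a: "0 < a" "\<And>v. v \<in> G \<Longrightarrow> ennreal a \<le> Lp_norm p (apply_bcontfun v)"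
    and b: "0 \<le> b" "\<And>v. v \<in> G \<Longrightarrow> gagliardo s p (apply_bcontfun v) \<le> ennreal b"
    and c: "b \<le> a * c"
  shows "{u \<in> Wsp0 s p \<Omega>. Lp_norm p u = 1 \<and> gagliardo s p u \<le> ennreal c} \<in> \<G>_p k s p \<Omega>"
proof -
  obtain K where K: "0 \<le> K" "\<And>v d. \<lbrakk>v \<in> C_0 \<Omega>; 0 < d; holder_norm \<alpha> v \<le> ennreal d\<rbrakk> \<Longrightarrow>
      Wsp_norm s p (apply_bcontfun v) \<le> ennreal (K * d)"
    using Wsp_norm_le_holder_norm[OF \<Omega> \<alpha> p] unfolding s by blast
  have p0: "0 < p" using p by simp
  have G': "v \<in> C_0 \<Omega>" "norm v = 1" if "v \<in> G" for v
    using G that by (auto simp: \<G>_infty_def genus_family_def C_0_holder_def)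
  have holder_G: "holder_norm \<alpha> v \<le> ennreal (1 + L)" if "v \<in> G" for v
    using L that G'[OF that] by (simp add: holder_norm_def)
  have W_G: "Wsp_norm s p (apply_bcontfun v) \<le> ennreal (K * (1 + L))" if "v \<in> G" for v
    using L G' that by (intro K(2) holder_G) auto
  define m where "m v = enn2real (Lp_norm p (apply_bcontfun v))" for v :: "'a \<Rightarrow>\<^sub>C real"
  have m: "Lp_norm p (apply_bcontfun v) = ennreal (m v)" "a \<le> m v" if "v \<in> G" for v
  proof -
    have "Lp_norm p (apply_bcontfun v) \<noteq> \<infinity>"
      using order_trans[OF Lp_norm_le_Wsp_norm[OF p0] W_G[OF that]] by (auto simp: top_unique)
    then show "Lp_norm p (apply_bcontfun v) = ennreal (m v)"
      by (simp add: m_def less_top)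
    moreover have "0 \<le> m v" by (simp add: m_def)
    ultimately show "a \<le> m v"
      using a(2)[OF that] by (simp del: ennreal_enn2real_if)
  qed
  define R where "R v = (\<lambda>x. inverse (m v) * apply_bcontfun v x)" for v
  show ?thesis
    unfolding \<G>_p_def
  proof (rule sublevel_in_genus_family[where G = G and V = "C_0_holder \<alpha> \<Omega>" and nrm = "holder_norm \<alpha>"
        and R = R and ?sph0.0 = "\<lambda>v. ennreal (norm v)"])
    show "G \<in> genus_family k (C_0_holder \<alpha> \<Omega>) (holder_norm \<alpha>) (\<lambda>v. ennreal (norm v))"
      using G by (simp add: \<G>_infty_def)
    show "holder_norm \<alpha> (u - w) \<le> holder_norm \<alpha> (u - v) + holder_norm \<alpha> (v - w)"
      for u v w :: "'a \<Rightarrow>\<^sub>C real"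
      by (rule holder_norm_triangle[OF \<alpha>])
    show "holder_norm \<alpha> (u - u) = 0" for u :: "'a \<Rightarrow>\<^sub>C real"
      by (simp add: holder_norm_0[OF \<alpha>])
  next
    fix v assume v: "v \<in> G"
    have "apply_bcontfun v \<in> Wsp0 s p \<Omega>"
      using G'[OF v] p0 W_G[OF v] by (intro Wsp0I) (auto elim: le_less_trans)
    then have "R v \<in> Wsp0 s p \<Omega>"
      unfolding R_def by (rule Wsp0_scale[OF _ p0])
    moreover have "Lp_norm p (R v) = 1"
      using m[OF v] a p0 by (simp add: R_def Lp_norm_cmult flip: ennreal_mult)
    moreover have "gagliardo s p (R v) \<le> ennreal c"
    proof -
      have "gagliardo s p (R v) = ennreal \<bar>inverse (m v)\<bar> * gagliardo s p (apply_bcontfun v)"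
        unfolding R_def using p0 by (intro gagliardo_cmult) auto
      also have "\<dots> \<le> ennreal (inverse a) * ennreal b"
        using a m(2)[OF v] b(2)[OF v] by (intro mult_mono ennreal_leI) (auto intro: le_imp_inverse_le)
      also have "\<dots> = ennreal (b / a)"
        using a b(1) by (simp add: field_simps flip: ennreal_mult)
      also have "\<dots> \<le> ennreal c"
        using a c by (intro ennreal_leI) (simp add: pos_divide_le_eq mult.commute)
      finally show ?thesis .
    qed
    ultimately show "R v \<in> Wsp0 s p \<Omega> \<and> Lp_norm p (R v) = 1 \<and> gagliardo s p (R v) \<le> ennreal c"
      by blast
  next
    fix v assume v: "v \<in> G"
    have "Lp_norm p (apply_bcontfun (- v)) = Lp_norm p (apply_bcontfun v)"
      by (simp add: Lp_norm_def)
    then have "m (- v) = m v" by (simp add: m_def)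
    then show "R (- v) = - R v" by (simp add: R_def fun_eq_iff)
  next
    fix u and e :: real
    assume u: "u \<in> G" and e: "0 < e"
    \<comment> \<open>If v is d-close to u in the Hoelder norm, \<open>R v - R u\<close> has norm at
      most \<open>d * A\<close>: the first summand comes from \<open>v - u\<close>, divided by at
      least a, the second from the difference of the reciprocals of the p-norms, at most
      \<open>K * d / (a * a)\<close>, times the bound \<open>K * (1 + L)\<close> for u.\<close>
    define A where "A = K / a + K * (K * (1 + L)) / a\<^sup>2"
    have A: "0 \<le> A" using K a L by (simp add: A_def)
    have "Wsp_norm s p (R v - R u) < ennreal e"
      if v: "v \<in> G" "holder_norm \<alpha> (v - u) < ennreal (e / (A + 1))" for v
    proof -
      define d where "d = e / (A + 1)"
      have d: "0 < d" "holder_norm \<alpha> (v - u) \<le> ennreal d" "d * A < e"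
        using e A v by (auto simp: d_def field_simps)
      have Wvu: "Wsp_norm s p (apply_bcontfun (v - u)) \<le> ennreal (K * d)"
        using d G' u v by (intro K(2) diff_C_0) auto
      have diff: "apply_bcontfun (v - u) = apply_bcontfun v - apply_bcontfun u" by auto
      have "ennreal (m u) \<le> ennreal (m v) + ennreal (K * d)" "ennreal (m v) \<le> ennreal (m u) + ennreal (K * d)"
        using Lp_norm_le_add[of "apply_bcontfun u" "apply_bcontfun v" p s]
          Lp_norm_le_add'[of "apply_bcontfun u" "apply_bcontfun v" p s] Wvu m(1) u v p(1)
        unfolding diff by (auto elim!: order_trans intro!: add_left_mono)
      then have "\<bar>m u - m v\<bar> \<le> K * d"
        using K(1) d(1) m(2)[OF u] m(2)[OF v(1)] a by (simp add: abs_le_iff flip: ennreal_plus)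
      then have "\<bar>m u - m v\<bar> / (m v * m u) \<le> K * d / (a * a)"
        using m(2)[OF u] m(2)[OF v(1)] a by (intro frac_le mult_mono) auto
      moreover have "inverse (m v) - inverse (m u) = (m u - m v) / (m v * m u)"
        using m(2)[OF u] m(2)[OF v(1)] a by (simp add: field_simps)
      ultimately have mm: "\<bar>inverse (m v) - inverse (m u)\<bar> \<le> K * d / (a * a)"
        using m(2)[OF u] m(2)[OF v(1)] a by (simp add: abs_mult)
      have "R v - R u = (\<lambda>x. inverse (m v) * apply_bcontfun (v - u) x
          + (inverse (m v) - inverse (m u)) * apply_bcontfun u x)"
        by (auto simp: R_def algebra_simps)
      then have "Wsp_norm s p (R v - R u) \<le>
          Wsp_norm s p (\<lambda>x. inverse (m v) * apply_bcontfun (v - u) x) +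
          Wsp_norm s p (\<lambda>x. (inverse (m v) - inverse (m u)) * apply_bcontfun u x)"
        using p by (simp only:) (intro Wsp_norm_add; measurable)
      also have "\<dots> = ennreal \<bar>inverse (m v)\<bar> * Wsp_norm s p (apply_bcontfun (v - u)) +
          ennreal \<bar>inverse (m v) - inverse (m u)\<bar> * Wsp_norm s p (apply_bcontfun u)"
        using p0 by (intro arg_cong2[where f = "(+)"] Wsp_norm_cmult measurable_bcontfun)
      also have "\<dots> \<le> ennreal (inverse a) * ennreal (K * d) +
          ennreal (K * d / (a * a)) * ennreal (K * (1 + L))"
        using Wvu W_G[OF u] m(2)[OF v(1)] a mm
        by (intro add_mono mult_mono ennreal_leI) (auto intro: le_imp_inverse_le)
      also have "\<dots> = ennreal (d * A)"
        using K(1) L(1) a(1) d(1) by (simp add: A_def field_simps power2_eq_square flip: ennreal_mult ennreal_plus)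
      also have "\<dots> < ennreal e"
        using d e by (intro ennreal_lessI)
      finally show ?thesis .
    qed
    then show "\<exists>d>0. \<forall>v\<in>G. holder_norm \<alpha> (v - u) < ennreal d \<longrightarrow> Wsp_norm s p (R v - R u) < ennreal e"
      using e A by (intro exI[of _ "e / (A + 1)"]) auto
  next
    show "Lp_norm p u \<le> Lp_norm p v + Wsp_norm s p (v - u)"
      "Lp_norm p v \<le> Lp_norm p u + Wsp_norm s p (v - u)"
      "gagliardo s p u \<le> gagliardo s p v + Wsp_norm s p (v - u)"
      if "u \<in> Wsp0 s p \<Omega>" "v \<in> Wsp0 s p \<Omega>" for u v
      using that p by (auto simp: Wsp0_def Wsp_def intro!: Lp_norm_le_add Lp_norm_le_add' gagliardo_le_add)
    show "Lp_norm p u < \<infinity>" "gagliardo s p u < \<infinity>" "Wsp_norm s p u \<le> Lp_norm p u + gagliardo s p u"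
      if "u \<in> Wsp0 s p \<Omega>" for u
      using that p Wsp_norm_le by (auto simp: Wsp0_def Wsp_def)
    show "ennreal c < \<infinity>" by simp
    show "- u \<in> Wsp0 s p \<Omega> \<and> Lp_norm p (- u) = Lp_norm p u \<and> gagliardo s p (- u) = gagliardo s p u \<and> - (- u) = u"
      if "u \<in> Wsp0 s p \<Omega>" for u
      using that p0 by (auto simp: uminus_Wsp0 Lp_norm_uminus gagliardo_uminus)
  qed
qed

lemma eventually_powr_mult_le:
  fixes \<rho> C \<beta> :: real
  assumes "0 \<le> \<rho>" "\<rho> < 1" "0 < \<beta>"
  shows "eventually (\<lambda>p. \<rho> powr p * C \<le> \<beta>) at_top"
proof (cases "\<rho> = 0")
  case True
  then show ?thesis using assms by simp
next
  case False
  then have "((\<lambda>p. \<rho> powr p * C) \<longlongrightarrow> 0 * C) at_top"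
  proof (intro tendsto_mult tendsto_const)
    have "filterlim (\<lambda>p. ln \<rho> * p) at_bot at_top"
      using False assms by (intro filterlim_tendsto_neg_mult_at_bot[OF tendsto_const]) (auto simp: filterlim_ident)
    then have "((\<lambda>p. exp (ln \<rho> * p)) \<longlongrightarrow> 0) at_top"
      by (rule filterlim_compose[OF exp_at_bot])
    then show "((\<lambda>p. \<rho> powr p) \<longlongrightarrow> 0) at_top"
      using False by (simp add: powr_def mult.commute)
  qed
  then have "eventually (\<lambda>p. \<rho> powr p * C < \<beta>) at_top"
    using assms by (intro order_tendstoD) auto
  then show ?thesis by eventually_elim simp
qed

text \<open>The level \<open>L\<close> is attained by some \<open>G\<close> and lies strictly below
  \<open>L'\<close>, which in turn is below a. The gap is spent on two losses: the factor
  \<open>1 - \<tau>\<close> from the lower bound of the p-norm, and the p-th roots of constants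
  independent of p.\<close>

lemma eventually_lambda_p_less:
  fixes \<Omega> :: "'a::euclidean_space set"
  assumes \<Omega>: "open \<Omega>" "bounded \<Omega>" and \<alpha>: "0 < \<alpha>" and less: "Lambda_infty k \<alpha> \<Omega> < a"
  shows "eventually (\<lambda>p. lambda_p k (\<alpha> - real DIM('a) / p) p \<Omega> epowr (1 / p) < a) at_top"
proof -
  obtain M where M: "Lambda_infty k \<alpha> \<Omega> < M" "M < a"
    using less dense by blast
  obtain l where l: "Lambda_infty k \<alpha> \<Omega> < l" "l < M"
    using M(1) dense by blast
  obtain L' where L': "M = ennreal L'" "0 \<le> L'" using M by (cases M) auto
  obtain L where L: "l = ennreal L" "0 \<le> L" using l by (cases l) (auto simp: top_unique L')
  have "0 < l" using l(1) by (metis not_gr_zero not_less_zero)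
  then have L0: "0 < L" and LL': "L < L'" using l L L' by (auto simp: ennreal_less_iff)
  obtain G where G: "G \<in> \<G>_infty k \<alpha> \<Omega>" "(SUP v\<in>G. holder_seminorm \<alpha> v / ennreal (norm v)) < l"
    using l(1) unfolding Lambda_infty_def INF_less_iff by blast
  have G': "v \<in> C_0 \<Omega>" "norm v = 1" if "v \<in> G" for v
    using G(1) that by (auto simp: \<G>_infty_def genus_family_def C_0_holder_def)
  have hol: "holder_seminorm \<alpha> v \<le> ennreal L" if "v \<in> G" for v
  proof -
    have "holder_seminorm \<alpha> v / ennreal (norm v) \<le> l"
      using SUP_lessD[OF G(2) that] by simp
    then show ?thesis using G'(2)[OF that] L by (simp add: divide_ennreal_def)
  qed
  \<comment> \<open>This makes \<open>1 - \<tau>\<close> the midpoint of \<open>L / L'\<close> and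
    1.\<close>
  define \<tau> where "\<tau> = (1 - L / L') / 2"
  \<comment> \<open>The remaining slack. After taking p-th powers, the required \<open>L * C powr (1
    / p) \<le> (1 - \<tau>) * \<beta> powr (1 / p) * L'\<close> becomes
    \<open>\<rho> powr p * C \<le> \<beta>\<close>, which holds for large p because \<rho> <
    1.\<close>
  define \<rho> where "\<rho> = L / ((1 - \<tau>) * L')"
  have \<tau>: "0 < \<tau>" "\<tau> < 1" using L0 LL' by (auto simp: \<tau>_def field_simps)
  have "L < (1 - \<tau>) * L'" using L0 LL' by (simp add: \<tau>_def field_simps)
  then have \<rho>: "0 < \<rho>" "\<rho> < 1" "L = \<rho> * ((1 - \<tau>) * L')"
    using L0 LL' \<tau> by (auto simp: \<rho>_def)
  \<comment> \<open>The solution of \<open>L * r powr \<alpha> = \<tau> / 2\<close>.\<close>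
  define r where "r = (\<tau> / (2 * L)) powr (1 / \<alpha>)"
  have r: "0 < r" "L * r powr \<alpha> \<le> \<tau> / 2"
    using \<tau> L0 \<alpha> by (auto simp: r_def powr_powr)
  define \<beta> where "\<beta> = measure lborel (ball (0 :: 'a) r)"
  have \<beta>: "0 < \<beta>" using r by (simp add: \<beta>_def)
  obtain C where C: "0 \<le> C"
    "\<And>v H p. \<lbrakk>v \<in> C_0 \<Omega>; 0 < H; holder_seminorm \<alpha> v \<le> ennreal H; 2 * norm v \<le> 2 / L * H;
        real (DIM('a) + 2) / \<alpha> \<le> p\<rbrakk> \<Longrightarrow>
      gagliardo (\<alpha> - real DIM('a) / p) p (apply_bcontfun v) \<le> ennreal (H * C powr (1 / p))"
    using gagliardo_le_of_holder[OF \<Omega> \<alpha>, of "2 / L"] L0 by auto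
  have "eventually (\<lambda>p. \<rho> powr p * C \<le> \<beta>) at_top"
    using \<rho> \<beta> by (intro eventually_powr_mult_le) auto
  moreover have "eventually (\<lambda>p. real (DIM('a) + 2) / \<alpha> \<le> p) at_top" "eventually (\<lambda>p::real. 1 \<le> p) at_top"
    by (rule eventually_ge_at_top)+
  ultimately show ?thesis
  proof eventually_elim
    case (elim p)
    define s where "s = \<alpha> - real DIM('a) / p"
    have p0: "0 < p" using elim by simp
    have s: "0 \<le> s"
      using elim \<alpha> p0 by (simp add: s_def field_simps)
    have "\<rho> * C powr (1 / p) = (\<rho> powr p * C) powr (1 / p)"
      using \<rho> C p0 by (simp add: powr_mult powr_powr)
    also have "\<dots> \<le> \<beta> powr (1 / p)"
      using elim C p0 by (intro powr_mono2) auto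
    finally have "\<rho> * C powr (1 / p) * ((1 - \<tau>) * L') \<le> \<beta> powr (1 / p) * ((1 - \<tau>) * L')"
      using \<tau> L' by (intro mult_right_mono) auto
    then have c: "L * C powr (1 / p) \<le> ((1 - \<tau>) * \<beta> powr (1 / p)) * L'"
      by (subst \<rho>(3)) (simp add: mult_ac)
    have "{u \<in> Wsp0 s p \<Omega>. Lp_norm p u = 1 \<and> gagliardo s p u \<le> ennreal L'} \<in> \<G>_p k s p \<Omega>"
    proof (rule normalized_sublevel_in_\<G>_p[OF \<Omega> \<alpha> _ _ s_def G(1) L0 hol])
      show "0 < (1 - \<tau>) * \<beta> powr (1 / p)" using \<tau> \<beta> by simp
      show "ennreal ((1 - \<tau>) * \<beta> powr (1 / p)) \<le> Lp_norm p (apply_bcontfun v)" if "v \<in> G" for v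
        unfolding \<beta>_def using \<tau> r p0 L0 by (intro Lp_norm_ge_of_holder[OF G'(2)[OF that] hol[OF that] \<alpha>]) auto
      show "gagliardo s p (apply_bcontfun v) \<le> ennreal (L * C powr (1 / p))" if "v \<in> G" for v
        unfolding s_def using G'[OF that] hol[OF that] L0 elim by (intro C(2)) auto
    qed (use elim c L0 in auto)
    then have "lambda_p k s p \<Omega> epowr (1 / p) \<le> M"
      unfolding L'(1) using s p0 L'(2) by (rule lambda_p_epowr_le)
    then show ?case
      using M(2) unfolding s_def by simp
  qed
qed


section \<open>Averages\<close>

text \<open>Soft thresholding moves t towards 0 by \<eta> and stops there. Being odd and
  1-Lipschitz, it respects the symmetry and does not increase the Hoelder constant; it lowers the
  sup norm by at most \<eta>.\<close>

definition soft :: "real \<Rightarrow> real \<Rightarrow> real" where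
  "soft \<eta> t = t - max (- \<eta>) (min \<eta> t)"

lemma soft_minus: "0 \<le> \<eta> \<Longrightarrow> soft \<eta> (- t) = - soft \<eta> t"
  by (auto simp: soft_def max_def min_def)

lemma soft_eq_0: "\<bar>t\<bar> \<le> \<eta> \<Longrightarrow> soft \<eta> t = 0"
  by (auto simp: soft_def max_def min_def)

lemma abs_soft_diff_le: "\<bar>soft \<eta> s - soft \<eta> t\<bar> \<le> \<bar>s - t\<bar>"
  by (auto simp: soft_def max_def min_def)

lemma abs_soft_ge: "0 \<le> \<eta> \<Longrightarrow> \<bar>t\<bar> - \<eta> \<le> \<bar>soft \<eta> t\<bar>"
  by (auto simp: soft_def max_def min_def)

lemma integrable_indicator_of_powr:
  fixes u :: "'a::euclidean_space \<Rightarrow> real"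
  assumes [measurable]: "u \<in> borel_measurable borel" "A \<in> sets borel"
    and A: "emeasure lborel A < \<infinity>" and p: "1 \<le> p"
    and fin: "(\<integral>\<^sup>+x. ennreal (\<bar>u x\<bar> powr p) \<partial>lborel) < \<infinity>"
  shows "integrable lborel (\<lambda>z. indicator A z * u z)"
proof (rule integrableI_bounded)
  have "(\<integral>\<^sup>+z. ennreal (norm (indicator A z * u z)) \<partial>lborel)
      \<le> (\<integral>\<^sup>+z. indicator A z + ennreal (\<bar>u z\<bar> powr p) \<partial>lborel)"
  proof (intro nn_integral_mono)
    fix z
    show "ennreal (norm (indicator A z * u z)) \<le> indicator A z + ennreal (\<bar>u z\<bar> powr p)"
      using le_add_powr[of "\<bar>u z\<bar>" 1 p] p
      by (auto simp: indicator_def simp flip: ennreal_1 ennreal_plus intro!: ennreal_leI)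
  qed
  also have "\<dots> = emeasure lborel A + (\<integral>\<^sup>+x. ennreal (\<bar>u x\<bar> powr p) \<partial>lborel)"
    by (subst nn_integral_add) auto
  finally show "(\<integral>\<^sup>+z. ennreal (norm (indicator A z * u z)) \<partial>lborel) < \<infinity>"
    using A fin by (auto elim: le_less_trans)
qed measurable

lemma abs_integral_indicator_diff_le:
  fixes u :: "'a::euclidean_space \<Rightarrow> real"
  assumes [measurable]: "F \<in> sets borel" and F: "emeasure lborel F < \<infinity>"
    and u: "integrable lborel (\<lambda>z. indicator F z * u z)"
  shows "ennreal \<bar>(LINT z|lborel. indicator F z * u z) - measure lborel F * c\<bar>
    \<le> (\<integral>\<^sup>+z. indicator F z * ennreal \<bar>u z - c\<bar> \<partial>lborel)"
proof -
  have ind: "integrable lborel (\<lambda>z. indicator F z * c)"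
    using F by (intro integrable_mult_left) (simp add: integrable_indicator_iff)
  have "(LINT z|lborel. indicator F z * u z) - measure lborel F * c
      = (LINT z|lborel. indicator F z * u z - indicator F z * c)"
    using u ind by simp
  then have "ennreal \<bar>(LINT z|lborel. indicator F z * u z) - measure lborel F * c\<bar>
      = ennreal (norm (LINT z|lborel. indicator F z * u z - indicator F z * c))"
    by simp
  also have "\<dots> \<le> (\<integral>\<^sup>+z. ennreal (norm (indicator F z * u z - indicator F z * c)) \<partial>lborel)"
    using u ind by (intro integral_norm_bound_ennreal) auto
  also have "\<dots> = (\<integral>\<^sup>+z. indicator F z * ennreal \<bar>u z - c\<bar> \<partial>lborel)"
    by (intro nn_integral_cong) (auto simp: indicator_def)
  finally show ?thesis .
qed

text \<open>Jensen's inequality up to the factor 2^p. With t the distance of the mean from c, the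
  bound |u - c| \<le> t/2 + (t/2)^(1-p) |u - c|^p is integrated over F; the left side gives at least
  b t, and the term b t / 2 on the right is absorbed. The factor 2 inside the power is later
  compensated by a small power of \<delta>.\<close>

lemma mean_powr_le:
  fixes u :: "'a::euclidean_space \<Rightarrow> real"
  assumes [measurable]: "F \<in> sets borel" "u \<in> borel_measurable borel"
    and F: "emeasure lborel F = ennreal b" "0 < b"
    and u: "integrable lborel (\<lambda>z. indicator F z * u z)" and p: "1 \<le> p"
  shows "ennreal (b * (\<bar>(LINT z|lborel. indicator F z * u z) / b - c\<bar> / 2) powr p)
    \<le> (\<integral>\<^sup>+z. indicator F z * ennreal (\<bar>u z - c\<bar> powr p) \<partial>lborel)"
proof -
  define t where "t = \<bar>(LINT z|lborel. indicator F z * u z) / b - c\<bar>"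
  have mF: "measure lborel F = b" using F by (simp add: measure_def)
  show ?thesis
  proof (cases "t = 0")
    case True
    then show ?thesis by (simp add: t_def)
  next
    case False
    then have t: "0 < t" by (simp add: t_def)
    let ?X = "\<integral>\<^sup>+z. indicator F z * ennreal (\<bar>u z - c\<bar> powr p) \<partial>lborel"
    have "ennreal (b * t) = ennreal \<bar>(LINT z|lborel. indicator F z * u z) - measure lborel F * c\<bar>"
    proof -
      have "b * t = \<bar>b * ((LINT z|lborel. indicator F z * u z) / b - c)\<bar>"
        using F(2) by (simp add: t_def abs_mult)
      also have "b * ((LINT z|lborel. indicator F z * u z) / b - c)
          = (LINT z|lborel. indicator F z * u z) - measure lborel F * c"
        using F(2) by (simp add: mF right_diff_distrib)
      finally show ?thesis by simp
    qed
    also have "\<dots> \<le> (\<integral>\<^sup>+z. indicator F z * ennreal \<bar>u z - c\<bar> \<partial>lborel)"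
      using F u by (intro abs_integral_indicator_diff_le) auto
    also have "\<dots> \<le> (\<integral>\<^sup>+z. ennreal (t / 2) * indicator F z +
        ennreal ((t / 2) powr (1 - p)) * (indicator F z * ennreal (\<bar>u z - c\<bar> powr p)) \<partial>lborel)"
    proof (intro nn_integral_mono)
      fix z
      have "\<bar>u z - c\<bar> \<le> t / 2 + t / 2 * (\<bar>u z - c\<bar> / (t / 2)) powr p"
        using t p by (intro le_add_powr) auto
      also have "t / 2 * (\<bar>u z - c\<bar> / (t / 2)) powr p = (t / 2) powr (1 - p) * \<bar>u z - c\<bar> powr p"
        using t by (simp add: powr_divide powr_mult powr_diff)
      finally show "indicator F z * ennreal \<bar>u z - c\<bar> \<le> ennreal (t / 2) * indicator F z +
        ennreal ((t / 2) powr (1 - p)) * (indicator F z * ennreal (\<bar>u z - c\<bar> powr p))"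
        using t by (auto simp: indicator_def simp flip: ennreal_mult ennreal_plus intro!: ennreal_leI)
    qed
    also have "\<dots> = ennreal (t / 2 * b) + ennreal ((t / 2) powr (1 - p)) * ?X"
      using F t by (simp add: nn_integral_add nn_integral_cmult nn_integral_cmult_indicator flip: ennreal_mult)
    finally have le: "ennreal (b * t) \<le> ennreal (t / 2 * b) + ennreal ((t / 2) powr (1 - p)) * ?X" .
    show ?thesis
    proof (cases ?X)
      case (real x)
      then have "b * t \<le> t / 2 * b + (t / 2) powr (1 - p) * x"
        using le F t by (simp flip: ennreal_mult ennreal_plus)
      then have "b * (t / 2) \<le> (t / 2) powr (1 - p) * x" by (simp add: field_simps)
      then have "b * (t / 2) * (t / 2) powr (p - 1) \<le> (t / 2) powr (1 - p) * x * (t / 2) powr (p - 1)"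
        by (rule mult_right_mono) simp
      moreover have "(t / 2) powr (1 - p) * (t / 2) powr (p - 1) = 1"
        using t by (simp flip: powr_add)
      moreover have "(t / 2) * (t / 2) powr (p - 1) = (t / 2) powr p"
        using t powr_add[of "t / 2" 1 "p - 1"] by simp
      ultimately have "b * (t / 2) powr p \<le> x"
        by (simp add: mult.assoc mult.left_commute[of _ x] mult.commute[of _ x] del: powr_half_sqrt)
      then show ?thesis
        using real by (simp add: t_def ennreal_leI)
    qed simp
  qed
qed

text \<open>The difference of the two means is at most the mean of |u x - u y| over E \<times> F.
  There the constant part of the bound survives unchanged, while the integral of g is at most
  \<kappa> and is divided by the measure a b of the product.\<close>

lemma mean_diff_le:
  fixes u :: "'a::euclidean_space \<Rightarrow> real" and g :: "'a \<times> 'a \<Rightarrow> real"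
  assumes [measurable]: "E \<in> sets borel" "F \<in> sets borel" "u \<in> borel_measurable borel"
      "g \<in> borel_measurable (lborel \<Otimes>\<^sub>M lborel)"
    and E: "emeasure lborel E = ennreal a" "0 < a" and F: "emeasure lborel F = ennreal b" "0 < b"
    and u: "integrable lborel (\<lambda>z. indicator E z * u z)" "integrable lborel (\<lambda>z. indicator F z * u z)"
    and D: "0 \<le> D" and \<kappa>: "0 \<le> \<kappa>" and g: "\<And>z. 0 \<le> g z" "(\<integral>\<^sup>+z. ennreal (g z) \<partial>(lborel \<Otimes>\<^sub>M lborel)) \<le> ennreal \<kappa>"
    and le: "\<And>x y. x \<in> E \<Longrightarrow> y \<in> F \<Longrightarrow> \<bar>u x - u y\<bar> \<le> D * (1 + g (x, y))"
  shows "\<bar>(LINT z|lborel. indicator E z * u z) / a - (LINT z|lborel. indicator F z * u z) / b\<bar>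
    \<le> D * (1 + \<kappa> / (a * b))"
proof -
  define m where "m = (LINT z|lborel. indicator F z * u z) / b"
  have mE: "measure lborel E = a" and mF: "measure lborel F = b"
    using E F by (simp_all add: measure_def)
  have inner: "ennreal b * ennreal \<bar>u x - m\<bar> \<le> (\<integral>\<^sup>+y. indicator F y * ennreal \<bar>u x - u y\<bar> \<partial>lborel)" for x
  proof -
    have "b * \<bar>u x - m\<bar> = \<bar>(LINT z|lborel. indicator F z * u z) - measure lborel F * u x\<bar>"
    proof -
      have "b * \<bar>u x - m\<bar> = \<bar>b * (u x - m)\<bar>" using F by (simp add: abs_mult)
      also have "b * (u x - m) = - ((LINT z|lborel. indicator F z * u z) - measure lborel F * u x)"
        using F by (simp add: m_def mF field_simps)
      finally show ?thesis by simp
    qed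
    then have "ennreal b * ennreal \<bar>u x - m\<bar>
        = ennreal \<bar>(LINT z|lborel. indicator F z * u z) - measure lborel F * u x\<bar>"
      using F by (simp flip: ennreal_mult)
    also have "\<dots> \<le> (\<integral>\<^sup>+y. indicator F y * ennreal \<bar>u y - u x\<bar> \<partial>lborel)"
      using F u by (intro abs_integral_indicator_diff_le) auto
    finally show ?thesis by (simp add: abs_minus_commute)
  qed
  have "ennreal b * ennreal (a * \<bar>(LINT z|lborel. indicator E z * u z) / a - m\<bar>)
      = ennreal b * ennreal \<bar>(LINT z|lborel. indicator E z * u z) - measure lborel E * m\<bar>"
  proof -
    have "a * \<bar>(LINT z|lborel. indicator E z * u z) / a - m\<bar>
        = \<bar>a * ((LINT z|lborel. indicator E z * u z) / a - m)\<bar>"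
      using E by (simp add: abs_mult)
    also have "a * ((LINT z|lborel. indicator E z * u z) / a - m)
        = (LINT z|lborel. indicator E z * u z) - measure lborel E * m"
      using E by (simp add: mE field_simps)
    finally show ?thesis by simp
  qed
  also have "\<dots> \<le> ennreal b * (\<integral>\<^sup>+x. indicator E x * ennreal \<bar>u x - m\<bar> \<partial>lborel)"
    using E u by (intro mult_left_mono abs_integral_indicator_diff_le) auto
  also have "\<dots> = (\<integral>\<^sup>+x. ennreal b * (indicator E x * ennreal \<bar>u x - m\<bar>) \<partial>lborel)"
    by (intro nn_integral_cmult[symmetric]) measurable
  also have "\<dots> \<le> (\<integral>\<^sup>+x. indicator E x * (\<integral>\<^sup>+y. indicator F y * ennreal \<bar>u x - u y\<bar> \<partial>lborel) \<partial>lborel)"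
    using inner by (intro nn_integral_mono) (auto simp: indicator_def)
  also have "\<dots> \<le> (\<integral>\<^sup>+x. indicator E x * (\<integral>\<^sup>+y. ennreal D * indicator F y + ennreal D * ennreal (g (x, y)) \<partial>lborel) \<partial>lborel)"
  proof (intro nn_integral_mono)
    fix x
    have "(\<integral>\<^sup>+y. indicator F y * ennreal \<bar>u x - u y\<bar> \<partial>lborel)
        \<le> (\<integral>\<^sup>+y. ennreal D * indicator F y + ennreal D * ennreal (g (x, y)) \<partial>lborel)" if "x \<in> E"
      using le[OF that] D g(1)
      by (intro nn_integral_mono)
        (auto simp: indicator_def distrib_left simp flip: ennreal_mult ennreal_plus intro!: ennreal_leI)
    then show "indicator E x * (\<integral>\<^sup>+y. indicator F y * ennreal \<bar>u x - u y\<bar> \<partial>lborel)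
        \<le> indicator E x * (\<integral>\<^sup>+y. ennreal D * indicator F y + ennreal D * ennreal (g (x, y)) \<partial>lborel)"
      by (auto simp: indicator_def)
  qed
  also have "\<dots> = (\<integral>\<^sup>+x. indicator E x * (ennreal (D * b) + ennreal D * (\<integral>\<^sup>+y. ennreal (g (x, y)) \<partial>lborel)) \<partial>lborel)"
    using D F by (simp add: nn_integral_add nn_integral_cmult nn_integral_cmult_indicator ennreal_mult)
  also have "\<dots> \<le> (\<integral>\<^sup>+x. ennreal (D * b) * indicator E x + ennreal D * (\<integral>\<^sup>+y. ennreal (g (x, y)) \<partial>lborel) \<partial>lborel)"
    by (intro nn_integral_mono) (auto simp: indicator_def)
  also have "\<dots> = ennreal (D * b) * ennreal a + ennreal D * (\<integral>\<^sup>+z. ennreal (g z) \<partial>(lborel \<Otimes>\<^sub>M lborel))"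
    using E by (simp add: nn_integral_add nn_integral_cmult nn_integral_cmult_indicator
        lborel.nn_integral_fst[of "\<lambda>z. ennreal (g z)" lborel])
  also have "\<dots> \<le> ennreal (D * b) * ennreal a + ennreal D * ennreal \<kappa>"
    using g(2) by (intro add_left_mono mult_left_mono) auto
  also have "\<dots> = ennreal (D * b * a + D * \<kappa>)"
    using D E F \<kappa> by (simp flip: ennreal_mult ennreal_plus)
  finally have "b * (a * \<bar>(LINT z|lborel. indicator E z * u z) / a - m\<bar>) \<le> D * b * a + D * \<kappa>"
    using D E F \<kappa> by (simp add: ennreal_le_iff flip: ennreal_mult ennreal_plus)
  moreover have "D * b * a + D * \<kappa> = b * (a * (D * (1 + \<kappa> / (a * b))))"
    using E F by (simp add: field_simps)
  ultimately show ?thesis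
    using E F by (simp add: m_def)
qed

section \<open>Averages over balls and against a Lipschitz kernel\<close>

definition ball_mean :: "real \<Rightarrow> ('a::euclidean_space \<Rightarrow> real) \<Rightarrow> 'a \<Rightarrow> real" where
  "ball_mean \<delta> u x = (LINT z|lborel. indicator (ball x \<delta>) z * u z) / measure lborel (ball (0::'a) \<delta>)"

lemma measurable_ball_mean [measurable]:
  assumes [measurable]: "u \<in> borel_measurable borel"
  shows "ball_mean \<delta> u \<in> borel_measurable borel"
proof -
  have eq: "indicator (ball x \<delta>) z = (indicator {w. dist (fst w) (snd w) < \<delta>} (x, z) :: real)" for x z :: 'a
    by (simp add: indicator_def)
  have "(\<lambda>x. LINT z|lborel. indicator (ball x \<delta>) z * u z) \<in> borel_measurable borel"
    unfolding eq by measurable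
  then show ?thesis
    unfolding ball_mean_def by measurable
qed

text \<open>A kernel supported in the ball of radius r and Lipschitz with constant 1/r;
  \<open>tent_mean\<close> divides by its mass. The Lipschitz bound of the kernel passes to the
  averages of bounded functions by a pointwise estimate.\<close>

definition tent :: "real \<Rightarrow> 'a::euclidean_space \<Rightarrow> real" where
  "tent r z = max 0 (1 - norm z / r)"

definition tent_mean :: "real \<Rightarrow> ('a::euclidean_space \<Rightarrow> real) \<Rightarrow> 'a \<Rightarrow> real" where
  "tent_mean r f x = (LINT z|lborel. tent r (x - z) * f z) / (LINT z|lborel. tent r (z::'a))"

lemma measurable_tent [measurable]: "tent r \<in> borel_measurable borel"
  unfolding tent_def by measurable

lemma
  assumes r: "0 < r"
  shows tent_nonneg: "0 \<le> tent r z" and tent_le_1: "tent r z \<le> 1"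
    and tent_eq_0: "r \<le> norm z \<Longrightarrow> tent r z = 0"
    and tent_minus: "tent r (- z) = tent r z"
    and abs_tent_diff_le: "\<bar>tent r y - tent r z\<bar> \<le> norm (y - z) / r"
proof -
  show "0 \<le> tent r z" "tent r z \<le> 1" "tent r (- z) = tent r z" using r by (simp_all add: tent_def)
  show "r \<le> norm z \<Longrightarrow> tent r z = 0" using r by (simp add: tent_def)
  have "\<bar>tent r y - tent r z\<bar> \<le> \<bar>norm y / r - norm z / r\<bar>"
    by (auto simp: tent_def max_def)
  also have "\<dots> = \<bar>norm y - norm z\<bar> / r"
    using r by (simp flip: diff_divide_distrib)
  also have "\<dots> \<le> norm (y - z) / r"
    using r by (intro divide_right_mono norm_triangle_ineq3) auto
  finally show "\<bar>tent r y - tent r z\<bar> \<le> norm (y - z) / r" .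
qed

lemma integral_translate:
  fixes f :: "'a::euclidean_space \<Rightarrow> real"
  assumes [measurable]: "f \<in> borel_measurable borel"
  shows "(LINT z|lborel. f (x + z)) = (LINT z|lborel. f z)"
proof -
  have "(LINT z|lborel. f z) = (LINT z|distr lborel borel ((+) x). f z)"
    by (simp add: lborel_distr_plus)
  also have "\<dots> = (LINT z|lborel. f (x + z))"
    by (rule integral_distr) measurable
  finally show ?thesis ..
qed

context
  fixes r :: real
  assumes r: "0 < r"
begin

lemma integrable_tent_mult:
  fixes f :: "'a::euclidean_space \<Rightarrow> real"
  assumes [measurable]: "f \<in> borel_measurable borel" and f: "\<And>z. \<bar>f z\<bar> \<le> B"
  shows "integrable lborel (\<lambda>z. tent r (x - z) * f z)"
proof (rule Bochner_Integration.integrable_bound)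
  show "integrable lborel (\<lambda>z. indicator (ball x r) z * B)"
    using emeasure_lborel_ball_finite[of x r]
    by (intro integrable_mult_left) (simp add: integrable_indicator_iff)
  show "AE z in lborel. norm (tent r (x - z) * f z) \<le> norm (indicator (ball x r) z * B)"
  proof (intro AE_I2)
    fix z
    show "norm (tent r (x - z) * f z) \<le> norm (indicator (ball x r) z * B)"
    proof (cases "z \<in> ball x r")
      case True
      have "\<bar>tent r (x - z)\<bar> * \<bar>f z\<bar> \<le> 1 * B"
        using f[of z] tent_nonneg[OF r, of "x - z"] tent_le_1[OF r, of "x - z"]
        by (intro mult_mono) auto
      then show ?thesis
        using True by (simp add: abs_mult)
    next
      case False
      then show ?thesis
        using tent_eq_0[OF r, of "x - z"] by (simp add: dist_norm)
    qed
  qed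
qed measurable

lemma integrable_tent_mult_shift:
  fixes f :: "'a::euclidean_space \<Rightarrow> real"
  assumes [measurable]: "f \<in> borel_measurable borel" and f: "\<And>z. \<bar>f z\<bar> \<le> B"
  shows "integrable lborel (\<lambda>z. tent r z * f (x + z))"
proof -
  have "integrable lborel (\<lambda>z. tent r (0 - z) * f (x + z))"
    by (rule integrable_tent_mult[OF _ f]) measurable
  then show ?thesis by (simp add: tent_minus[OF r])
qed

text \<open>The kernel is at least 1/2 on the ball of radius r/2, whose volume is 4^N times smaller
  than that of the ball of radius 2 r. This is the origin of the constant 2 * 4^N below; the ball of
  radius 2 r contains the supports of the kernels at two centres whose distance is at most
  r.\<close>

lemma integral_tent_ge:
  "measure lborel (ball (0::'a::euclidean_space) (2 * r)) \<le> 2 * 4 ^ DIM('a) * (LINT z|lborel. tent r (z::'a))"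
proof -
  have int: "integrable lborel (tent r :: 'a \<Rightarrow> real)"
    using integrable_tent_mult_shift[of "\<lambda>_::'a. 1" 1 0] by simp
  have "(LINT z|lborel. indicator (ball (0::'a) (r / 2)) z * (1 / 2)) \<le> (LINT z|lborel. tent r (z::'a))"
  proof (rule integral_mono[OF _ int])
    show "integrable lborel (\<lambda>z. indicator (ball (0::'a) (r / 2)) z * (1 / 2 :: real))"
      using emeasure_lborel_ball_finite[of "0::'a" "r / 2"]
      by (intro integrable_mult_left) (simp add: integrable_indicator_iff)
    show "indicator (ball 0 (r / 2)) z * (1 / 2) \<le> tent r z" for z :: 'a
    proof (cases "z \<in> ball 0 (r / 2)")
      case True
      then have "norm z / r \<le> 1 / 2" using r by (simp add: pos_divide_le_eq)
      then have "1 / 2 \<le> tent r z" unfolding tent_def le_max_iff_disj by linarith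
      then show ?thesis using True by simp
    qed (simp add: tent_nonneg[OF r])
  qed
  then have "measure lborel (ball (0::'a) (r / 2)) \<le> 2 * (LINT z|lborel. tent r (z::'a))"
    by simp
  moreover have "measure lborel (ball (0::'a) (2 * r)) = 4 ^ DIM('a) * measure lborel (ball (0::'a) (r / 2))"
  proof -
    have "(2 * r) ^ DIM('a) = 4 ^ DIM('a) * (r / 2) ^ DIM('a)"
      by (subst power_mult_distrib[symmetric]) simp
    then show ?thesis
      using r by (simp add: content_ball)
  qed
  ultimately show ?thesis by simp
qed

lemma integral_tent_pos: "0 < (LINT z|lborel. tent r (z::'a::euclidean_space))"
proof -
  have "0 < measure lborel (ball (0::'a) (2 * r))" using r by simp
  also note integral_tent_ge
  finally show ?thesis by (simp add: zero_less_mult_iff)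
qed

lemma integral_tent_shift: "(LINT z|lborel. tent r ((x::'a::euclidean_space) - z)) = (LINT z|lborel. tent r (z::'a))"
proof -
  have "(LINT z|lborel. tent r (x - z)) = (LINT z|lborel. tent r (x - (x + z)))"
    by (rule integral_translate[symmetric]) measurable
  then show ?thesis by (simp add: tent_minus[OF r])
qed

lemma tent_mean_altdef:
  fixes f :: "'a::euclidean_space \<Rightarrow> real"
  assumes [measurable]: "f \<in> borel_measurable borel"
  shows "tent_mean r f x = (LINT z|lborel. tent r z * f (x + z)) / (LINT z|lborel. tent r (z::'a))"
proof -
  have "(LINT z|lborel. tent r (x - z) * f z) = (LINT z|lborel. tent r (x - (x + z)) * f (x + z))"
    by (rule integral_translate[symmetric]) measurable
  then show ?thesis by (simp add: tent_mean_def tent_minus[OF r])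
qed

text \<open>Two functions at two points allow several uses: f = g transfers a modulus of continuity
  to the averages, x = y compares the averages of different functions, and a constant g compares an
  average with a number.\<close>

lemma abs_tent_mean_diff_le:
  fixes f g :: "'a::euclidean_space \<Rightarrow> real"
  assumes [measurable]: "f \<in> borel_measurable borel" "g \<in> borel_measurable borel"
    and f: "\<And>z. \<bar>f z\<bar> \<le> B" "\<And>z. \<bar>g z\<bar> \<le> B"
    and D: "\<And>z. norm z < r \<Longrightarrow> \<bar>f (x + z) - g (y + z)\<bar> \<le> D"
  shows "\<bar>tent_mean r f x - tent_mean r g y\<bar> \<le> D"
proof -
  let ?c = "LINT z|lborel. tent r (z::'a)"
  note int = integrable_tent_mult_shift[OF assms(1) f(1)] integrable_tent_mult_shift[OF assms(2) f(2)]
  have int1: "integrable lborel (\<lambda>z::'a. tent r z * D)"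
    using integrable_tent_mult_shift[of "\<lambda>_::'a. D" "\<bar>D\<bar>" 0] by simp
  have "\<bar>(LINT z|lborel. tent r z * f (x + z)) - (LINT z|lborel. tent r z * g (y + z))\<bar>
      = \<bar>LINT z|lborel. tent r z * f (x + z) - tent r z * g (y + z)\<bar>"
    using int by (subst Bochner_Integration.integral_diff) auto
  also have "\<dots> \<le> (LINT z|lborel. \<bar>tent r z * f (x + z) - tent r z * g (y + z)\<bar>)"
    by (rule integral_abs_bound)
  also have "\<dots> \<le> (LINT z|lborel. tent r (z::'a) * D)"
  proof (rule integral_mono[OF _ int1])
    show "integrable lborel (\<lambda>z. \<bar>tent r z * f (x + z) - tent r z * g (y + z)\<bar>)"
      using int by (intro integrable_abs Bochner_Integration.integrable_diff) auto
    show "\<bar>tent r z * f (x + z) - tent r z * g (y + z)\<bar> \<le> tent r z * D" for z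
    proof (cases "norm z < r")
      case True
      have "\<bar>tent r z * f (x + z) - tent r z * g (y + z)\<bar> = tent r z * \<bar>f (x + z) - g (y + z)\<bar>"
        using tent_nonneg[OF r, of z] by (simp add: abs_mult flip: right_diff_distrib)
      then show ?thesis
        using D[OF True] tent_nonneg[OF r, of z] by (simp add: mult_left_mono)
    next
      case False
      then show ?thesis by (simp add: tent_eq_0[OF r])
    qed
  qed
  also have "\<dots> = ?c * D" by simp
  finally have "\<bar>(LINT z|lborel. tent r z * f (x + z)) - (LINT z|lborel. tent r z * g (y + z))\<bar> \<le> D * ?c"
    by (simp add: mult.commute)
  then show ?thesis
    using integral_tent_pos[where 'a = 'a]
    by (simp add: tent_mean_altdef pos_divide_le_eq flip: diff_divide_distrib)
qed

lemma tent_mean_const: "tent_mean r (\<lambda>_. c) (x::'a::euclidean_space) = c"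
  using integral_tent_pos[where 'a = 'a] by (simp add: tent_mean_def integral_tent_shift)

text \<open>The kernels centred at x and y have equal mass, so subtracting the constant c from f
  does not change the difference. What remains is the difference of the kernels, at most
  \<open>norm (x - y) / r\<close> and zero outside \<open>ball x (2 * r)\<close>, times a factor
  bounded by D.\<close>

lemma tent_mean_Lipschitz:
  fixes f :: "'a::euclidean_space \<Rightarrow> real"
  assumes [measurable]: "f \<in> borel_measurable borel" and f: "\<And>z. \<bar>f z\<bar> \<le> B"
    and D: "\<And>z. z \<in> ball x (2 * r) \<Longrightarrow> \<bar>f z - c\<bar> \<le> D" and xy: "norm (x - y) \<le> r"
  shows "\<bar>tent_mean r f x - tent_mean r f y\<bar> \<le> 2 * 4 ^ DIM('a) * D * norm (x - y) / r"
proof -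
  let ?c = "LINT z|lborel. tent r (z::'a)" and ?V = "measure lborel (ball (0::'a) (2 * r))"
  have D0: "0 \<le> D" using D[of x] r by auto
  have fc: "\<bar>f z - c\<bar> \<le> B + \<bar>c\<bar>" for z
    using f[of z] by linarith
  have int: "integrable lborel (\<lambda>z. tent r (x - z) * (f z - c))" for x
    by (rule integrable_tent_mult[OF _ fc]) measurable
  have int': "integrable lborel (\<lambda>z. tent r (x - z) * f z)" "integrable lborel (\<lambda>z. tent r (x - z) * c)" for x
    using integrable_tent_mult[OF assms(1) f] integrable_tent_mult[of "\<lambda>_::'a. c" "\<bar>c\<bar>"] by simp_all
  have shift: "(LINT z|lborel. tent r (x - z) * f z) = (LINT z|lborel. tent r (x - z) * (f z - c)) + ?c * c" for x
    using int' by (simp add: right_diff_distrib integral_tent_shift)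
  have "\<bar>(LINT z|lborel. tent r (x - z) * (f z - c)) - (LINT z|lborel. tent r (y - z) * (f z - c))\<bar>
      = \<bar>LINT z|lborel. tent r (x - z) * (f z - c) - tent r (y - z) * (f z - c)\<bar>"
    using int by (subst Bochner_Integration.integral_diff) auto
  also have "\<dots> \<le> (LINT z|lborel. \<bar>tent r (x - z) * (f z - c) - tent r (y - z) * (f z - c)\<bar>)"
    by (rule integral_abs_bound)
  also have "\<dots> \<le> (LINT z|lborel. indicator (ball x (2 * r)) z * (norm (x - y) / r * D))"
  proof (rule integral_mono)
    show "integrable lborel (\<lambda>z. \<bar>tent r (x - z) * (f z - c) - tent r (y - z) * (f z - c)\<bar>)"
      using int by (intro integrable_abs Bochner_Integration.integrable_diff) auto
    show "integrable lborel (\<lambda>z. indicator (ball x (2 * r)) z * (norm (x - y) / r * D))"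
      using emeasure_lborel_ball_finite[of x "2 * r"]
      by (intro integrable_mult_left) (simp add: integrable_indicator_iff)
    fix z
    show "\<bar>tent r (x - z) * (f z - c) - tent r (y - z) * (f z - c)\<bar>
        \<le> indicator (ball x (2 * r)) z * (norm (x - y) / r * D)"
    proof (cases "z \<in> ball x (2 * r)")
      case True
      have "\<bar>tent r (x - z) - tent r (y - z)\<bar> * \<bar>f z - c\<bar> \<le> norm (x - y) / r * D"
        using abs_tent_diff_le[OF r, of "x - z" "y - z"] D[OF True] r by (intro mult_mono) auto
      moreover have "\<bar>tent r (x - z) * (f z - c) - tent r (y - z) * (f z - c)\<bar>
          = \<bar>tent r (x - z) - tent r (y - z)\<bar> * \<bar>f z - c\<bar>"
        by (simp only: left_diff_distrib[symmetric] abs_mult)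
      ultimately show ?thesis using True by simp
    next
      case False
      then have z: "2 * r \<le> norm (x - z)" by (simp add: dist_norm)
      moreover have "norm (x - z) \<le> norm (x - y) + norm (y - z)"
        using norm_triangle_ineq[of "x - y" "y - z"] by simp
      ultimately have "r \<le> norm (y - z)" "r \<le> norm (x - z)" using xy r by linarith+
      then show ?thesis using False by (simp add: tent_eq_0[OF r])
    qed
  qed
  also have "\<dots> = ?V * (norm (x - y) / r * D)"
    by (simp add: measure_ball_eq[of x "2 * r" 0])
  also have "\<dots> \<le> (2 * 4 ^ DIM('a) * ?c) * (norm (x - y) / r * D)"
    using D0 r integral_tent_ge by (intro mult_right_mono) auto
  finally have "\<bar>(LINT z|lborel. tent r (x - z) * f z) - (LINT z|lborel. tent r (y - z) * f z)\<bar>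
      \<le> (2 * 4 ^ DIM('a) * D * norm (x - y) / r) * ?c"
    unfolding shift[of x] shift[of y] add_diff_cancel_right by (simp add: mult_ac)
  then show ?thesis
    using integral_tent_pos[where 'a = 'a]
    by (simp add: tent_mean_def pos_divide_le_eq flip: diff_divide_distrib)
qed

end

lemma abs_diff_le_hquot_powr:
  fixes u :: "'a::euclidean_space \<Rightarrow> real"
  assumes "0 < \<mu>" "1 \<le> p"
  shows "\<bar>u x - u y\<bar> \<le> norm (x - y) powr \<alpha> * (\<mu> * (1 + (\<bar>hquot \<alpha> u (x, y)\<bar> / \<mu>) powr p))"
proof (cases "x = y")
  case False
  then have "\<bar>u x - u y\<bar> = norm (x - y) powr \<alpha> * \<bar>hquot \<alpha> u (x, y)\<bar>"
    by (simp add: hquot_def)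
  also have "\<dots> \<le> norm (x - y) powr \<alpha> * (\<mu> + \<mu> * (\<bar>hquot \<alpha> u (x, y)\<bar> / \<mu>) powr p)"
    using assms by (intro mult_left_mono le_add_powr) auto
  finally show ?thesis by (simp add: distrib_left)
qed (use assms in auto)

section \<open>Oscillation and size of ball means\<close>

context
  fixes u :: "'a::euclidean_space \<Rightarrow> real" and \<alpha> p \<mu> \<kappa> \<delta> :: real
  assumes u [measurable]: "u \<in> borel_measurable borel"
    and \<alpha>: "0 < \<alpha>" and p: "1 \<le> p" and \<mu>: "0 < \<mu>" and \<kappa>: "0 \<le> \<kappa>" and \<delta>: "0 < \<delta>"
    and fin: "(\<integral>\<^sup>+x. ennreal (\<bar>u x\<bar> powr p) \<partial>lborel) < \<infinity>"
    and J: "(\<integral>\<^sup>+z. ennreal ((\<bar>hquot \<alpha> u z\<bar> / \<mu>) powr p) \<partial>(lborel \<Otimes>\<^sub>M lborel)) \<le> ennreal \<kappa>"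
begin

lemma integrable_indicator_u:
  assumes "A \<in> sets borel" "emeasure lborel A < \<infinity>"
  shows "integrable lborel (\<lambda>z. indicator A z * u z)"
  using assms p fin by (intro integrable_indicator_of_powr) auto

text \<open>This takes the place of Morrey's inequality: the constant \<mu> is kept, and the error
  \<kappa> / (a b) disappears as \<kappa> tends to 0 with the sets fixed.\<close>

lemma mean_diff_le_dist:
  assumes E: "E \<in> sets borel" "emeasure lborel E = ennreal a" "0 < a"
    and F: "F \<in> sets borel" "emeasure lborel F = ennreal b" "0 < b"
    and t: "\<And>x y. x \<in> E \<Longrightarrow> y \<in> F \<Longrightarrow> norm (x - y) \<le> t"
  shows "\<bar>(LINT z|lborel. indicator E z * u z) / a - (LINT z|lborel. indicator F z * u z) / b\<bar>
    \<le> t powr \<alpha> * \<mu> * (1 + \<kappa> / (a * b))"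
proof (rule mean_diff_le[where g = "\<lambda>z. (\<bar>hquot \<alpha> u z\<bar> / \<mu>) powr p"])
  show "integrable lborel (\<lambda>z. indicator E z * u z)" "integrable lborel (\<lambda>z. indicator F z * u z)"
    using E F by (auto intro!: integrable_indicator_u)
  fix x y assume xy: "x \<in> E" "y \<in> F"
  have "\<bar>u x - u y\<bar> \<le> norm (x - y) powr \<alpha> * (\<mu> * (1 + (\<bar>hquot \<alpha> u (x, y)\<bar> / \<mu>) powr p))"
    using \<mu> p by (rule abs_diff_le_hquot_powr)
  also have "\<dots> \<le> t powr \<alpha> * (\<mu> * (1 + (\<bar>hquot \<alpha> u (x, y)\<bar> / \<mu>) powr p))"
    using t[OF xy] \<alpha> \<mu> by (intro mult_right_mono powr_mono2) (auto intro!: mult_nonneg_nonneg)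
  finally show "\<bar>u x - u y\<bar> \<le> t powr \<alpha> * \<mu> * (1 + (\<bar>hquot \<alpha> u (x, y)\<bar> / \<mu>) powr p)"
    by (simp add: mult.assoc)
qed (use E F \<mu> \<kappa> J in auto)

text \<open>Points of the two balls may be farther apart than the centres by 2 \<delta>, so this is
  close to a Hoelder bound only at distances large compared with \<delta>.\<close>

lemma ball_mean_diff_le:
  "\<bar>ball_mean \<delta> u x - ball_mean \<delta> u y\<bar> \<le> (norm (x - y) + 2 * \<delta>) powr \<alpha> * \<mu> *
    (1 + \<kappa> / (measure lborel (ball (0::'a) \<delta>) * measure lborel (ball (0::'a) \<delta>)))"
  unfolding ball_mean_def
proof (rule mean_diff_le_dist)
  fix v w assume "v \<in> ball x \<delta>" "w \<in> ball y \<delta>"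
  then have "norm (v - x) < \<delta>" "norm (y - w) < \<delta>"
    by (auto simp: dist_norm norm_minus_commute)
  then show "norm (v - w) \<le> norm (x - y) + 2 * \<delta>"
    using norm_triangle_ineq[of "v - x" "x - w"] norm_triangle_ineq[of "x - y" "y - w"] by simp
qed (use \<delta> in \<open>simp_all add: emeasure_ball_eq_measure measure_ball_eq[of x \<delta> 0] measure_ball_eq[of y \<delta> 0]\<close>)

text \<open>The mean over the ball is compared with the mean over its part outside \<Omega>, which
  is 0. The error involves the measure of that part, hence the lower bound c.\<close>

lemma ball_mean_le_of_null_part:
  assumes \<Omega>: "open \<Omega>" and zero: "AE x in lborel. x \<notin> \<Omega> \<longrightarrow> u x = 0"
    and c: "0 < c" "c \<le> measure lborel (ball x \<delta> - \<Omega>)"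
  shows "\<bar>ball_mean \<delta> u x\<bar> \<le> (2 * \<delta>) powr \<alpha> * \<mu> * (1 + \<kappa> / (measure lborel (ball (0::'a) \<delta>) * c))"
proof -
  let ?F = "ball x \<delta> - \<Omega>" and ?\<beta> = "measure lborel (ball (0::'a) \<delta>)"
  have F: "?F \<in> sets borel" using \<Omega> by simp
  have "emeasure lborel ?F \<le> emeasure lborel (ball x \<delta>)"
    by (intro emeasure_mono) auto
  then have eF: "emeasure lborel ?F = ennreal (measure lborel ?F)"
    using emeasure_lborel_ball_finite[of x \<delta>] by (intro emeasure_eq_ennreal_measure) (auto simp: top_unique)
  have \<beta>: "0 < ?\<beta>" using \<delta> by simp
  have "(LINT z|lborel. indicator ?F z * u z) = (LINT z::'a|lborel. 0)"
  proof (rule integral_cong_AE)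
    show "(\<lambda>z. indicator ?F z * u z) \<in> borel_measurable lborel"
      using F by (intro borel_measurable_times borel_measurable_indicator) auto
    show "AE z in lborel. indicator ?F z * u z = 0"
      using zero by eventually_elim (auto simp: indicator_def)
  qed simp
  then have "\<bar>ball_mean \<delta> u x\<bar> = \<bar>(LINT z|lborel. indicator (ball x \<delta>) z * u z) / ?\<beta>
      - (LINT z|lborel. indicator ?F z * u z) / measure lborel ?F\<bar>"
    by (simp add: ball_mean_def)
  also have "\<dots> \<le> (2 * \<delta>) powr \<alpha> * \<mu> * (1 + \<kappa> / (?\<beta> * measure lborel ?F))"
  proof (rule mean_diff_le_dist)
    fix v w assume "v \<in> ball x \<delta>" "w \<in> ?F"
    then have "norm (v - x) < \<delta>" "norm (x - w) < \<delta>"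
      by (auto simp: dist_norm norm_minus_commute)
    then show "norm (v - w) \<le> 2 * \<delta>"
      using norm_triangle_ineq[of "v - x" "x - w"] by simp
  qed (use \<beta> c F eF in \<open>simp_all add: emeasure_ball_eq_measure measure_ball_eq[of x \<delta> 0]\<close>)
  also have "\<dots> \<le> (2 * \<delta>) powr \<alpha> * \<mu> * (1 + \<kappa> / (?\<beta> * c))"
    using \<beta> c \<mu> \<kappa> by (intro mult_left_mono add_left_mono divide_left_mono) auto
  finally show ?thesis .
qed

lemma ball_mean_powr_le:
  "ennreal (measure lborel (ball (0::'a) \<delta>) * (\<bar>ball_mean \<delta> u x - c\<bar> / 2) powr p)
    \<le> (\<integral>\<^sup>+z. indicator (ball x \<delta>) z * ennreal (\<bar>u z - c\<bar> powr p) \<partial>lborel)"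
  unfolding ball_mean_def
  using \<delta> p emeasure_lborel_ball_finite[of x \<delta>]
  by (intro mean_powr_le integrable_indicator_u)
    (simp_all add: emeasure_ball_eq_measure measure_ball_eq[of x \<delta> 0])

text \<open>
  \<open>u\<close> is close to its ball means in \<open>L\<^sup>p\<close>, so that the ball means cannot all be below \<open>m < 1\<close> when
  \<open>p\<close> is large and \<open>\<parallel>u\<parallel>\<^sub>p = 1\<close>.
\<close>

lemma Lp_le_of_ball_mean_le:
  assumes \<Omega>: "open \<Omega>" "bounded \<Omega>" and zero: "AE x in lborel. x \<notin> \<Omega> \<longrightarrow> u x = 0"
    and m: "0 \<le> m" "\<And>x. x \<in> \<Omega> \<Longrightarrow> \<bar>ball_mean \<delta> u x\<bar> \<le> m" and \<tau>: "0 < \<tau>"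
  shows "(\<integral>\<^sup>+x. ennreal (\<bar>u x\<bar> powr p) \<partial>lborel) \<le> ennreal (measure lborel \<Omega> * (m + \<tau>) powr p
    + (2 * \<delta> powr \<alpha> * \<mu> * (1 + m / \<tau>)) powr p * (\<kappa> / measure lborel (ball (0::'a) \<delta>)))"
proof -
  define \<beta> where "\<beta> = measure lborel (ball (0::'a) \<delta>)"
  define g where "g x y = ennreal ((\<bar>hquot \<alpha> u (x, y)\<bar> / \<mu>) powr p)" for x y
  have [measurable]: "case_prod g \<in> borel_measurable (lborel \<Otimes>\<^sub>M lborel)"
    unfolding g_def by measurable
  define A where "A = (2 * \<delta> powr \<alpha> * \<mu> * (1 + m / \<tau>)) powr p"
  have \<beta>: "0 < \<beta>" using \<delta> by (simp add: \<beta>_def)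
  have [measurable]: "\<Omega> \<in> sets borel" using \<Omega> by simp
  have fin\<Omega>: "emeasure lborel \<Omega> = ennreal (measure lborel \<Omega>)"
    using emeasure_bounded_finite[OF \<Omega>(2)] by (intro emeasure_eq_ennreal_measure) auto
  \<comment> \<open>The ball mean at x is compared with the number \<open>u x\<close>. Only pairs at
    distance below \<delta> enter, which yields the small factor
    \<open>\<delta> powr \<alpha>\<close>.\<close>
  have diff: "ennreal ((\<bar>u x - ball_mean \<delta> u x\<bar> * (1 + m / \<tau>)) powr p)
      \<le> ennreal (A / \<beta>) * (\<integral>\<^sup>+y. g x y \<partial>lborel)" for x
  proof -
    define B where "B = (\<delta> powr \<alpha> * \<mu>) powr p"
    have "ennreal (\<beta> * (\<bar>ball_mean \<delta> u x - u x\<bar> / 2) powr p)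
        \<le> (\<integral>\<^sup>+y. indicator (ball x \<delta>) y * ennreal (\<bar>u y - u x\<bar> powr p) \<partial>lborel)"
      unfolding \<beta>_def by (rule ball_mean_powr_le)
    also have "\<dots> \<le> (\<integral>\<^sup>+y. ennreal B * g x y \<partial>lborel)"
    proof (intro nn_integral_mono)
      fix y
      show "indicator (ball x \<delta>) y * ennreal (\<bar>u y - u x\<bar> powr p) \<le> ennreal B * g x y"
      proof (cases "y \<in> ball x \<delta> \<and> x \<noteq> y")
        case True
        have "\<bar>u y - u x\<bar> = norm (x - y) powr \<alpha> * \<bar>hquot \<alpha> u (x, y)\<bar>"
          using True by (simp add: hquot_def abs_minus_commute)
        also have "\<dots> \<le> \<delta> powr \<alpha> * \<bar>hquot \<alpha> u (x, y)\<bar>"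
          using True \<alpha> by (intro mult_right_mono powr_mono2) (auto simp: dist_norm)
        also have "\<dots> = (\<delta> powr \<alpha> * \<mu>) * (\<bar>hquot \<alpha> u (x, y)\<bar> / \<mu>)"
          using \<mu> by simp
        finally have "\<bar>u y - u x\<bar> powr p \<le> ((\<delta> powr \<alpha> * \<mu>) * (\<bar>hquot \<alpha> u (x, y)\<bar> / \<mu>)) powr p"
          using p by (intro powr_mono2) auto
        then have "\<bar>u y - u x\<bar> powr p \<le> B * (\<bar>hquot \<alpha> u (x, y)\<bar> / \<mu>) powr p"
          by (simp only: powr_mult B_def)
        then show ?thesis
          using True by (simp add: g_def B_def ennreal_leI flip: ennreal_mult)
      qed auto
    qed
    also have "\<dots> = ennreal B * (\<integral>\<^sup>+y. g x y \<partial>lborel)"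
      by (intro nn_integral_cmult) measurable
    finally have "ennreal ((2 * (1 + m / \<tau>)) powr p / \<beta>) * ennreal (\<beta> * (\<bar>ball_mean \<delta> u x - u x\<bar> / 2) powr p)
        \<le> ennreal ((2 * (1 + m / \<tau>)) powr p / \<beta>) * (ennreal B * (\<integral>\<^sup>+y. g x y \<partial>lborel))"
      by (rule mult_left_mono) simp
    moreover have "(2 * (1 + m / \<tau>)) powr p / \<beta> * (\<beta> * (\<bar>ball_mean \<delta> u x - u x\<bar> / 2) powr p)
        = (\<bar>u x - ball_mean \<delta> u x\<bar> * (1 + m / \<tau>)) powr p"
    proof -
      have "(2 * (1 + m / \<tau>)) powr p * (\<bar>ball_mean \<delta> u x - u x\<bar> / 2) powr p
          = ((2 * (1 + m / \<tau>)) * (\<bar>ball_mean \<delta> u x - u x\<bar> / 2)) powr p"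
        by (simp only: powr_mult)
      also have "(2 * (1 + m / \<tau>)) * (\<bar>ball_mean \<delta> u x - u x\<bar> / 2) = \<bar>u x - ball_mean \<delta> u x\<bar> * (1 + m / \<tau>)"
        by (simp add: abs_minus_commute)
      finally show ?thesis using \<beta> by simp
    qed
    moreover have "(2 * (1 + m / \<tau>)) powr p / \<beta> * B = A / \<beta>"
      unfolding A_def B_def by (simp only: powr_mult) simp
    ultimately show ?thesis
      using \<beta> by (simp add: B_def flip: ennreal_mult mult.assoc)
  qed
  \<comment> \<open>Where u is \<tau>-close to its mean, it is at most \<open>m + \<tau>\<close>.
    Elsewhere m is at most \<open>m / \<tau>\<close> times the deviation, so the deviation controls
    u. This dichotomy leaves the main term \<open>(m + \<tau>) powr p\<close> without a factor that
    grows with p.\<close>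
  have pt: "\<bar>u x\<bar> powr p \<le> (m + \<tau>) powr p + (\<bar>u x - ball_mean \<delta> u x\<bar> * (1 + m / \<tau>)) powr p" if "x \<in> \<Omega>" for x
  proof (cases "\<bar>u x - ball_mean \<delta> u x\<bar> \<le> \<tau>")
    case True
    then have "\<bar>u x\<bar> powr p \<le> (m + \<tau>) powr p"
      using m(2)[OF that] p by (intro powr_mono2) auto
    then show ?thesis by (simp add: add_increasing2)
  next
    case False
    let ?t = "\<bar>u x - ball_mean \<delta> u x\<bar>"
    have "m * 1 \<le> m * (?t / \<tau>)"
      using False m(1) \<tau> by (intro mult_left_mono) auto
    then have "\<bar>u x\<bar> \<le> ?t * (1 + m / \<tau>)"
      using m(2)[OF that] by (simp add: distrib_left) (simp add: mult.commute)
    then have "\<bar>u x\<bar> powr p \<le> (?t * (1 + m / \<tau>)) powr p"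
      using p by (intro powr_mono2) auto
    then show ?thesis by (simp add: add_increasing)
  qed
  have "(\<integral>\<^sup>+x. ennreal (\<bar>u x\<bar> powr p) \<partial>lborel)
      \<le> (\<integral>\<^sup>+x. ennreal ((m + \<tau>) powr p) * indicator \<Omega> x + ennreal (A / \<beta>) * (\<integral>\<^sup>+y. g x y \<partial>lborel) \<partial>lborel)"
  proof (rule nn_integral_mono_AE)
    show "AE x in lborel. ennreal (\<bar>u x\<bar> powr p)
        \<le> ennreal ((m + \<tau>) powr p) * indicator \<Omega> x + ennreal (A / \<beta>) * (\<integral>\<^sup>+y. g x y \<partial>lborel)"
      using zero
    proof eventually_elim
      case (elim x)
      show ?case
      proof (cases "x \<in> \<Omega>")
        case True
        have "ennreal (\<bar>u x\<bar> powr p) \<le> ennreal ((m + \<tau>) powr p)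
            + ennreal ((\<bar>u x - ball_mean \<delta> u x\<bar> * (1 + m / \<tau>)) powr p)"
          using pt[OF True] by (simp add: ennreal_leI flip: ennreal_plus)
        also have "\<dots> \<le> ennreal ((m + \<tau>) powr p) + ennreal (A / \<beta>) * (\<integral>\<^sup>+y. g x y \<partial>lborel)"
          by (intro add_left_mono diff)
        finally show ?thesis using True by simp
      next
        case False
        then show ?thesis using elim by simp
      qed
    qed
  qed
  also have "\<dots> = ennreal ((m + \<tau>) powr p) * ennreal (measure lborel \<Omega>)
      + ennreal (A / \<beta>) * (\<integral>\<^sup>+x. \<integral>\<^sup>+y. g x y \<partial>lborel \<partial>lborel)"
    by (simp add: nn_integral_add nn_integral_cmult nn_integral_cmult_indicator fin\<Omega>)
  also have "(\<integral>\<^sup>+x. \<integral>\<^sup>+y. g x y \<partial>lborel \<partial>lborel)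
      = (\<integral>\<^sup>+z. ennreal ((\<bar>hquot \<alpha> u z\<bar> / \<mu>) powr p) \<partial>(lborel \<Otimes>\<^sub>M lborel))"
    unfolding g_def by (intro lborel.nn_integral_fst) measurable
  also have "ennreal ((m + \<tau>) powr p) * ennreal (measure lborel \<Omega>) + ennreal (A / \<beta>) * \<dots>
      \<le> ennreal ((m + \<tau>) powr p) * ennreal (measure lborel \<Omega>) + ennreal (A / \<beta>) * ennreal \<kappa>"
    using J by (intro add_left_mono mult_left_mono) auto
  also have "\<dots> = ennreal (measure lborel \<Omega> * (m + \<tau>) powr p + A * (\<kappa> / \<beta>))"
    using \<kappa> \<beta> by (simp add: A_def mult.commute flip: ennreal_mult ennreal_plus)
  finally show ?thesis by (simp add: A_def \<beta>_def)
qed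

end

text \<open>A bound at fixed p, with c = 0 in \<open>mean_powr_le\<close>. It makes the ball means
  bounded and uniformly continuous in u; its constant does not affect the quotients.\<close>

lemma abs_ball_mean_le:
  fixes u :: "'a::euclidean_space \<Rightarrow> real"
  assumes [measurable]: "u \<in> borel_measurable borel" and p: "1 \<le> p" and \<delta>: "0 < \<delta>"
    and L: "0 \<le> L" "Lp_norm p u \<le> ennreal L"
  shows "\<bar>ball_mean \<delta> u x\<bar> \<le> 2 * L / measure lborel (ball (0::'a) \<delta>) powr (1 / p)"
proof -
  let ?\<beta> = "measure lborel (ball (0::'a) \<delta>)" and ?t = "\<bar>ball_mean \<delta> u x\<bar> / 2"
  have \<beta>: "0 < ?\<beta>" using \<delta> by simp
  have I: "(\<integral>\<^sup>+x. ennreal (\<bar>u x\<bar> powr p) \<partial>lborel) \<le> ennreal (L powr p)"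
    using L p epowr_le_iff[of p _ "ennreal L"] by (simp add: Lp_norm_def epowr_ennreal)
  have "ennreal (?\<beta> * (\<bar>ball_mean \<delta> u x - 0\<bar> / 2) powr p)
      \<le> (\<integral>\<^sup>+z. indicator (ball x \<delta>) z * ennreal (\<bar>u z - 0\<bar> powr p) \<partial>lborel)"
    unfolding ball_mean_def
    using \<delta> p emeasure_lborel_ball_finite[of x \<delta>] I
    by (intro mean_powr_le integrable_indicator_of_powr)
      (auto simp: emeasure_ball_eq_measure measure_ball_eq[of x \<delta> 0] elim: le_less_trans)
  also have "\<dots> \<le> (\<integral>\<^sup>+x. ennreal (\<bar>u x\<bar> powr p) \<partial>lborel)"
    by (intro nn_integral_mono) (auto simp: indicator_def)
  also note I
  finally have "?\<beta> * ?t powr p \<le> L powr p" by simp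
  then have "(?\<beta> * ?t powr p) powr (1 / p) \<le> (L powr p) powr (1 / p)"
    using p by (intro powr_mono2) auto
  then have "?\<beta> powr (1 / p) * ?t \<le> L"
    using p L by (simp add: powr_mult powr_powr)
  then show ?thesis using \<beta> by (simp add: field_simps)
qed

lemma ball_mean_diff:
  fixes u v :: "'a::euclidean_space \<Rightarrow> real"
  assumes "integrable lborel (\<lambda>z. indicator (ball x \<delta>) z * u z)"
    "integrable lborel (\<lambda>z. indicator (ball x \<delta>) z * v z)"
  shows "ball_mean \<delta> (u - v) x = ball_mean \<delta> u x - ball_mean \<delta> v x"
  using assms by (simp add: ball_mean_def right_diff_distrib diff_divide_distrib)

section \<open>The second average, on the larger scale\<close>

context
  fixes w :: "'a::euclidean_space \<Rightarrow> real" and l \<alpha> d r B :: real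
  assumes w [measurable]: "w \<in> borel_measurable borel" and bdd: "\<And>x. \<bar>w x\<bar> \<le> B"
    and osc: "\<And>x y. \<bar>w x - w y\<bar> \<le> l * max (norm (x - y)) d powr \<alpha>"
    and l: "0 \<le> l" and \<alpha>: "0 < \<alpha>" "\<alpha> < 1" and d: "0 < d" "d \<le> r"
begin

lemma abs_tent_mean_minus_le: "\<bar>tent_mean r w x - w x\<bar> \<le> l * r powr \<alpha>"
proof -
  have r: "0 < r" using d by linarith
  have "\<bar>tent_mean r w x - tent_mean r (\<lambda>_. w x) x\<bar> \<le> l * r powr \<alpha>"
  proof (rule abs_tent_mean_diff_le[OF r w _ bdd bdd])
    fix z :: 'a assume z: "norm z < r"
    have "\<bar>w (x + z) - w x\<bar> \<le> l * max (norm z) d powr \<alpha>"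
      using osc[of "x + z" x] by simp
    also have "\<dots> \<le> l * r powr \<alpha>"
      using z l d \<alpha> by (intro mult_left_mono powr_mono2) auto
    finally show "\<bar>w (x + z) - w x\<bar> \<le> l * r powr \<alpha>" .
  qed measurable
  then show ?thesis by (simp add: tent_mean_const[OF r])
qed

text \<open>From distance d on, averaging preserves the bound \<open>osc\<close>. At a distance n <
  d the Lipschitz estimate gives l n^\<alpha> times a constant times (n / r)^(1 - \<alpha>); since
  \<alpha> < 1, the choice of d / r makes this factor at most 1, and the constant l is not increased
  at any distance.\<close>

lemma tent_mean_holder:
  assumes small: "2 * 4 ^ DIM('a) * 2 powr \<alpha> * (d / r) powr (1 - \<alpha>) \<le> 1"
  shows "\<bar>tent_mean r w x - tent_mean r w y\<bar> \<le> l * norm (x - y) powr \<alpha>"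
proof (cases "d \<le> norm (x - y)")
  case True
  have r: "0 < r" using d by linarith
  show ?thesis
  proof (rule abs_tent_mean_diff_le[OF r w w bdd bdd])
    show "\<bar>w (x + z) - w (y + z)\<bar> \<le> l * norm (x - y) powr \<alpha>" for z
      using osc[of "x + z" "y + z"] True by simp
  qed
next
  case False
  have r: "0 < r" using d by linarith
  show ?thesis
  proof (cases "x = y")
    case False
    define n where "n = norm (x - y)"
    have n: "0 < n" "n < d" using False \<open>\<not> d \<le> norm (x - y)\<close> by (auto simp: n_def)
    have "\<bar>tent_mean r w x - tent_mean r w y\<bar> \<le> 2 * 4 ^ DIM('a) * (l * (2 * r) powr \<alpha>) * norm (x - y) / r"
    proof (rule tent_mean_Lipschitz[OF r w bdd, where c = "w x"])
      fix z assume "z \<in> ball x (2 * r)"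
      then have "max (norm (z - x)) d powr \<alpha> \<le> (2 * r) powr \<alpha>"
        using d \<alpha> by (intro powr_mono2) (auto simp: dist_norm norm_minus_commute)
      then show "\<bar>w z - w x\<bar> \<le> l * (2 * r) powr \<alpha>"
        using osc[of z x] l by (meson mult_left_mono order_trans)
    qed (use n d in \<open>auto simp: n_def\<close>)
    also have "\<dots> = l * n powr \<alpha> * (2 * 4 ^ DIM('a) * 2 powr \<alpha> * (n / r) powr (1 - \<alpha>))"
    proof -
      have "(2 * r) powr \<alpha> * n / r = 2 powr \<alpha> * n * (r powr \<alpha> / r)"
        by (simp add: powr_mult)
      also have "r powr \<alpha> / r = 1 / r powr (1 - \<alpha>)"
        using r by (simp add: powr_diff)
      also have "2 powr \<alpha> * n * (1 / r powr (1 - \<alpha>)) = 2 powr \<alpha> * (n powr \<alpha> * (n / r) powr (1 - \<alpha>))"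
        using n by (simp add: powr_divide powr_diff)
      finally have eq: "(2 * r) powr \<alpha> * n / r = 2 powr \<alpha> * (n powr \<alpha> * (n / r) powr (1 - \<alpha>))" .
      have "2 * 4 ^ DIM('a) * (l * (2 * r) powr \<alpha>) * norm (x - y) / r
          = l * (2 * 4 ^ DIM('a)) * ((2 * r) powr \<alpha> * n / r)"
        by (simp add: n_def mult_ac)
      also have "\<dots> = l * n powr \<alpha> * (2 * 4 ^ DIM('a) * 2 powr \<alpha> * (n / r) powr (1 - \<alpha>))"
        unfolding eq by (simp add: mult_ac)
      finally show ?thesis .
    qed
    also have "\<dots> \<le> l * n powr \<alpha> * 1"
    proof (intro mult_left_mono order_trans[OF _ small])
      show "(n / r) powr (1 - \<alpha>) \<le> (d / r) powr (1 - \<alpha>)"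
        using n d r \<alpha> by (intro powr_mono2 divide_right_mono) auto
    qed (use l in auto)
    finally show ?thesis by (simp add: n_def)
  qed (use l in auto)
qed

end

lemma tent_mean_Lipschitz_of_bounded:
  fixes w :: "'a::euclidean_space \<Rightarrow> real"
  assumes w [measurable]: "w \<in> borel_measurable borel" and bdd: "\<And>x. \<bar>w x\<bar> \<le> B" and r: "0 < r"
  shows "\<bar>tent_mean r w x - tent_mean r w y\<bar> \<le> 2 * 4 ^ DIM('a) * B / r * norm (x - y)"
proof (cases "norm (x - y) \<le> r")
  case True
  have "\<bar>tent_mean r w x - tent_mean r w y\<bar> \<le> 2 * 4 ^ DIM('a) * B * norm (x - y) / r"
    using bdd by (intro tent_mean_Lipschitz[OF r w bdd _ True, where c = 0]) auto
  then show ?thesis by simp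
next
  case False
  have B: "0 \<le> B" using bdd[of x] by linarith
  have "\<bar>tent_mean r w x - tent_mean r w y\<bar> \<le> 2 * B"
  proof (rule abs_tent_mean_diff_le[OF r w w bdd bdd])
    show "\<bar>w (x + z) - w (y + z)\<bar> \<le> 2 * B" for z
      using bdd[of "x + z"] bdd[of "y + z"] by linarith
  qed
  also have "\<dots> \<le> (2 * 4 ^ DIM('a) * B) * (norm (x - y) / r)"
  proof -
    have "2 * B * 1 \<le> (2 * 4 ^ DIM('a) * B) * (norm (x - y) / r)"
      using False B r by (intro mult_mono) (auto simp: mult_right_mono intro!: mult_right_mono)
    then show ?thesis by simp
  qed
  finally show ?thesis by simp
qed


section \<open>Smoothing operators\<close>

lemma measure_pos_of_open_subset:
  fixes U A :: "'a::euclidean_space set"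
  assumes "open U" "U \<noteq> {}" "U \<subseteq> A" "A \<in> sets borel" "emeasure lborel A < \<infinity>"
  shows "0 < measure lborel A"
proof -
  obtain x e where e: "0 < e" "ball x e \<subseteq> U"
    using assms(1,2) by (metis all_not_in_conv openE)
  have "0 < measure lborel (ball x e)"
    using e by (intro measure_ball_pos)
  also have "\<dots> \<le> measure lborel A"
    using assms e by (intro measure_mono_fmeasurable) (auto simp: fmeasurable_def)
  finally show ?thesis .
qed

lemma emeasure_ball_diff_finite:
  fixes \<Omega> :: "'a::euclidean_space set"
  shows "emeasure lborel (ball x \<delta> - \<Omega>) < \<infinity>"
proof -
  have "emeasure lborel (ball x \<delta> - \<Omega>) \<le> emeasure lborel (ball x \<delta>)"
    by (intro emeasure_mono) auto
  then show ?thesis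
    using emeasure_lborel_ball_finite[of x \<delta>] by (rule le_less_trans)
qed

text \<open>Near z the strict subgraph of g is open and disjoint from \<Omega>. It is reached from
  z, which lies on or below the graph as it is not in the open set \<Omega>, by moving
  \<open>\<rho> / 2\<close> against e, which leaves the projection onto the hyperplane
  unchanged.\<close>

lemma measure_ball_diff_frontier_pos:
  fixes \<Omega> :: "'a::euclidean_space set"
  assumes \<Omega>: "open \<Omega>" "lipschitz_set \<Omega>" and z: "z \<in> frontier \<Omega>" and \<delta>: "0 < \<delta>"
  shows "0 < measure lborel (ball z \<delta> - \<Omega>)"
proof -
  obtain r e g L where r: "0 < r" and e: "norm e = 1" and g: "L-lipschitz_on {y. y \<bullet> e = 0} (g :: 'a \<Rightarrow> real)"
    and eq: "\<Omega> \<inter> ball z r = {x \<in> ball z r. g (x - (x \<bullet> e) *\<^sub>R e) < x \<bullet> e}"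
    using \<Omega>(2) z unfolding lipschitz_set_def by blast
  define \<rho> where "\<rho> = min r \<delta>"
  define U where "U = {x \<in> ball z \<rho>. x \<bullet> e < g (x - (x \<bullet> e) *\<^sub>R e)}"
  have \<rho>: "0 < \<rho>" "\<rho> \<le> r" "\<rho> \<le> \<delta>" using r \<delta> by (auto simp: \<rho>_def)
  have ee: "e \<bullet> e = 1" using e by (simp add: dot_square_norm)
  have "continuous_on UNIV (\<lambda>x. g (x - (x \<bullet> e) *\<^sub>R e))"
  proof (rule continuous_on_compose2[OF lipschitz_on_continuous_on[OF g]])
    show "continuous_on UNIV (\<lambda>x. x - (x \<bullet> e) *\<^sub>R e)" by (intro continuous_intros)
    show "range (\<lambda>x. x - (x \<bullet> e) *\<^sub>R e) \<subseteq> {y. y \<bullet> e = 0}"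
      using ee by (auto simp: inner_diff_left)
  qed
  then have "open ({x. x \<bullet> e < g (x - (x \<bullet> e) *\<^sub>R e)} \<inter> ball z \<rho>)"
    by (intro open_Int open_Collect_less continuous_intros) auto
  moreover have "{x. x \<bullet> e < g (x - (x \<bullet> e) *\<^sub>R e)} \<inter> ball z \<rho> = U"
    by (auto simp: U_def)
  ultimately have "open U" by simp
  moreover have "z - (\<rho> / 2) *\<^sub>R e \<in> U"
  proof -
    have "z \<notin> \<Omega>" using \<Omega>(1) z by (simp add: frontier_def interior_open)
    then have "z \<notin> {x \<in> ball z r. g (x - (x \<bullet> e) *\<^sub>R e) < x \<bullet> e}"
      using eq by blast
    then have ge: "z \<bullet> e \<le> g (z - (z \<bullet> e) *\<^sub>R e)"
      using r by simp
    have inner: "(z - (\<rho> / 2) *\<^sub>R e) \<bullet> e = z \<bullet> e - \<rho> / 2"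
      by (simp add: inner_diff_left ee)
    have proj: "z - (\<rho> / 2) *\<^sub>R e - (z \<bullet> e - \<rho> / 2) *\<^sub>R e = z - (z \<bullet> e) *\<^sub>R e"
      by (simp add: scaleR_diff_left)
    have "z - (\<rho> / 2) *\<^sub>R e \<in> ball z \<rho>"
      using \<rho>(1) e by (simp add: dist_norm)
    then show ?thesis
      unfolding U_def mem_Collect_eq inner proj using ge \<rho>(1) by simp
  qed
  moreover have "U \<subseteq> ball z \<delta> - \<Omega>"
  proof
    fix x assume x: "x \<in> U"
    then have "x \<in> ball z r" "x \<in> ball z \<delta>" using \<rho> by (auto simp: U_def)
    moreover have "x \<notin> \<Omega>"
    proof
      assume "x \<in> \<Omega>"
      then have "x \<in> {x \<in> ball z r. g (x - (x \<bullet> e) *\<^sub>R e) < x \<bullet> e}"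
        using eq \<open>x \<in> ball z r\<close> by blast
      then show False using x by (simp add: U_def)
    qed
    ultimately show "x \<in> ball z \<delta> - \<Omega>" by simp
  qed
  ultimately show ?thesis
    using \<Omega>(1) emeasure_ball_diff_finite[of z \<delta> \<Omega>]
    by (intro measure_pos_of_open_subset[of U]) auto
qed

text \<open>Compactness of the frontier makes the positivity uniform. If the ball of radius \<delta>
  / 2 around x meets \<Omega>, it contains a frontier point by connectedness, and the ball of the
  finite cover containing that point lies in \<open>ball x \<delta>\<close>, since \<delta> / 2 +
  \<delta> / 4 + \<delta> / 4 = \<delta>. Otherwise the smaller ball itself lies outside
  \<Omega>.\<close>

lemma exterior_measure_bound:
  fixes \<Omega> :: "'a::euclidean_space set"
  assumes \<Omega>: "open \<Omega>" "bounded \<Omega>" "lipschitz_set \<Omega>" and \<delta>: "0 < \<delta>"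
  obtains c where "0 < c" "\<And>x. x \<notin> \<Omega> \<Longrightarrow> c \<le> measure lborel (ball x \<delta> - \<Omega>)"
proof -
  let ?m = "\<lambda>z. measure lborel (ball z (\<delta> / 4) - \<Omega>)"
  have "compact (frontier \<Omega>)" using \<Omega>(2) by (rule compact_frontier_bounded)
  then obtain T where T: "T \<subseteq> frontier \<Omega>" "finite T" "frontier \<Omega> \<subseteq> (\<Union>z\<in>T. ball z (\<delta> / 4))"
    using \<delta> by (elim compactE_image[where C = "frontier \<Omega>" and f = "\<lambda>z. ball z (\<delta> / 4)"]) auto
  define c where "c = Min (insert (measure lborel (ball (0::'a) (\<delta> / 2))) (?m ` T))"
  have mono: "measure lborel A \<le> measure lborel (ball x \<delta> - \<Omega>)"
    if "A \<subseteq> ball x \<delta> - \<Omega>" "A \<in> sets borel" for x A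
    using that \<Omega>(1) emeasure_ball_diff_finite[of x \<delta> \<Omega>]
    by (intro measure_mono_fmeasurable) (auto simp: fmeasurable_def)
  show ?thesis
  proof
    show "0 < c"
      unfolding c_def using T \<delta> measure_ball_diff_frontier_pos[OF \<Omega>(1,3), of _ "\<delta> / 4"]
      by (subst Min_gr_iff) auto
  next
    fix x assume x: "x \<notin> \<Omega>"
    show "c \<le> measure lborel (ball x \<delta> - \<Omega>)"
    proof (cases "ball x (\<delta> / 2) \<inter> \<Omega> = {}")
      case True
      have "c \<le> measure lborel (ball x (\<delta> / 2))"
        unfolding c_def measure_ball_eq[of x _ 0] using T(2) by (intro Min_le) auto
      also have "\<dots> \<le> measure lborel (ball x \<delta> - \<Omega>)"
        using True \<delta> by (intro mono) auto
      finally show ?thesis .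
    next
      case False
      have "ball x (\<delta> / 2) \<inter> frontier \<Omega> \<noteq> {}"
      proof (rule connected_Int_frontier)
        have "x \<in> ball x (\<delta> / 2) - \<Omega>" using x \<delta> by simp
        then show "ball x (\<delta> / 2) - \<Omega> \<noteq> {}" by blast
      qed (use False in \<open>auto intro: convex_connected\<close>)
      then obtain z where z: "z \<in> ball x (\<delta> / 2)" "z \<in> frontier \<Omega>" by blast
      then obtain y where y: "y \<in> T" "z \<in> ball y (\<delta> / 4)" using T(3) by blast
      have "c \<le> ?m y" unfolding c_def using T(2) y by (intro Min_le) auto
      also have "\<dots> \<le> measure lborel (ball x \<delta> - \<Omega>)"
      proof (rule mono)
        have "dist x w < \<delta>" if "w \<in> ball y (\<delta> / 4)" for w
          using that z y dist_triangle[of x w z] dist_triangle[of z w y] by (simp add: dist_commute)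
        then show "ball y (\<delta> / 4) - \<Omega> \<subseteq> ball x \<delta> - \<Omega>" by auto
      qed (use \<Omega>(1) in auto)
      finally show ?thesis .
    qed
  qed
qed

text \<open>A difference t of two values equals t^(1 - \<alpha>) t^\<alpha>, with t at most 2
  \<epsilon> in the first factor and at most Q times the distance in the second. Uniform convergence
  under a common Lipschitz bound thus implies convergence in the Hoelder norm.\<close>

lemma holder_norm_le_interpolation:
  fixes f :: "'a::euclidean_space \<Rightarrow>\<^sub>C real"
  assumes \<alpha>: "0 < \<alpha>" "\<alpha> < 1" and \<epsilon>: "norm f \<le> \<epsilon>" and Q: "0 \<le> Q"
    and lip: "\<And>x y. \<bar>apply_bcontfun f x - apply_bcontfun f y\<bar> \<le> Q * norm (x - y)"
  shows "holder_norm \<alpha> f \<le> ennreal (\<epsilon> + (2 * \<epsilon>) powr (1 - \<alpha>) * Q powr \<alpha>)"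
proof -
  have \<epsilon>0: "0 \<le> \<epsilon>" using \<epsilon> norm_ge_zero[of f] by linarith
  have "\<bar>apply_bcontfun f x - apply_bcontfun f y\<bar> \<le> ((2 * \<epsilon>) powr (1 - \<alpha>) * Q powr \<alpha>) * norm (x - y) powr \<alpha>" for x y
  proof -
    let ?t = "\<bar>apply_bcontfun f x - apply_bcontfun f y\<bar>"
    have "?t \<le> 2 * \<epsilon>"
      using norm_bounded[of f x] norm_bounded[of f y] \<epsilon> by auto
    then have "?t powr (1 - \<alpha>) * ?t powr \<alpha> \<le> (2 * \<epsilon>) powr (1 - \<alpha>) * (Q * norm (x - y)) powr \<alpha>"
      using lip \<alpha> by (intro mult_mono powr_mono2) auto
    moreover have "?t powr (1 - \<alpha>) * ?t powr \<alpha> = ?t"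
      by (simp flip: powr_add)
    ultimately show ?thesis by (simp add: powr_mult mult_ac)
  qed
  then have "holder_seminorm \<alpha> f \<le> ennreal ((2 * \<epsilon>) powr (1 - \<alpha>) * Q powr \<alpha>)"
    using \<alpha> by (subst holder_seminorm_le_iff) auto
  then have "holder_norm \<alpha> f \<le> ennreal \<epsilon> + ennreal ((2 * \<epsilon>) powr (1 - \<alpha>) * Q powr \<alpha>)"
    unfolding holder_norm_def using \<epsilon> by (intro add_mono ennreal_leI)
  then show ?thesis using \<epsilon>0 by simp
qed

lemma interpolation_bound_small:
  fixes \<alpha> e Q :: real
  assumes "\<alpha> < 1" "0 < e"
  obtains \<epsilon> where "0 < \<epsilon>" "\<epsilon> + (2 * \<epsilon>) powr (1 - \<alpha>) * Q powr \<alpha> < e"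
proof -
  have "((\<lambda>\<epsilon>. \<epsilon> + (2 * \<epsilon>) powr (1 - \<alpha>) * Q powr \<alpha>) \<longlongrightarrow> 0 + 0 * Q powr \<alpha>) (at_right 0)"
  proof (intro tendsto_add tendsto_mult tendsto_const tendsto_ident_at tendsto_zero_powrI[OF _ tendsto_const])
    show "((\<lambda>\<epsilon>::real. 2 * \<epsilon>) \<longlongrightarrow> 0) (at_right 0)"
      by (auto intro!: tendsto_eq_intros)
    show "\<forall>\<^sub>F \<epsilon>::real in at_right 0. 0 \<le> 2 * \<epsilon>"
      by (auto simp: eventually_at_right_field intro: exI[of _ 1])
  qed (use assms in auto)
  then have "\<forall>\<^sub>F \<epsilon> in at_right 0. \<epsilon> + (2 * \<epsilon>) powr (1 - \<alpha>) * Q powr \<alpha> < e"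
    using assms by (intro order_tendstoD(2)) auto
  then have "\<forall>\<^sub>F \<epsilon> in at_right 0. 0 < \<epsilon> \<and> \<epsilon> + (2 * \<epsilon>) powr (1 - \<alpha>) * Q powr \<alpha> < e"
    using eventually_at_right_less by (rule eventually_conj[rotated])
  then show ?thesis
    using that eventually_happens by (metis (no_types, lifting) trivial_limit_at_right_real)
qed

lemma norm_normalize_diff_le:
  fixes a b :: "'v::real_normed_vector"
  assumes "0 < norm a" "0 < norm b"
  shows "norm (inverse (norm a) *\<^sub>R a - inverse (norm b) *\<^sub>R b) \<le> 2 * norm (a - b) / norm a"
proof -
  have "inverse (norm a) *\<^sub>R a - inverse (norm b) *\<^sub>R b
      = inverse (norm a) *\<^sub>R (a - b) + (inverse (norm a) - inverse (norm b)) *\<^sub>R b"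
    by (simp add: algebra_simps)
  also have "norm \<dots> \<le> inverse (norm a) * norm (a - b) + \<bar>inverse (norm a) - inverse (norm b)\<bar> * norm b"
    by (rule order_trans[OF norm_triangle_ineq]) simp
  also have "\<bar>inverse (norm a) - inverse (norm b)\<bar> * norm b = \<bar>norm b - norm a\<bar> / norm a"
  proof -
    have "inverse (norm a) - inverse (norm b) = (norm b - norm a) / (norm a * norm b)"
      using assms by (simp add: field_simps)
    then show ?thesis using assms by (simp add: abs_mult)
  qed
  also have "\<bar>norm b - norm a\<bar> / norm a \<le> norm (a - b) / norm a"
    using assms norm_triangle_ineq3[of b a] by (intro divide_right_mono) (auto simp: norm_minus_commute)
  finally show ?thesis by (simp add: field_simps)
qed

text \<open>\<open>Bcontfun\<close> is meaningful only for bounded continuous arguments;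
  \<open>apply_smoothing\<close> verifies this when the ball means are bounded.\<close>

definition smoothing :: "real \<Rightarrow> real \<Rightarrow> real \<Rightarrow> ('a::euclidean_space \<Rightarrow> real) \<Rightarrow> 'a \<Rightarrow>\<^sub>C real" where
  "smoothing \<delta> r \<eta> u = Bcontfun (\<lambda>x. soft \<eta> (tent_mean r (ball_mean \<delta> u) x))"

lemma apply_smoothing:
  fixes u :: "'a::euclidean_space \<Rightarrow> real"
  assumes [measurable]: "u \<in> borel_measurable borel" and B: "\<And>x. \<bar>ball_mean \<delta> u x\<bar> \<le> B"
    and r: "0 < r" and \<eta>: "0 \<le> \<eta>"
  shows "apply_bcontfun (smoothing \<delta> r \<eta> u) = (\<lambda>x. soft \<eta> (tent_mean r (ball_mean \<delta> u) x))"
proof -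
  let ?W = "tent_mean r (ball_mean \<delta> u)" and ?Q = "2 * 4 ^ DIM('a) * B / r"
  have B0: "0 \<le> B" using B[of 0] by linarith
  have "\<bar>soft \<eta> (?W x) - soft \<eta> (?W y)\<bar> \<le> ?Q * norm (x - y)" for x y
    by (rule order_trans[OF abs_soft_diff_le tent_mean_Lipschitz_of_bounded[OF _ B r]]) measurable
  then have "?Q-lipschitz_on UNIV (\<lambda>x. soft \<eta> (?W x))"
    using B0 r by (intro lipschitz_onI) (auto simp: dist_norm)
  then have "continuous_on UNIV (\<lambda>x. soft \<eta> (?W x))"
    by (rule lipschitz_on_continuous_on)
  moreover have "norm (soft \<eta> (?W x)) \<le> B" for x
  proof -
    have "\<bar>tent_mean r (ball_mean \<delta> u) x - tent_mean r (\<lambda>_. 0) x\<bar> \<le> B"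
      using B B0 by (intro abs_tent_mean_diff_le[OF r _ _ B]) auto
    then show ?thesis
      using abs_soft_diff_le[of \<eta> "?W x" 0] soft_eq_0[of 0 \<eta>] \<eta> by (simp add: tent_mean_const[OF r])
  qed
  ultimately show ?thesis
    unfolding smoothing_def by (intro Bcontfun_inverse bcontfun_normI)
qed

text \<open>
  The map \<open>u \<mapsto> v / \<parallel>v\<parallel>\<close> with \<open>v = smoothing \<delta> r \<eta> u\<close> sends \<open>G\<close> into the set below. Thresholding
  at height \<open>\<eta>\<close> moves the support into \<open>\<Omega>\<close>, and averaging first on the scale \<open>\<delta>\<close> and then on the
  much larger scale \<open>r\<close> keeps the Hoelder constant, which a single average would not do at distances
  comparable to its scale.
\<close>

lemma smoothed_sublevel_in_\<G>_infty:
  fixes \<Omega> :: "'a::euclidean_space set"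
  assumes \<Omega>: "open \<Omega>" "bounded \<Omega>" and \<alpha>: "0 < \<alpha>" "\<alpha> < 1" and p: "1 \<le> p"
    and G: "G \<in> \<G>_p k s p \<Omega>"
    and \<mu>: "0 < \<mu>" and \<kappa>: "0 \<le> \<kappa>"
    and J: "\<And>u. u \<in> G \<Longrightarrow>
      (\<integral>\<^sup>+z. ennreal ((\<bar>hquot \<alpha> u z\<bar> / \<mu>) powr p) \<partial>(lborel \<Otimes>\<^sub>M lborel)) \<le> ennreal \<kappa>"
    and \<delta>: "0 < \<delta>" "2 * \<delta> \<le> r" and d: "0 < d" "d \<le> r"
    and c: "0 < c" "\<And>x. x \<notin> \<Omega> \<Longrightarrow> c \<le> measure lborel (ball x \<delta> - \<Omega>)"
    and \<beta>: "\<beta> = measure lborel (ball (0::'a) \<delta>)"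
    and l_osc: "(1 + 2 * \<delta> / d) powr \<alpha> * \<mu> * (1 + \<kappa> / (\<beta> * \<beta>)) \<le> l"
    and l_ext: "\<mu> * (1 + \<kappa> / (\<beta> * c)) \<le> l"
    and small: "2 * 4 ^ DIM('a) * 2 powr \<alpha> * (d / r) powr (1 - \<alpha>) \<le> 1"
    and \<eta>: "0 < \<eta>" "\<eta> \<le> 1 / 4" and r_\<eta>: "4 * l * r powr \<alpha> \<le> \<eta>"
    and mass: "measure lborel \<Omega> * (1 - \<eta> / 2) powr p
      + (2 * \<delta> powr \<alpha> * \<mu> * (1 + (1 - 3 * \<eta> / 4) / (\<eta> / 4))) powr p * (\<kappa> / \<beta>) < 1"
    and M: "l \<le> (1 - 2 * \<eta>) * M"
  shows "{v \<in> C_0_holder \<alpha> \<Omega>. ennreal (norm v) = 1 \<and> holder_seminorm \<alpha> v \<le> ennreal M} \<in> \<G>_infty k \<alpha> \<Omega>"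
proof -
  have p0: "0 < p" and r: "0 < r" and \<beta>0: "0 < \<beta>" using p d \<delta> by (auto simp: \<beta>)
  have "0 \<le> \<mu> * (1 + \<kappa> / (\<beta> * c))" using \<mu> \<kappa> \<beta>0 c(1) by simp
  with l_ext have l: "0 \<le> l" by linarith
  define B where "B = 2 / \<beta> powr (1 / p)"
  define Q where "Q = 2 * 4 ^ DIM('a) * B / r"
  have Q: "0 \<le> Q" using r by (simp add: Q_def B_def)
  \<comment> \<open>Lower bound for the sup norm of \<open>V u\<close>: one \<eta> is lost by
    averaging, the other by thresholding.\<close>
  define \<nu> where "\<nu> = 1 - 2 * \<eta>"
  have \<nu>: "0 < \<nu>" using \<eta> by (simp add: \<nu>_def)
  have GD: "u \<in> borel_measurable borel" "AE x in lborel. x \<notin> \<Omega> \<longrightarrow> u x = 0" "Lp_norm p u = 1"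
      "- u \<in> G" "u \<in> Wsp0 s p \<Omega>" if "u \<in> G" for u
    using G that by (auto simp: \<G>_p_def genus_family_def Wsp0_def Wsp_def)
  have I1: "(\<integral>\<^sup>+x. ennreal (\<bar>u x\<bar> powr p) \<partial>lborel) = 1" if "u \<in> G" for u
    using GD(3)[OF that] p0 by (simp add: Lp_norm_def epowr_eq_one_iff)
  have I_fin: "(\<integral>\<^sup>+x. ennreal (\<bar>u x\<bar> powr p) \<partial>lborel) < \<infinity>" if "u \<in> G" for u
    using I1[OF that] by simp
  have wB: "\<bar>ball_mean \<delta> u x\<bar> \<le> B" if "u \<in> G" for u x
    using abs_ball_mean_le[OF GD(1)[OF that] p \<delta>(1), of 1 x] GD(3)[OF that] by (simp add: B_def \<beta>)
  have osc: "\<bar>ball_mean \<delta> u x - ball_mean \<delta> u y\<bar> \<le> l * max (norm (x - y)) d powr \<alpha>" if u: "u \<in> G" for u x y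
  proof -
    define m where "m = max (norm (x - y)) d"
    have m: "d \<le> m" "norm (x - y) \<le> m" by (auto simp: m_def)
    \<comment> \<open>At distances truncated from below by d, the additional 2 \<delta> is at most
      the fraction \<open>2 * \<delta> / d\<close> of m.\<close>
    have "2 * \<delta> * d \<le> 2 * \<delta> * m" using m(1) \<delta> by (intro mult_left_mono) auto
    then have "2 * \<delta> \<le> m * (2 * \<delta> / d)" using d by (simp add: field_simps)
    then have "norm (x - y) + 2 * \<delta> \<le> m * (1 + 2 * \<delta> / d)"
      using m(2) by (simp add: distrib_left)
    then have "(norm (x - y) + 2 * \<delta>) powr \<alpha> \<le> m powr \<alpha> * (1 + 2 * \<delta> / d) powr \<alpha>"
      using \<alpha> \<delta> by (simp add: powr_mono2 flip: powr_mult)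
    then have "(norm (x - y) + 2 * \<delta>) powr \<alpha> * \<mu> * (1 + \<kappa> / (\<beta> * \<beta>))
        \<le> (m powr \<alpha> * (1 + 2 * \<delta> / d) powr \<alpha>) * \<mu> * (1 + \<kappa> / (\<beta> * \<beta>))"
      using \<mu> \<kappa> by (intro mult_right_mono) auto
    also have "\<dots> = m powr \<alpha> * ((1 + 2 * \<delta> / d) powr \<alpha> * \<mu> * (1 + \<kappa> / (\<beta> * \<beta>)))"
      by (simp only: mult.assoc)
    also have "\<dots> \<le> m powr \<alpha> * l"
      by (intro mult_left_mono l_osc) auto
    finally show ?thesis
      using ball_mean_diff_le[OF GD(1)[OF u] \<alpha>(1) p \<mu> \<kappa> \<delta>(1) I_fin[OF u] J[OF u], of x y]
      by (simp add: m_def \<beta> mult.commute)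
  qed
  have ext: "\<bar>ball_mean \<delta> u x\<bar> \<le> l * r powr \<alpha>" if u: "u \<in> G" and x: "x \<notin> \<Omega>" for u x
  proof -
    have "\<bar>ball_mean \<delta> u x\<bar> \<le> (2 * \<delta>) powr \<alpha> * \<mu> * (1 + \<kappa> / (\<beta> * c))"
      unfolding \<beta> using GD(1)[OF u] \<alpha>(1) p \<mu> \<kappa> \<delta>(1) I_fin[OF u] J[OF u] \<Omega>(1) GD(2)[OF u] c(1) c(2)[OF x]
      by (rule ball_mean_le_of_null_part)
    also have "\<dots> = (2 * \<delta>) powr \<alpha> * (\<mu> * (1 + \<kappa> / (\<beta> * c)))" by (simp only: mult.assoc)
    also have "\<dots> \<le> r powr \<alpha> * l"
      using \<delta> \<alpha> l l_ext \<mu> \<kappa> \<beta>0 c(1) by (intro mult_mono powr_mono2) auto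
    finally show ?thesis by (simp add: mult.commute)
  qed
  define W where "W u = tent_mean r (ball_mean \<delta> u)" for u :: "'a \<Rightarrow> real"
  define V where "V u = smoothing \<delta> r \<eta> u" for u :: "'a \<Rightarrow> real"
  have V: "apply_bcontfun (V u) x = soft \<eta> (W u x)" if "u \<in> G" for u x
    unfolding V_def W_def using apply_smoothing[OF GD(1)[OF that] wB[OF that] r] \<eta> by simp
  have Ww: "\<bar>W u x - ball_mean \<delta> u x\<bar> \<le> l * r powr \<alpha>" if "u \<in> G" for u x
    unfolding W_def using measurable_ball_mean[OF GD(1)[OF that]] wB[OF that] osc[OF that] l \<alpha> d
    by (rule abs_tent_mean_minus_le)
  \<comment> \<open>The inner mean and the second average contribute at most \<eta> / 4 each. The
    sum is strictly below \<eta>, so the closed set where \<open>\<bar>W u x\<bar>\<close> reaches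
    \<eta> lies in \<Omega> and contains the closure of the support of \<open>R u\<close>.\<close>
  have W_ext: "\<bar>W u x\<bar> \<le> \<eta> / 2" if "u \<in> G" "x \<notin> \<Omega>" for u x
    using Ww[OF that(1), of x] ext[OF that] r_\<eta> by linarith
  have W_hol: "\<bar>W u x - W u y\<bar> \<le> l * norm (x - y) powr \<alpha>" if "u \<in> G" for u x y
    unfolding W_def using measurable_ball_mean[OF GD(1)[OF that]] wB[OF that] osc[OF that] l \<alpha> d small
    by (rule tent_mean_holder)
  have W_lip: "\<bar>W u x - W u y\<bar> \<le> Q * norm (x - y)" if "u \<in> G" for u x y
    unfolding W_def Q_def using measurable_ball_mean[OF GD(1)[OF that]] wB[OF that] r
    by (rule tent_mean_Lipschitz_of_bounded)
  have W_large: "\<exists>x. 1 - \<eta> \<le> \<bar>W u x\<bar>" if u: "u \<in> G" for u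
  proof -
    \<comment> \<open>With tolerance \<eta> / 4 the main term of
      \<open>Lp_le_of_ball_mean_le\<close> has base 1 - \<eta> / 2, and \<open>mass\<close>
      contradicts the p-norm being 1. The second average then costs another \<eta> / 4, leaving 1 -
      \<eta>.\<close>
    have "\<exists>x\<in>\<Omega>. 1 - 3 * \<eta> / 4 < \<bar>ball_mean \<delta> u x\<bar>"
    proof (rule ccontr)
      assume "\<not> ?thesis"
      then have m: "\<And>x. x \<in> \<Omega> \<Longrightarrow> \<bar>ball_mean \<delta> u x\<bar> \<le> 1 - 3 * \<eta> / 4" by (auto simp: not_less)
      have "(\<integral>\<^sup>+x. ennreal (\<bar>u x\<bar> powr p) \<partial>lborel) \<le> ennreal (measure lborel \<Omega> * ((1 - 3 * \<eta> / 4) + \<eta> / 4) powr p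
          + (2 * \<delta> powr \<alpha> * \<mu> * (1 + (1 - 3 * \<eta> / 4) / (\<eta> / 4))) powr p * (\<kappa> / measure lborel (ball (0::'a) \<delta>)))"
        using \<eta> by (intro Lp_le_of_ball_mean_le[OF GD(1)[OF u] \<alpha>(1) p \<mu> \<kappa> \<delta>(1) I_fin[OF u] J[OF u] \<Omega> GD(2)[OF u] _ m]) auto
      also have "(1 - 3 * \<eta> / 4) + \<eta> / 4 = 1 - \<eta> / 2" by simp
      also have "ennreal (measure lborel \<Omega> * (1 - \<eta> / 2) powr p
          + (2 * \<delta> powr \<alpha> * \<mu> * (1 + (1 - 3 * \<eta> / 4) / (\<eta> / 4))) powr p * (\<kappa> / measure lborel (ball (0::'a) \<delta>))) < 1"
        unfolding \<beta>[symmetric] using mass by (intro ennreal_less_one_iff[THEN iffD2])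
      finally show False using I1[OF u] by simp
    qed
    then obtain x where "1 - 3 * \<eta> / 4 < \<bar>ball_mean \<delta> u x\<bar>" by blast
    then show ?thesis using Ww[OF u, of x] r_\<eta> by (intro exI[of _ x]) linarith
  qed
  have V_norm: "\<nu> \<le> norm (V u)" if u: "u \<in> G" for u
  proof -
    obtain x where "1 - \<eta> \<le> \<bar>W u x\<bar>" using W_large[OF u] by blast
    then have "\<nu> \<le> \<bar>apply_bcontfun (V u) x\<bar>"
      using abs_soft_ge[of \<eta> "W u x"] \<eta> V[OF u] by (simp add: \<nu>_def)
    then show ?thesis using norm_bounded[of "V u" x] by simp
  qed
  define R where "R u = inverse (norm (V u)) *\<^sub>R V u" for u
  have R_diff: "\<bar>apply_bcontfun (R u) x - apply_bcontfun (R u) y\<bar> \<le> inverse \<nu> * \<bar>W u x - W u y\<bar>"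
    if u: "u \<in> G" for u x y
  proof -
    have "apply_bcontfun (R u) x - apply_bcontfun (R u) y
        = inverse (norm (V u)) * (soft \<eta> (W u x) - soft \<eta> (W u y))"
      by (simp add: R_def V[OF u] right_diff_distrib)
    then have "\<bar>apply_bcontfun (R u) x - apply_bcontfun (R u) y\<bar>
        = inverse (norm (V u)) * \<bar>soft \<eta> (W u x) - soft \<eta> (W u y)\<bar>"
      by (simp add: abs_mult)
    also have "\<dots> \<le> inverse \<nu> * \<bar>W u x - W u y\<bar>"
      using V_norm[OF u] \<nu> by (intro mult_mono abs_soft_diff_le le_imp_inverse_le) auto
    finally show ?thesis .
  qed
  have R_C0: "R u \<in> C_0 \<Omega>" if u: "u \<in> G" for u
  proof -
    let ?S = "closure {x. apply_bcontfun (R u) x \<noteq> 0}"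
    have "{x. apply_bcontfun (R u) x \<noteq> 0} \<subseteq> {x. \<eta> \<le> \<bar>W u x\<bar>}"
    proof (rule subsetI)
      fix x assume "x \<in> {x. apply_bcontfun (R u) x \<noteq> 0}"
      then have "soft \<eta> (W u x) \<noteq> 0" by (simp add: R_def V[OF u])
      then have "\<not> \<bar>W u x\<bar> \<le> \<eta>" using soft_eq_0 by blast
      then show "x \<in> {x. \<eta> \<le> \<bar>W u x\<bar>}" by simp
    qed
    moreover have "closed {x. \<eta> \<le> \<bar>W u x\<bar>}"
    proof -
      have "Q-lipschitz_on UNIV (W u)"
        using W_lip[OF u] Q by (intro lipschitz_onI) (auto simp: dist_norm)
      then have "continuous_on UNIV (W u)" by (rule lipschitz_on_continuous_on)
      then show ?thesis by (intro closed_Collect_le continuous_intros)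
    qed
    ultimately have "?S \<subseteq> {x. \<eta> \<le> \<bar>W u x\<bar>}" by (rule closure_minimal)
    moreover have "{x. \<eta> \<le> \<bar>W u x\<bar>} \<subseteq> \<Omega>"
    proof (rule subsetI, rule ccontr)
      fix x assume "x \<in> {x. \<eta> \<le> \<bar>W u x\<bar>}" "x \<notin> \<Omega>"
      then show False using W_ext[OF u, of x] \<eta>(1) by simp
    qed
    ultimately have sub: "?S \<subseteq> \<Omega>" by (rule subset_trans)
    then have "compact ?S"
      using bounded_subset[OF \<Omega>(2) sub] by (simp add: compact_eq_bounded_closed)
    then have "R u \<in> C_c \<Omega>" using sub by (simp add: C_c_def)
    then show ?thesis
      unfolding C_0_def using closure_subset by (rule set_mp[rotated])
  qed
  have R_norm: "norm (R u) = 1" if "u \<in> G" for u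
  proof -
    have "norm (V u) \<noteq> 0" using V_norm[OF that] \<nu> by linarith
    then show ?thesis by (simp add: R_def)
  qed
  have R_hol: "holder_seminorm \<alpha> (R u) \<le> ennreal M" if u: "u \<in> G" for u
  proof -
    have lM: "inverse \<nu> * l \<le> M" using M \<nu> by (simp add: \<nu>_def field_simps)
    have M0: "0 \<le> M"
      using lM l \<nu> by (meson inverse_nonnegative_iff_nonnegative less_imp_le mult_nonneg_nonneg order_trans)
    have "\<bar>apply_bcontfun (R u) x - apply_bcontfun (R u) y\<bar> \<le> M * norm (x - y) powr \<alpha>" for x y
    proof -
      have "inverse \<nu> * \<bar>W u x - W u y\<bar> \<le> inverse \<nu> * (l * norm (x - y) powr \<alpha>)"
        using \<nu> W_hol[OF u] by (intro mult_left_mono) auto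
      also have "\<dots> = (inverse \<nu> * l) * norm (x - y) powr \<alpha>" by simp
      also have "\<dots> \<le> M * norm (x - y) powr \<alpha>" by (intro mult_right_mono lM) auto
      finally show ?thesis using R_diff[OF u, of x y] by linarith
    qed
    then show ?thesis using M0 \<alpha> by (subst holder_seminorm_le_iff) auto
  qed
  have R_lip: "\<bar>apply_bcontfun (R u) x - apply_bcontfun (R u) y\<bar> \<le> inverse \<nu> * Q * norm (x - y)"
    if u: "u \<in> G" for u x y
  proof -
    have "inverse \<nu> * \<bar>W u x - W u y\<bar> \<le> inverse \<nu> * (Q * norm (x - y))"
      using \<nu> W_lip[OF u] by (intro mult_left_mono) auto
    then show ?thesis using R_diff[OF u, of x y] by simp
  qed
  show ?thesis
    unfolding \<G>_infty_def
  proof (rule sublevel_in_genus_family[where G = G and V = "Wsp0 s p \<Omega>" and nrm = "Wsp_norm s p"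
        and R = R and ?sph0.0 = "Lp_norm p"])
    show "G \<in> genus_family k (Wsp0 s p \<Omega>) (Wsp_norm s p) (Lp_norm p)"
      using G by (simp add: \<G>_p_def)
    show "Wsp_norm s p (u - w) \<le> Wsp_norm s p (u - v) + Wsp_norm s p (v - w)"
      if "u \<in> Wsp0 s p \<Omega>" "v \<in> Wsp0 s p \<Omega>" "w \<in> Wsp0 s p \<Omega>" for u v w
      using that p by (intro Wsp_norm_triangle) (auto simp: Wsp0_def Wsp_def)
    show "Wsp_norm s p (u - u) = 0" for u :: "'a \<Rightarrow> real"
      by (rule Wsp_norm_diff_self[OF p0])
  next
    fix u assume u: "u \<in> G"
    show "R u \<in> C_0_holder \<alpha> \<Omega> \<and> ennreal (norm (R u)) = 1 \<and> holder_seminorm \<alpha> (R u) \<le> ennreal M"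
      using R_C0[OF u] R_norm[OF u] R_hol[OF u] by (auto simp: C_0_holder_def elim: le_less_trans)
    have "ball_mean \<delta> (- u) = (\<lambda>x. - ball_mean \<delta> u x)"
      by (simp add: ball_mean_def fun_eq_iff)
    then have "W (- u) x = - W u x" for x
      by (simp add: W_def tent_mean_def)
    then have "V (- u) = - V u"
      using \<eta> by (intro bcontfun_eqI) (simp add: V[OF u] V[OF GD(4)[OF u]] soft_minus)
    then show "R (- u) = - R u" by (simp add: R_def)
  next
    fix u and e :: real
    assume u: "u \<in> G" and e: "0 < e"
    obtain \<epsilon> where \<epsilon>: "0 < \<epsilon>" "\<epsilon> + (2 * \<epsilon>) powr (1 - \<alpha>) * (2 * (inverse \<nu> * Q)) powr \<alpha> < e"
      using interpolation_bound_small[OF \<alpha>(2) e] by blast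
    \<comment> \<open>Chosen so that the bound \<open>B * t\<close> for \<open>V v - V u\<close>,
      doubled and divided by \<nu> in the normalisation, is exactly \<epsilon>.\<close>
    define t where "t = \<epsilon> * \<nu> / (2 * B)"
    have B: "0 < B" using \<beta>0 by (simp add: B_def)
    have t: "0 < t" using \<epsilon>(1) \<nu> B by (simp add: t_def)
    have "holder_norm \<alpha> (R v - R u) < ennreal e" if v: "v \<in> G" and vu: "Wsp_norm s p (v - u) < ennreal t" for v
    proof -
      have vu_meas: "v - u \<in> borel_measurable borel"
        by (intro borel_measurable_fun_diff GD(1) u v)
      have "Lp_norm p (v - u) \<le> ennreal t"
        using order_trans[OF Lp_norm_le_Wsp_norm[OF p0] less_imp_le[OF vu]] .
      then have bm: "\<bar>ball_mean \<delta> (v - u) x\<bar> \<le> B * t" for x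
        using abs_ball_mean_le[OF vu_meas p \<delta>(1), of t x] t by (simp add: B_def \<beta>)
      have w_diff: "\<bar>ball_mean \<delta> v x - ball_mean \<delta> u x\<bar> \<le> B * t" for x
      proof -
        have "integrable lborel (\<lambda>z. indicator (ball x \<delta>) z * f z)" if "f \<in> G" for f
          using GD(1)[OF that] I_fin[OF that] p emeasure_lborel_ball_finite[of x \<delta>]
          by (intro integrable_indicator_of_powr) auto
        then show ?thesis using bm[of x] by (simp add: ball_mean_diff u v)
      qed
      have "\<bar>W v x - W u x\<bar> \<le> B * t" for x
        unfolding W_def
        by (rule abs_tent_mean_diff_le[OF r measurable_ball_mean[OF GD(1)[OF v]]
              measurable_ball_mean[OF GD(1)[OF u]] wB[OF v] wB[OF u]]) (rule w_diff)
      then have "\<bar>apply_bcontfun (V v - V u) x\<bar> \<le> B * t" for x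
        using abs_soft_diff_le[of \<eta> "W v x" "W u x"] by (simp add: V u v) (meson order_trans)
      then have "norm (V v - V u) \<le> B * t"
        by (intro norm_bound) simp
      then have "2 * norm (V v - V u) / norm (V v) \<le> 2 * (B * t) / \<nu>"
        using V_norm[OF v] \<nu> B t by (intro frac_le) auto
      also have "\<dots> = \<epsilon>" using B \<nu> by (simp add: t_def)
      finally have *: "2 * norm (V v - V u) / norm (V v) \<le> \<epsilon>" .
      have "0 < norm (V v)" "0 < norm (V u)"
        using V_norm[OF v] V_norm[OF u] \<nu> by linarith+
      then have n: "norm (R v - R u) \<le> \<epsilon>"
        unfolding R_def using * by (rule order_trans[OF norm_normalize_diff_le])
      have "\<bar>apply_bcontfun (R v - R u) x - apply_bcontfun (R v - R u) y\<bar> \<le> 2 * (inverse \<nu> * Q) * norm (x - y)" for x y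
        using R_lip[OF u, of x y] R_lip[OF v, of x y] by simp
      then have "holder_norm \<alpha> (R v - R u)
          \<le> ennreal (\<epsilon> + (2 * \<epsilon>) powr (1 - \<alpha>) * (2 * (inverse \<nu> * Q)) powr \<alpha>)"
        using \<nu> Q by (intro holder_norm_le_interpolation[OF \<alpha> n]) auto
      also have "\<dots> < ennreal e" using \<epsilon> e by (intro ennreal_lessI)
      finally show ?thesis .
    qed
    then show "\<exists>d>0. \<forall>v\<in>G. Wsp_norm s p (v - u) < ennreal d \<longrightarrow> holder_norm \<alpha> (R v - R u) < ennreal e"
      using t by blast
  next
    show "ennreal (norm u) \<le> ennreal (norm v) + holder_norm \<alpha> (v - u)"
      "ennreal (norm v) \<le> ennreal (norm u) + holder_norm \<alpha> (v - u)"
      "holder_seminorm \<alpha> u \<le> holder_seminorm \<alpha> v + holder_norm \<alpha> (v - u)" for u v :: "'a \<Rightarrow>\<^sub>C real"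
      by (rule norm_le_add_holder_norm norm_le_add_holder_norm' holder_seminorm_le_add; fact \<alpha>(1))+
    show "ennreal (norm u) < \<infinity>" "holder_norm \<alpha> u \<le> ennreal (norm u) + holder_seminorm \<alpha> u" for u :: "'a \<Rightarrow>\<^sub>C real"
      by (simp_all add: holder_norm_def)
    show "holder_seminorm \<alpha> u < \<infinity>" if "u \<in> C_0_holder \<alpha> \<Omega>" for u
      using that by (simp add: C_0_holder_def)
    show "ennreal M < \<infinity>" by simp
    show "- u \<in> C_0_holder \<alpha> \<Omega> \<and> ennreal (norm (- u)) = ennreal (norm u)
        \<and> holder_seminorm \<alpha> (- u) = holder_seminorm \<alpha> u \<and> - (- u) = u" if "u \<in> C_0_holder \<alpha> \<Omega>" for u
      using that by (simp add: uminus_C_0_holder holder_seminorm_uminus)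
  qed
qed

section \<open>The lower bound for the limit\<close>

lemma nn_integral_hquot_scaled_le:
  fixes u :: "'a::euclidean_space \<Rightarrow> real"
  assumes [measurable]: "u \<in> borel_measurable borel" and p: "0 < p" and \<mu>: "0 < \<mu>" and b: "0 \<le> b"
    and s: "s = \<alpha> - real DIM('a) / p" "0 < \<gamma>" "\<gamma> \<le> 1 - s"
    and le: "ennreal (1 - s) * gagliardo s p u epowr p \<le> ennreal (b powr p)"
  shows "(\<integral>\<^sup>+z. ennreal ((\<bar>hquot \<alpha> u z\<bar> / \<mu>) powr p) \<partial>(lborel \<Otimes>\<^sub>M lborel)) \<le> ennreal ((b / \<mu>) powr p / \<gamma>)"
proof -
  let ?J = "\<integral>\<^sup>+z. ennreal (\<bar>hquot \<alpha> u z\<bar> powr p) \<partial>(lborel \<Otimes>\<^sub>M lborel)"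
  have J: "gagliardo s p u epowr p = ?J"
    using p by (simp add: gagliardo_eq s(1) epowr_epowr_inverse)
  have "ennreal \<gamma> * ?J \<le> ennreal (1 - s) * ?J"
    using s by (intro mult_right_mono ennreal_leI) auto
  also have "\<dots> \<le> ennreal (b powr p)" using le J by simp
  finally have "ennreal (1 / \<gamma> * (1 / \<mu>) powr p) * (ennreal \<gamma> * ?J) \<le> ennreal (1 / \<gamma> * (1 / \<mu>) powr p) * ennreal (b powr p)"
    by (rule mult_left_mono) simp
  also have "\<dots> = ennreal ((b / \<mu>) powr p / \<gamma>)"
    using s \<mu> b by (simp add: powr_divide flip: ennreal_mult)
  also have "ennreal (1 / \<gamma> * (1 / \<mu>) powr p) * (ennreal \<gamma> * ?J) = ennreal ((1 / \<mu>) powr p) * ?J"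
    using s by (simp flip: ennreal_mult mult.assoc)
  also have "\<dots> = (\<integral>\<^sup>+z. ennreal ((1 / \<mu>) powr p) * ennreal (\<bar>hquot \<alpha> u z\<bar> powr p) \<partial>(lborel \<Otimes>\<^sub>M lborel))"
    by (intro nn_integral_cmult[symmetric]) measurable
  also have "\<dots> = (\<integral>\<^sup>+z. ennreal ((\<bar>hquot \<alpha> u z\<bar> / \<mu>) powr p) \<partial>(lborel \<Otimes>\<^sub>M lborel))"
    using \<mu> by (intro nn_integral_cong) (simp add: powr_divide flip: ennreal_mult)
  finally show ?thesis .
qed

text \<open>If the claim failed for a large p, some \<open>G\<close> would have quotients with p-th
  root below b, and smoothing it would give an admissible set with quotients at most M, below
  \<open>Lambda_infty k \<alpha> \<Omega>\<close>. The levels are ordered b < \<mu> < l' < l < M: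
  the first gap makes \<kappa> decay, and the others pay for the inner radius, the error \<kappa>
  and the normalisation, in this order. Each of \<eta>, r, d, \<delta>, c is fixed in terms of the
  previous ones, and p last.\<close>

lemma eventually_less_lambda_p:
  fixes \<Omega> :: "'a::euclidean_space set"
  assumes \<Omega>: "open \<Omega>" "bounded \<Omega>" "lipschitz_set \<Omega>" and \<alpha>: "0 < \<alpha>" "\<alpha> < 1"
    and less: "a < Lambda_infty k \<alpha> \<Omega>"
  shows "eventually (\<lambda>p. a < lambda_p k (\<alpha> - real DIM('a) / p) p \<Omega> epowr (1 / p)) at_top"
proof -
  obtain x where x: "a < x" "x < Lambda_infty k \<alpha> \<Omega>" using less dense by blast
  obtain y where y: "x < y" "y < Lambda_infty k \<alpha> \<Omega>" using x dense by blast
  obtain z where z: "y < z" "z < Lambda_infty k \<alpha> \<Omega>" using y dense by blast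
  obtain M where M: "z = ennreal M" "0 \<le> M" using z(2) by (cases z) auto
  obtain \<mu> where \<mu>y: "y = ennreal \<mu>" "0 \<le> \<mu>" using y(2) by (cases y) auto
  obtain b where b: "x = ennreal b" "0 \<le> b" using x(2) by (cases x) auto
  have b\<mu>: "b < \<mu>" and \<mu>M: "\<mu> < M"
    using y(1) z(1) M \<mu>y b by (auto simp: ennreal_less_iff)
  have \<mu>: "0 < \<mu>" using b b\<mu> by linarith
  define l where "l = (\<mu> + M) / 2"
  have l: "\<mu> < l" "l < M" "0 < l" using \<mu>M \<mu> by (auto simp: l_def)
  \<comment> \<open>The second entry gives \<open>2 * \<eta> \<le> 1 - l / M\<close>, so that
    division by the norm, at least \<open>1 - 2 * \<eta>\<close>, turns l into at most M.\<close>
  define \<eta> where "\<eta> = min (1 / 4) ((1 - l / M) / 2)"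
  have \<eta>: "0 < \<eta>" "\<eta> \<le> 1 / 4" "l \<le> (1 - 2 * \<eta>) * M"
  proof -
    have lM: "l / M < 1" using l by simp
    then show "0 < \<eta>" by (simp add: \<eta>_def)
    show "\<eta> \<le> 1 / 4" unfolding \<eta>_def by (rule min.cobounded1)
    have "\<eta> \<le> (1 - l / M) / 2" unfolding \<eta>_def by (rule min.cobounded2)
    then have "2 * \<eta> \<le> 1 - l / M" by simp
    then have "l / M * M \<le> (1 - 2 * \<eta>) * M" using l by (intro mult_right_mono) auto
    then show "l \<le> (1 - 2 * \<eta>) * M" using l by simp
  qed
  \<comment> \<open>Apart from \<open>\<delta> powr \<alpha>\<close>, this is the base of the p-th
    power in the error term of the mass condition. Keeping
    \<open>A * \<delta> powr \<alpha> \<le> 1\<close> prevents that power from growing with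
    p.\<close>
  define A where "A = 2 * \<mu> * (1 + (1 - 3 * \<eta> / 4) / (\<eta> / 4))"
  have "0 \<le> (1 - 3 * \<eta> / 4) / (\<eta> / 4)" using \<eta> by (intro divide_nonneg_pos) auto
  then have A: "0 < A" using \<mu> by (auto simp: A_def intro!: mult_pos_pos)
  \<comment> \<open>The largest radius allowed by both requirements, an oscillation of at most
    \<eta> / 4 and \<open>A * r powr \<alpha> \<le> 1\<close>.\<close>
  define r where "r = min (\<eta> / (4 * l)) (1 / A) powr (1 / \<alpha>)"
  have r\<alpha>: "r powr \<alpha> = min (\<eta> / (4 * l)) (1 / A)"
    using \<eta> l A \<alpha> by (simp add: r_def powr_powr)
  have r: "0 < r" "4 * l * r powr \<alpha> \<le> \<eta>" "A * r powr \<alpha> \<le> 1"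
  proof -
    show "0 < r" unfolding r_def using \<eta> l A by (subst powr_gt_zero) (simp add: min_def)
    have "4 * l * r powr \<alpha> \<le> 4 * l * (\<eta> / (4 * l))" unfolding r\<alpha> using l by (intro mult_left_mono) auto
    then show "4 * l * r powr \<alpha> \<le> \<eta>" using l by simp
    have "A * r powr \<alpha> \<le> A * (1 / A)" unfolding r\<alpha> using A by (intro mult_left_mono) auto
    then show "A * r powr \<alpha> \<le> 1" using A by simp
  qed
  define C where "C = 2 * 4 ^ DIM('a) * 2 powr \<alpha>"
  have C: "1 \<le> C"
  proof -
    have "1 * 1 * 1 \<le> 2 * (4::real) ^ DIM('a) * 2 powr \<alpha>"
      using \<alpha> by (intro mult_mono ge_one_powr_ge_zero) auto
    then show ?thesis by (simp add: C_def)
  qed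
  \<comment> \<open>The solution of \<open>C * (d / r) powr (1 - \<alpha>) = 1\<close>, the
    condition \<open>small\<close> of \<open>tent_mean_holder\<close>.\<close>
  define d where "d = (1 / C) powr (1 / (1 - \<alpha>)) * r"
  have d: "0 < d" "d \<le> r" "C * (d / r) powr (1 - \<alpha>) \<le> 1"
  proof -
    show "0 < d" using C r by (simp add: d_def)
    have "(1 / C) powr (1 / (1 - \<alpha>)) \<le> 1" using C \<alpha> by (intro powr_le1) auto
    then show "d \<le> r" using r mult_right_mono[of "(1 / C) powr (1 / (1 - \<alpha>))" 1 r] by (simp add: d_def)
    show "C * (d / r) powr (1 - \<alpha>) \<le> 1" using C r \<alpha> by (simp add: d_def powr_powr)
  qed
  define l' where "l' = (\<mu> + l) / 2"
  have l': "\<mu> < l'" "l' < l" using l by (auto simp: l'_def)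
  \<comment> \<open>The second entry makes \<open>(1 + 2 * \<delta> / d) * \<mu>\<close> at most the
    midpoint l' of \<mu> and l; the first keeps 2 \<delta> below d.\<close>
  define \<delta> where "\<delta> = min (1 / 2) ((l - \<mu>) / (4 * \<mu>)) * d"
  have \<delta>: "0 < \<delta>" "2 * \<delta> \<le> d" "(1 + 2 * \<delta> / d) * \<mu> \<le> l'"
  proof -
    show "0 < \<delta>" using l \<mu> d by (simp add: \<delta>_def)
    have "min (1 / 2) ((l - \<mu>) / (4 * \<mu>)) * d \<le> 1 / 2 * d" using d by (intro mult_right_mono) auto
    then show "2 * \<delta> \<le> d" by (simp add: \<delta>_def)
    have "min (1 / 2) ((l - \<mu>) / (4 * \<mu>)) \<le> (l - \<mu>) / (4 * \<mu>)" by (rule min.cobounded2)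
    moreover have "2 * \<delta> / d = 2 * min (1 / 2) ((l - \<mu>) / (4 * \<mu>))" using d by (simp add: \<delta>_def)
    ultimately have "2 * \<delta> / d \<le> 2 * ((l - \<mu>) / (4 * \<mu>))" by linarith
    then have "(1 + 2 * \<delta> / d) * \<mu> \<le> (1 + 2 * ((l - \<mu>) / (4 * \<mu>))) * \<mu>" using \<mu> by (intro mult_right_mono) auto
    also have "\<dots> = l'" using \<mu> by (simp add: l'_def field_simps)
    finally show "(1 + 2 * \<delta> / d) * \<mu> \<le> l'" .
  qed
  have osc: "(1 + 2 * \<delta> / d) powr \<alpha> * \<mu> \<le> l'"
  proof -
    have "(1 + 2 * \<delta> / d) powr \<alpha> \<le> (1 + 2 * \<delta> / d) powr 1"
      using \<delta> d \<alpha> by (intro powr_mono) auto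
    also have "\<dots> = 1 + 2 * \<delta> / d" using \<delta>(1) d(1) by simp
    finally have "(1 + 2 * \<delta> / d) powr \<alpha> * \<mu> \<le> (1 + 2 * \<delta> / d) * \<mu>"
      using \<mu> by (intro mult_right_mono) auto
    then show ?thesis using \<delta>(3) by linarith
  qed
  obtain c where c: "0 < c" "\<And>x. x \<notin> \<Omega> \<Longrightarrow> c \<le> measure lborel (ball x \<delta> - \<Omega>)"
    using exterior_measure_bound[OF \<Omega> \<delta>(1)] by blast
  define \<beta> where "\<beta> = measure lborel (ball (0::'a) \<delta>)"
  have \<beta>: "0 < \<beta>" using \<delta> by (simp add: \<beta>_def)
  \<comment> \<open>The bound of \<open>nn_integral_hquot_scaled_le\<close> with
    \<open>\<gamma> = 1 - \<alpha>\<close>. It decays exponentially in p because b < \<mu>, while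
    \<beta> and c do not depend on p.\<close>
  define \<kappa> where "\<kappa> p = (b / \<mu>) powr p / (1 - \<alpha>)" for p
  have \<kappa>_small: "eventually (\<lambda>p. \<kappa> p \<le> e) at_top" if "0 < e" for e
    using eventually_powr_mult_le[of "b / \<mu>" e "1 / (1 - \<alpha>)"] b b\<mu> \<mu> that by (simp add: \<kappa>_def)
  have "eventually (\<lambda>p. \<kappa> p \<le> (l / l' - 1) * (\<beta> * \<beta>)) at_top"
    "eventually (\<lambda>p. \<kappa> p \<le> (l / \<mu> - 1) * (\<beta> * c)) at_top"
    "eventually (\<lambda>p. \<kappa> p \<le> 1 / 4 * \<beta>) at_top"
    using l l' \<mu> \<beta> c by (intro \<kappa>_small mult_pos_pos; simp)+
  moreover have "eventually (\<lambda>p. (1 - \<eta> / 2) powr p * measure lborel \<Omega> \<le> 1 / 4) at_top"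
    using \<eta> by (intro eventually_powr_mult_le) auto
  moreover have "eventually (\<lambda>p::real. 1 \<le> p) at_top" by (rule eventually_ge_at_top)
  ultimately show ?thesis
  proof eventually_elim
    case (elim p)
    define s where "s = \<alpha> - real DIM('a) / p"
    have p0: "0 < p" using elim by simp
    have \<kappa>0: "0 \<le> \<kappa> p" using \<alpha> by (simp add: \<kappa>_def)
    \<comment> \<open>The weight stays away from 0, so removing it from the energy costs only the
      constant factor 1 / (1 - \<alpha>) in \<kappa>.\<close>
    have s: "1 - \<alpha> \<le> 1 - s" using p0 by (simp add: s_def)
    show ?case
    proof (rule ccontr)
      assume "\<not> ?thesis"
      then have "lambda_p k s p \<Omega> epowr (1 / p) \<le> a" by (simp add: s_def not_less)
      then have "lambda_p k s p \<Omega> epowr (1 / p) < ennreal b" using x(1) b by simp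
      then have "lambda_p k s p \<Omega> < ennreal (b powr p)"
        using epowr_le_iff[of "p" "lambda_p k s p \<Omega>"] epowr_mono[of "1 / p" "ennreal (b powr p)" "lambda_p k s p \<Omega>"]
          p0 b(2) by (force simp: epowr_ennreal powr_powr not_le[symmetric])
      then obtain G where G: "G \<in> \<G>_p k s p \<Omega>"
        and sup: "(SUP v\<in>G. ennreal (1 - s) * gagliardo s p v epowr p / Lp_norm p v epowr p) < ennreal (b powr p)"
        unfolding lambda_p_def INF_less_iff by blast
      have J: "(\<integral>\<^sup>+z. ennreal ((\<bar>hquot \<alpha> u z\<bar> / \<mu>) powr p) \<partial>(lborel \<Otimes>\<^sub>M lborel)) \<le> ennreal (\<kappa> p)"
        if u: "u \<in> G" for u
      proof -
        have uG: "u \<in> borel_measurable borel" "Lp_norm p u = 1"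
          using G u by (auto simp: \<G>_p_def genus_family_def Wsp0_def Wsp_def)
        have "ennreal (1 - s) * gagliardo s p u epowr p / Lp_norm p u epowr p \<le> ennreal (b powr p)"
          using SUP_lessD[OF sup u] by simp
        then have "ennreal (1 - s) * gagliardo s p u epowr p \<le> ennreal (b powr p)"
          using uG(2) epowr_ennreal[of 1 p] by (simp add: divide_ennreal_def)
        then show ?thesis
          unfolding \<kappa>_def using uG(1) p0 \<mu> b(2) s_def s \<alpha> by (intro nn_integral_hquot_scaled_le) auto
      qed
      have "(1 + 2 * \<delta> / d) powr \<alpha> * \<mu> * (1 + \<kappa> p / (\<beta> * \<beta>)) \<le> l' * (l / l')"
      proof (rule mult_mono[OF osc])
        show "1 + \<kappa> p / (\<beta> * \<beta>) \<le> l / l'"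
          using elim(1) \<beta> by (simp add: pos_divide_le_eq[symmetric])
      qed (use l' \<mu> \<kappa>0 \<beta> in auto)
      then have l_osc: "(1 + 2 * \<delta> / d) powr \<alpha> * \<mu> * (1 + \<kappa> p / (\<beta> * \<beta>)) \<le> l"
        using l' \<mu> by simp
      have "\<mu> * (1 + \<kappa> p / (\<beta> * c)) \<le> \<mu> * (l / \<mu>)"
      proof (rule mult_left_mono)
        show "1 + \<kappa> p / (\<beta> * c) \<le> l / \<mu>"
          using elim(2) \<beta> c(1) by (simp add: pos_divide_le_eq[symmetric])
      qed (use \<mu> in auto)
      then have l_ext: "\<mu> * (1 + \<kappa> p / (\<beta> * c)) \<le> l" using \<mu> by simp
      have "(2 * \<delta> powr \<alpha> * \<mu> * (1 + (1 - 3 * \<eta> / 4) / (\<eta> / 4))) powr p \<le> 1 powr p"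
      proof (rule powr_mono2)
        have "2 * \<delta> powr \<alpha> * \<mu> * (1 + (1 - 3 * \<eta> / 4) / (\<eta> / 4)) = A * \<delta> powr \<alpha>"
          by (simp add: A_def)
        moreover have "A * \<delta> powr \<alpha> \<le> A * r powr \<alpha>"
          using A \<delta> d \<alpha> by (intro mult_left_mono powr_mono2) auto
        moreover have "0 \<le> A * \<delta> powr \<alpha>" using A by simp
        ultimately show "2 * \<delta> powr \<alpha> * \<mu> * (1 + (1 - 3 * \<eta> / 4) / (\<eta> / 4)) \<le> 1"
          "0 \<le> 2 * \<delta> powr \<alpha> * \<mu> * (1 + (1 - 3 * \<eta> / 4) / (\<eta> / 4))"
          using r(3) by linarith+
      qed (use p0 in simp)
      then have "(2 * \<delta> powr \<alpha> * \<mu> * (1 + (1 - 3 * \<eta> / 4) / (\<eta> / 4))) powr p * (\<kappa> p / \<beta>) \<le> 1 * (1 / 4)"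
        using elim(3) \<beta> \<kappa>0 by (intro mult_mono) (auto simp: pos_divide_le_eq)
      then have mass: "measure lborel \<Omega> * (1 - \<eta> / 2) powr p
          + (2 * \<delta> powr \<alpha> * \<mu> * (1 + (1 - 3 * \<eta> / 4) / (\<eta> / 4))) powr p * (\<kappa> p / \<beta>) < 1"
        using elim(4) by (simp add: mult.commute)
      have "{v \<in> C_0_holder \<alpha> \<Omega>. ennreal (norm v) = 1 \<and> holder_seminorm \<alpha> v \<le> ennreal M} \<in> \<G>_infty k \<alpha> \<Omega>"
        using \<delta> d by (intro smoothed_sublevel_in_\<G>_infty[OF \<Omega>(1,2) \<alpha> elim(5) G \<mu> \<kappa>0 J \<delta>(1) _ d(1,2) c \<beta>_def
              l_osc l_ext _ \<eta>(1,2) r(2) mass \<eta>(3)]) (auto simp: C_def)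
      then have "Lambda_infty k \<alpha> \<Omega> \<le> ennreal M"
        unfolding Lambda_infty_def
        by (rule INF_lower2) (auto intro!: SUP_least simp: divide_ennreal_def)
      then show False using z(2) M by simp
    qed
  qed
qed

theorem theorem4p4:
  fixes \<Omega> :: "'a::euclidean_space set" and \<alpha> :: real and k :: nat
  assumes "\<Omega> \<noteq> {}" and "open \<Omega>" and "bounded \<Omega>" and "lipschitz_set \<Omega>"
    and "0 < \<alpha>" and "\<alpha> < 1" and "k \<ge> 1"
  shows "((\<lambda>p::real. lambda_p k (\<alpha> - real DIM('a) / p) p \<Omega> epowr (1 / p))
           \<longlongrightarrow> Lambda_infty k \<alpha> \<Omega>) at_top"
  using assms by (intro order_tendstoI eventually_less_lambda_p eventually_lambda_p_less)

end
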